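(* For $l\ge0$ put $$a_l=\frac12\int_{-1}^{1}|t|P_l(t)\,dt.$$ Then $a_0=1/2$, $a_l=0$ for odd $l$, and, for $j\ge1$, $$a_{2j}=(-1)^{j-1}\frac{(2j-3)!!}{(2j+2)!!};$$ in particular $a_2=\frac18$, $a_4=-\frac1{48}$, $a_6=\frac1{128}$, $a_8=-\frac1{256}$. Let $U$ be uniformly distributed on $S^2$. If $Z\subset\mathbb{R}^3$ is a zonoid with unique even generating measure $\mu_Z$ and $W_Z=w_Z(U)$, then $$\operatorname{Var}W_Z=\sum_{j\ge1}a_{2j}^2\sum_{m=-2j}^{2j}\left|(\widehat{\mu_Z})_{2j,m}\right|^2.$$ If $K\subset\mathbb{R}^3$ is a convex body, $B_K=b_K(U)$, and $(S_K)_e$ is the even part of its surface-area measure, then $$\operatorname{Var}B_K=\frac14\sum_{j\ge1}a_{2j}^2\sum_{m=-2j}^{2j}\left|(\widehat{(S_K)_e})_{2j,m}\right|^2.$$ Equivalently, the kernel $k_2(\rho)=\frac{2}{3\pi}\left(\sqrt{1-\rho^2}+\rho\arcsin\rho\right)-\frac14$ has the $L^2$ zonal expansion $$k_2(|n\cdot n'|)=\sum_{j\ge1}(4j+1)a_{2j}^2P_{2j}(n\cdot n').$$ For every fixed even $L\ge2$ one has the finite-band stability estimate $$\sum_{\substack{2\le l\le L\\ l\text{ even}}}\sum_{m=-l}^{l}\left|(\widehat{\mu_Z})_{lm}\right|^2\le\frac{\operatorname{Var}W_Z}{\min_{2\le l\le L,\ l\text{ even}}|a_l|^2}.$$ There is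 no corresponding uniform all-degree estimate of this form (that is, there is no finite constant $C$ with $\sum_{l\ge2,\ l\text{ even}}\sum_{m=-l}^{l}|(\widehat{\mu_Z})_{lm}|^2\le C\operatorname{Var}W_Z$ for all zonoids $Z$), because $a_{2j}\to0$.
   Context: $P_l$ is the Legendre polynomial of degree $l$. $\sigma$ is the rotation-invariant probability measure on $S^2$; $(Y_{lm})_{-l\le m\le l}$ are spherical harmonics of degree $l$, orthonormal in $L^2(S^2,\sigma)$. For a finite signed Borel measure $\nu$ on $S^2$, $\hat\nu_{lm}=\int_{S^2}\overline{Y_{lm}(n)}\,d\nu(n)$ and its even part is $\nu_e=(\nu+\nu^-)/2$ with $\nu^-(E)=\nu(-E)$. For a compact convex body $K$ and $u\in S^2$: $w_K(u)=\max_{x\in K}u\cdot x-\min_{x\in K}u\cdot x$ is the width, and the brightness $b_K(u)$ is the area of the orthogonal projection of $K$ onto $u^{\perp}$. The even generating measure of a zonoid $Z$ is the unique finite even positive Borel measure $\mu_Z$ with $w_Z(u)=\int_{S^2}|u\cdot n|\,d\mu_Z(n)$; the surface-area measure satisfies $b_K(u)=\frac12\int_{S^2}|u\cdot n|\,dS_K(n)$. Double factorial convention: $(-1)!!=1$. *)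

theory Defs
  imports "HOL-Probability.Probability" "HOL-Computational_Algebra.Polynomial"
begin

text \<open>Legendre polynomials by Rodrigues' formula.\<close>

definition legendre :: "nat \<Rightarrow> real poly" where
  "legendre l = smult (1 / (2 ^ l * fact l)) ((pderiv ^^ l) ([:-1, 0, 1:] ^ l))"

definition abs_coeff :: "nat \<Rightarrow> real" where
  "abs_coeff l = 1 / 2 * integral {-1..1} (\<lambda>t. \<bar>t\<bar> * poly (legendre l) t)"

text \<open>
  \<open>n (n - 2) (n - 4) \<cdots>\<close> over the positive factors; the argument is an integer
  because \<open>(-1)!! = 1\<close> (the empty product) is needed.
\<close>

definition double_factorial :: "int \<Rightarrow> int" where
  "double_factorial n = \<Prod>{k. 1 \<le> k \<and> k \<le> n \<and> even (n - k)}"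

definition kernel2 :: "real \<Rightarrow> real" where
  "kernel2 \<rho> = 2 / (3 * pi) * (sqrt (1 - \<rho>\<^sup>2) + \<rho> * arcsin \<rho>) - 1 / 4"


section \<open>The sphere and its rotation-invariant probability measure\<close>

abbreviation S2 :: "(real^3) set" where
  "S2 \<equiv> sphere 0 1"

definition sphere_borel :: "(real^3) measure" where
  "sphere_borel = restrict_space borel S2"

definition radial_proj :: "real^3 \<Rightarrow> real^3" where
  "radial_proj x = (if x = 0 then axis 1 1 else sgn x)"

text \<open>
  The law of \<open>x / norm x\<close> for \<open>x\<close> uniform in the unit ball. The lemmas
  \<open>prob_space_sphere_measure\<close> and \<open>sphere_measure_rotation_invariant\<close> below identify it as
  the rotation-invariant Borel probability measure on the sphere. The value of
  \<^const>\<open>radial_proj\<close> at the origin is irrelevant.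
\<close>

definition sphere_measure :: "(real^3) measure" where
  "sphere_measure = distr (uniform_measure lborel (ball 0 1)) sphere_borel radial_proj"

lemma space_sphere_borel [simp]: "space sphere_borel = S2"
  by (simp add: sphere_borel_def space_restrict_space)

lemma sets_sphere_borel: "sets sphere_borel = {E. E \<in> sets borel \<and> E \<subseteq> S2}"
  unfolding sphere_borel_def by (subst sets_restrict_space_iff[symmetric] | auto simp: sets_restrict_space)+

lemma sets_sphere_measure [simp]: "sets sphere_measure = sets sphere_borel"
  by (simp add: sphere_measure_def)

lemma space_sphere_measure [simp]: "space sphere_measure = S2"
  by (simp add: sphere_measure_def)

lemma radial_proj_measurable: "radial_proj \<in> measurable borel sphere_borel"
  unfolding sphere_borel_def
proof (rule measurable_restrict_space2)
  show "radial_proj \<in> space borel \<rightarrow> S2"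
    by (auto simp: radial_proj_def norm_sgn)
  show "radial_proj \<in> borel_measurable borel"
    unfolding radial_proj_def[abs_def] sgn_div_norm by measurable
qed

lemma prob_space_uniform_ball: "prob_space (uniform_measure lborel (ball (0::real^3) 1))"
  by (rule prob_space_uniform_measure) (simp_all add: emeasure_lborel_ball_finite less_top[symmetric]
     emeasure_ball unit_ball_vol_pos ennreal_eq_0_iff not_le)

lemma prob_space_sphere_measure: "prob_space sphere_measure"
  unfolding sphere_measure_def
  by (rule prob_space.prob_space_distr[OF prob_space_uniform_ball])
     (use radial_proj_measurable in \<open>simp add: measurable_def\<close>)

lemma emeasure_uniform_ball_orthogonal:
  assumes f: "orthogonal_transformation (f :: real^3 \<Rightarrow> real^3)" and X: "X \<in> sets borel"
  shows "emeasure lborel (ball 0 1 \<inter> f -` X) = emeasure lborel (ball 0 1 \<inter> X)"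
proof -
  obtain g where g: "orthogonal_transformation g" "\<And>x. f (g x) = x" "\<And>x. g (f x) = x"
    by (metis f orthogonal_transformation_inv orthogonal_transformation_bij bij_inv_eq_iff)
  let ?B = "ball 0 1 :: (real^3) set"
  have eq: "?B \<inter> f -` X = g ` (?B \<inter> X)"
  proof (intro equalityI subsetI)
    fix x assume "x \<in> ?B \<inter> f -` X"
    then have "f x \<in> ?B \<inter> X" using f by (simp add: orthogonal_transformation)
    then show "x \<in> g ` (?B \<inter> X)" using g(3) by (metis imageI)
  next
    fix x assume "x \<in> g ` (?B \<inter> X)"
    then show "x \<in> ?B \<inter> f -` X" using g by (auto simp: orthogonal_transformation)
  qed
  have BX: "?B \<inter> X \<in> sets borel" using X by simp
  have bd: "bounded (?B \<inter> X)" by (meson bounded_ball bounded_Int)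
  have m: "?B \<inter> X \<in> lmeasurable"
    using BX bd by (intro bounded_set_imp_lmeasurable) auto
  have gm: "g ` (?B \<inter> X) \<in> lmeasurable"
    by (rule measurable_orthogonal_image[OF g(1) m])
  have "f \<in> borel_measurable borel"
    by (intro borel_measurable_continuous_onI linear_continuous_on)
       (use f in \<open>auto simp: orthogonal_transformation_def linear_linear\<close>)
  then have "f -` X \<in> sets borel" using X
    by (metis measurable_sets_borel)
  then have b2: "?B \<inter> f -` X \<in> sets borel" by simp
  have "emeasure lborel (?B \<inter> f -` X) = emeasure lebesgue (?B \<inter> f -` X)"
    using b2 by simp
  also have "\<dots> = ennreal (measure lebesgue (g ` (?B \<inter> X)))"
    using gm eq by (simp add: emeasure_eq_measure2 fmeasurableD2)
  also have "\<dots> = ennreal (measure lebesgue (?B \<inter> X))"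
    by (simp only: measure_orthogonal_image[OF g(1) m])
  also have "\<dots> = emeasure lebesgue (?B \<inter> X)"
    using m by (simp add: emeasure_eq_measure2 fmeasurableD2)
  also have "\<dots> = emeasure lborel (?B \<inter> X)" using BX by simp
  finally show ?thesis .
qed

lemma sphere_measure_rotation_invariant:
  assumes "rotation_matrix (A :: real^3^3)"
  shows "distr sphere_measure sphere_borel (\<lambda>x. A *v x) = sphere_measure"
proof -
  let ?f = "\<lambda>x. A *v x" and ?m = "uniform_measure lborel (ball (0::real^3) 1)"
  have f: "orthogonal_transformation ?f"
    using assms by (auto simp: orthogonal_transformation_matrix rotation_matrix_def)
  have nf: "norm (A *v x) = norm x" for x using f by (simp add: orthogonal_transformation)
  have fm: "?f \<in> borel_measurable borel"
    by (intro borel_measurable_continuous_onI linear_continuous_on) (auto simp: linear_linear[symmetric])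
  have fS: "?f \<in> measurable sphere_borel sphere_borel"
    unfolding sphere_borel_def
    by (intro measurable_restrict_space2 measurable_restrict_space1 fm) (auto simp: space_restrict_space nf)
  have rp: "radial_proj \<in> measurable ?m sphere_borel"
    using radial_proj_measurable by (simp add: measurable_def)
  have fmm: "?f \<in> measurable ?m borel" using fm by (simp add: measurable_def)
  have inv: "distr ?m borel ?f = ?m"
  proof (rule measure_eqI)
    fix E assume "E \<in> sets (distr ?m borel ?f)"
    then have E: "E \<in> sets borel" by simp
    have pre: "?f -` E \<in> sets borel" using fm E by (metis measurable_sets_borel)
    have "emeasure (distr ?m borel ?f) E = emeasure ?m (?f -` E)"
      using E fmm by (simp add: emeasure_distr)
    also have "\<dots> = emeasure ?m E"
      using emeasure_uniform_ball_orthogonal[OF f E] pre E by simp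
    finally show "emeasure (distr ?m borel ?f) E = emeasure ?m E" .
  qed simp
  have "distr sphere_measure sphere_borel ?f = distr ?m sphere_borel (?f \<circ> radial_proj)"
    unfolding sphere_measure_def by (rule distr_distr[OF fS rp])
  also have "\<dots> = distr ?m sphere_borel (radial_proj \<circ> ?f)"
  proof (rule distr_cong_AE[OF refl])
    have "AE x in lborel. x \<noteq> (0::real^3)"
      by (rule AE_lborel_singleton)
    then have "AE x in ?m. x \<noteq> 0"
      by (intro AE_uniform_measureI) auto
    then show "AE x in ?m. (?f \<circ> radial_proj) x = (radial_proj \<circ> ?f) x"
    proof (rule AE_mp, intro AE_I2 impI)
      fix x :: "real^3" assume x: "x \<noteq> 0"
      have "A *v x \<noteq> 0" using nf[of x] x by auto
      then show "(?f \<circ> radial_proj) x = (radial_proj \<circ> ?f) x"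
        using x by (simp add: radial_proj_def sgn_div_norm nf matrix_vector_mult_scaleR)
    qed
    show "?f \<circ> radial_proj \<in> measurable ?m sphere_borel" by (rule measurable_comp[OF rp fS])
    show "radial_proj \<circ> ?f \<in> measurable ?m sphere_borel"
      by (rule measurable_comp[OF fmm radial_proj_measurable])
  qed simp
  also have "\<dots> = distr (distr ?m borel ?f) sphere_borel radial_proj"
    by (rule distr_distr[symmetric, OF radial_proj_measurable fmm])
  also have "\<dots> = sphere_measure" unfolding inv sphere_measure_def ..
  finally show ?thesis .
qed


section \<open>Spherical harmonics\<close>

definition homogeneous_polynomial :: "nat \<Rightarrow> (real^3 \<Rightarrow> complex) \<Rightarrow> bool" where
  "homogeneous_polynomial l p \<longleftrightarrow>
    (\<exists>c :: nat \<Rightarrow> nat \<Rightarrow> nat \<Rightarrow> complex. \<forall>x.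
      p x = (\<Sum>(i, j, k) \<in> {(i, j, k). i + j + k = l}.
               c i j k * of_real ((x $ 1) ^ i * (x $ 2) ^ j * (x $ 3) ^ k)))"

definition laplacian :: "(real^3 \<Rightarrow> complex) \<Rightarrow> real^3 \<Rightarrow> complex" where
  "laplacian f x =
    (\<Sum>b\<in>Basis. vector_derivative
      (\<lambda>s. vector_derivative (\<lambda>t. f (x + t *\<^sub>R b)) (at s)) (at 0))"

definition spherical_harmonic :: "nat \<Rightarrow> (real^3 \<Rightarrow> complex) \<Rightarrow> bool" where
  "spherical_harmonic l f \<longleftrightarrow>
    (\<exists>p. homogeneous_polynomial l p \<and> (\<forall>x. laplacian p x = 0) \<and> (\<forall>n\<in>S2. f n = p n))"

text \<open>
  \<open>Y l m\<close> matters only for \<open>-l \<le> m \<le> l\<close> and only on the sphere. The space of spherical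
  harmonics of degree \<open>l\<close> has dimension \<open>2 l + 1\<close>, so each \<open>Y l\<close> is a basis of it.
\<close>

definition orthonormal_harmonics :: "(nat \<Rightarrow> int \<Rightarrow> real^3 \<Rightarrow> complex) \<Rightarrow> bool" where
  "orthonormal_harmonics Y \<longleftrightarrow>
    (\<forall>l. \<forall>m\<in>{-int l..int l}. spherical_harmonic l (Y l m)) \<and>
    (\<forall>l l'. \<forall>m\<in>{-int l..int l}. \<forall>m'\<in>{-int l'..int l'}.
      (\<integral>n. Y l m n * cnj (Y l' m' n) \<partial>sphere_measure) = (if l = l' \<and> m = m' then 1 else 0))"

definition harmonic_coeff ::
    "(nat \<Rightarrow> int \<Rightarrow> real^3 \<Rightarrow> complex) \<Rightarrow> (real^3) measure \<Rightarrow> nat \<Rightarrow> int \<Rightarrow> complex" where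
  "harmonic_coeff Y \<nu> l m = (\<integral>n. cnj (Y l m n) \<partial>\<nu>)"


section \<open>Even measures and even parts\<close>

definition even_measure :: "(real^3) measure \<Rightarrow> bool" where
  "even_measure \<nu> \<longleftrightarrow> (\<forall>E\<in>sets \<nu>. emeasure \<nu> (uminus ` E) = emeasure \<nu> E)"

definition even_part :: "(real^3) measure \<Rightarrow> (real^3) measure" where
  "even_part \<nu> = measure_of (space \<nu>) (sets \<nu>)
    (\<lambda>E. (emeasure \<nu> E + emeasure \<nu> (uminus ` E)) / 2)"

lemma emeasure_even_part:
  assumes "sets \<nu> = sets sphere_borel" "E \<in> sets \<nu>"
  shows "emeasure (even_part \<nu>) E = (emeasure \<nu> E + emeasure \<nu> (uminus ` E)) / 2"
proof -
  have un: "uminus \<in> measurable \<nu> \<nu>"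
    unfolding measurable_cong_sets[OF assms(1) assms(1)] sphere_borel_def
    by (intro measurable_restrict_space2 measurable_restrict_space1) (auto simp: space_restrict_space)
  have sp: "space \<nu> = S2" using sets_eq_imp_space_eq[OF assms(1)] by simp
  have vi: "uminus -` E \<inter> space \<nu> = uminus ` E" if "E \<in> sets \<nu>" for E
  proof -
    have "E \<subseteq> S2" using that sets.sets_into_space[of E \<nu>] sp by simp
    then show ?thesis unfolding sp by (force simp: image_iff)
  qed
  have refl: "emeasure \<nu> (uminus ` E) = emeasure (distr \<nu> \<nu> uminus) E" if "E \<in> sets \<nu>" for E
    by (simp add: emeasure_distr[OF un that] vi[OF that])
  have ca: "countably_additive (sets \<nu>) (\<lambda>E. (emeasure \<nu> E + emeasure \<nu> (uminus ` E)) / 2)"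
  proof (rule countably_additiveI)
    fix A :: "nat \<Rightarrow> _" assume A: "range A \<subseteq> sets \<nu>" "disjoint_family A" "\<Union> (range A) \<in> sets \<nu>"
    have Ai: "A i \<in> sets \<nu>" for i using A(1) by auto
    have 1: "(\<Sum>i. emeasure \<nu> (A i)) = emeasure \<nu> (\<Union> (range A))"
      using A by (rule_tac suminf_emeasure) auto
    have 2: "(\<Sum>i. emeasure \<nu> (uminus ` A i)) = emeasure \<nu> (uminus ` \<Union> (range A))"
      unfolding refl[OF Ai] refl[OF A(3)] using A by (rule_tac suminf_emeasure) auto
    show "(\<Sum>i. (emeasure \<nu> (A i) + emeasure \<nu> (uminus ` A i)) / 2) =
        (emeasure \<nu> (\<Union> (range A)) + emeasure \<nu> (uminus ` \<Union> (range A))) / 2"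
      unfolding divide_ennreal_def ennreal_suminf_multc
      by (simp add: suminf_add[symmetric] 1 2)
  qed
  have se: "sets (even_part \<nu>) = sets \<nu>"
    by (simp add: even_part_def)
  show ?thesis
    by (rule emeasure_measure_of[OF even_part_def sets.space_closed])
       (use assms ca in \<open>simp_all only: se, simp_all add: positive_def\<close>)
qed


section \<open>Convex bodies, width, brightness\<close>

definition convex_body :: "(real^3) set \<Rightarrow> bool" where
  "convex_body K \<longleftrightarrow> compact K \<and> convex K \<and> K \<noteq> {}"

definition width :: "(real^3) set \<Rightarrow> real^3 \<Rightarrow> real" where
  "width K u = (SUP x\<in>K. u \<bullet> x) - (INF x\<in>K. u \<bullet> x)"

definition plane_isometry :: "real^3 \<Rightarrow> (real^2 \<Rightarrow> real^3) \<Rightarrow> bool" where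
  "plane_isometry u f \<longleftrightarrow> linear f \<and> (\<forall>y. norm (f y) = norm y) \<and> range f = {x. u \<bullet> x = 0}"

text \<open>
  Area in the plane orthogonal to \<open>u\<close>, transported from \<open>real^2\<close> along an arbitrary linear
  isometry; see \<open>plane_isometry_exists\<close> and \<open>plane_area_eq\<close> for independence of the choice.
\<close>

definition plane_area :: "real^3 \<Rightarrow> (real^3) set \<Rightarrow> real" where
  "plane_area u A = measure lebesgue ((SOME f. plane_isometry u f) -` A)"

lemma plane_isometry_exists:
  assumes "u \<in> S2"
  shows "\<exists>f. plane_isometry u f"
proof -
  have "u \<noteq> 0" using assms by auto
  then have d: "dim (UNIV :: (real^2) set) = dim {x. u \<bullet> x = 0}"
    by (simp add: dim_hyperplane)
  obtain f :: "real^2 \<Rightarrow> real^3" and g where "linear f" "f ` UNIV = {x. u \<bullet> x = 0}"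
      "\<And>x. x \<in> UNIV \<Longrightarrow> norm (f x) = norm x"
    using isometries_subspaces[OF subspace_UNIV subspace_hyperplane d] by metis
  then show ?thesis unfolding plane_isometry_def by blast
qed

lemma plane_area_eq:
  assumes f: "plane_isometry u f" and A: "compact A"
  shows "plane_area u A = measure lebesgue (f -` A)"
proof -
  define g where "g = (SOME f. plane_isometry u f)"
  have g: "plane_isometry u g" unfolding g_def by (rule someI[where P = "plane_isometry u", OF f])
  have inj: "h x = h y \<longleftrightarrow> x = y" if "plane_isometry u h" for h x y
  proof -
    have "norm (h x - h y) = norm (x - y)"
      using that unfolding plane_isometry_def by (metis linear_diff)
    then show ?thesis by auto
  qed
  define h where "h y = (THE x. g x = f y)" for y
  have gh: "g (h y) = f y" for y
  proof -
    have "f y \<in> range g" using f g unfolding plane_isometry_def by blast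
    then obtain x where "g x = f y" by auto
    then show ?thesis unfolding h_def by (metis (mono_tags, lifting) inj[OF g] the_equality)
  qed
  have lf: "linear f" and lg: "linear g" using f g by (auto simp: plane_isometry_def)
  have "linear h"
  proof (rule linearI)
    show "h (x + y) = h x + h y" for x y
      by (simp add: inj[OF g, symmetric] gh linear_add[OF lf] linear_add[OF lg])
    show "h (c *\<^sub>R x) = c *\<^sub>R h x" for c x
      by (simp add: inj[OF g, symmetric] gh linear_scale[OF lf] linear_scale[OF lg])
  qed
  moreover have "norm (h y) = norm y" for y
    using gh[of y] f g unfolding plane_isometry_def by metis
  ultimately have h: "orthogonal_transformation h" by (simp add: orthogonal_transformation)
  have "closed (f -` A)"
    by (intro continuous_closed_vimage compact_imp_closed A)
       (use lf in \<open>simp add: linear_linear linear_continuous_at\<close>)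
  moreover have "bounded (f -` A)"
  proof -
    obtain B where "\<forall>x\<in>A. norm x \<le> B" using A compact_imp_bounded bounded_iff by metis
    then have "\<forall>y\<in>f -` A. norm y \<le> B" using f unfolding plane_isometry_def by fastforce
    then show ?thesis using bounded_iff by blast
  qed
  ultimately have m: "f -` A \<in> lmeasurable"
    by (intro lmeasurable_compact) (simp add: compact_eq_bounded_closed)
  have "surj h" using h orthogonal_transformation_surj by blast
  have "g -` A = h ` (f -` A)"
  proof (intro equalityI subsetI)
    fix x assume "x \<in> g -` A"
    moreover obtain y where "x = h y" using \<open>surj h\<close> by blast
    ultimately show "x \<in> h ` (f -` A)" by (simp add: gh)
  qed (auto simp: gh)
  then show ?thesis
    unfolding plane_area_def g_def[symmetric]
    using measure_orthogonal_image[OF h m] by simp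
qed

definition brightness :: "(real^3) set \<Rightarrow> real^3 \<Rightarrow> real" where
  "brightness K u = plane_area u ((\<lambda>x. x - (u \<bullet> x) *\<^sub>R u) ` K)"


section \<open>Zonoids and generating measures\<close>

text \<open>The sum in \<open>zonotope\<close> is the Minkowski sum of sets.\<close>

definition zonotope :: "(real^3) set \<Rightarrow> bool" where
  "zonotope P \<longleftrightarrow> (\<exists>(N::nat) a b. P = (\<Sum>i<N. closed_segment (a i) (b i)))"

text \<open>Limits of zonotopes in the Hausdorff metric.\<close>

definition zonoid :: "(real^3) set \<Rightarrow> bool" where
  "zonoid Z \<longleftrightarrow> convex_body Z \<and>
    (\<forall>e>0. \<exists>P. zonotope P \<and> Z \<subseteq> (\<Union>x\<in>P. cball x e) \<and> P \<subseteq> (\<Union>x\<in>Z. cball x e))"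

definition generating_measure :: "(real^3) set \<Rightarrow> (real^3) measure \<Rightarrow> bool" where
  "generating_measure Z \<mu> \<longleftrightarrow>
    sets \<mu> = sets sphere_borel \<and> finite_measure \<mu> \<and> even_measure \<mu> \<and>
    (\<forall>u\<in>S2. width Z u = (\<integral>n. \<bar>u \<bullet> n\<bar> \<partial>\<mu>))"


section \<open>Surface-area measure\<close>

text \<open>
  \<open>local_parallel_set K E \<epsilon>\<close> consists of the points outside \<open>K\<close> at distance at most \<open>\<epsilon>\<close>
  whose direction from the nearest point of \<open>K\<close> lies in \<open>E\<close>. By the local Steiner formula its
  volume is a polynomial in \<open>\<epsilon>\<close> without constant term, and the surface-area measure of \<open>K\<close> is
  the coefficient of \<open>\<epsilon>\<close>. If \<open>K\<close> has interior points this is the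
  area of the set of boundary points having an outer unit normal in \<open>E\<close>; a planar \<open>K\<close>
  contributes its area once for each of its two normals.
\<close>

definition local_parallel_set :: "(real^3) set \<Rightarrow> (real^3) set \<Rightarrow> real \<Rightarrow> (real^3) set" where
  "local_parallel_set K E \<epsilon> =
    {x. 0 < infdist x K \<and> infdist x K \<le> \<epsilon> \<and> sgn (x - closest_point K x) \<in> E}"

definition surface_area_measure :: "(real^3) set \<Rightarrow> (real^3) measure \<Rightarrow> bool" where
  "surface_area_measure K S \<longleftrightarrow>
    sets S = sets sphere_borel \<and> finite_measure S \<and>
    (\<forall>E\<in>sets S.
      ((\<lambda>\<epsilon>. measure lebesgue (local_parallel_set K E \<epsilon>) / \<epsilon>) \<longlongrightarrow> measure S E) (at_right 0))"

end

theory Submission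
  imports Defs "HOL-Library.Function_Algebras"
begin

text \<open>
  For a finite measure \<open>\<nu>\<close> on the sphere put \<open>W u = \<integral>n. \<bar>u \<bullet> n\<bar> \<partial>\<nu>\<close>. By the Funk-Hecke formula the
  coefficient of \<open>W\<close> at a harmonic of degree \<open>l\<close> is \<open>abs_coeff l\<close> times that of \<open>\<nu>\<close>, so both
  variance formulas are Parseval's identity for \<open>W\<close> with the term \<open>l = 0\<close> removed.

  The Funk-Hecke formula is proved without averaging over rotations: infinitesimal rotation invariance
  gives \<open>d (d + 1) \<integral>p = \<integral>\<Delta>p\<close> for homogeneous \<open>p\<close> of degree \<open>d\<close>, and for \<open>p x = (u \<bullet> x) ^ k * f x\<close>
  this is a recursion in \<open>k\<close> which the Legendre moments satisfy as well. Completeness of the harmonics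
  is a dimension count.

  For the brightness it remains to see that \<open>b\<^bsub>K\<^esub> u\<close> is half the cosine transform of the surface
  area measure. On the shell \<open>0 < d \<le> \<epsilon>\<close>, with \<open>d\<close> the distance to \<open>K\<close>, the outer normal is the
  gradient of \<open>d\<close>, and \<open>d\<close> is convex along each line parallel to \<open>u\<close>. Its variation in the shell is
  \<open>2 \<epsilon>\<close> on the lines that meet \<open>K\<close>, at most \<open>2 \<epsilon>\<close> on the others, and zero on any given one of
  these once \<open>\<epsilon>\<close> is small. Dividing by \<open>\<epsilon>\<close> leaves twice the area of the projection.
\<close>

section \<open>Legendre polynomials\<close>

text \<open>What is used about \<open>sphere_measure\<close> is that it is a rotation-invariant
  probability measure; no slicing formula turning a zonal integral into one over [-1, 1] is at hand.
  So both sides of the Funk-Hecke formula are compared through recursions, and the slicing formula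
  of Archimedes comes out afterwards as its case of degree 0. In the same way the surface area
  measure is given only by limits over single Borel sets; integrals against it are therefore
  squeezed between finite sums over bands a \<le> |u . n|, with an error of 1/N times the total
  mass. The kernel k_2 is the covariance of |U . n| and |U . n'|, which is where the squares of
  a_{2j} come from; the proof finds its coefficients by integrating against P_l with the help of the
  Legendre equation. For the negative statement a single zonoid defeats every constant: a unit
  segment is generated by two atoms, its coefficients are values of harmonics at a point, and these
  are not square summable.\<close>

lemma pderiv_funpow_X_mult:
  "(pderiv ^^ Suc n) ([:0, 1:] * p) =
     [:0, 1:] * (pderiv ^^ Suc n) p + of_nat (Suc n) * (pderiv ^^ n) (p :: real poly)"
proof (induction n)
  case 0 then show ?case by (simp add: pderiv_mult pderiv_pCons)
next
  case (Suc n)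
  have "(pderiv ^^ Suc (Suc n)) ([:0, 1:] * p) = pderiv ((pderiv ^^ Suc n) ([:0, 1:] * p))" by simp
  also have "\<dots> = [:0,1:] * pderiv ((pderiv ^^ Suc n) p) + (pderiv ^^ Suc n) p + of_nat (Suc n) * pderiv ((pderiv ^^ n) p)"
    unfolding Suc.IH by (simp add: pderiv_add pderiv_mult pderiv_of_nat pderiv_pCons one_pCons[symmetric])
  finally show ?case by (simp add: algebra_simps)
qed

lemma quadratic_eq_X: "[:-1, 0, 1:] = [:0, 1:] * [:0, 1:] - (1 :: real poly)"
  by (simp add: one_pCons)

lemma pderiv_funpow_diff: "(pderiv ^^ n) (p - q) = (pderiv ^^ n) p - (pderiv ^^ n) (q :: real poly)"
  by (induction n arbitrary: p q) (simp_all add: pderiv_diff)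

lemma pderiv_funpow_of_nat_mult: "(pderiv ^^ n) (of_nat k * p) = of_nat k * (pderiv ^^ n) (p :: real poly)"
  by (induction n arbitrary: p) (simp_all add: pderiv_mult pderiv_of_nat)

text \<open>\<open>legendre\<close> without the factor 1 / (2^l l!); unnormalised, the recurrences
  keep integer coefficients.\<close>

definition rodrigues :: "nat \<Rightarrow> real poly" where
  "rodrigues l = (pderiv ^^ l) ([:-1, 0, 1:] ^ l)"

text \<open>Two ways of differentiating h^(k+2), h = X^2 - 1, k + 2 times: either take one
  derivative first, which leaves a multiple of X h^(k+1), or write h^(k+2) = X X h^(k+1) - h^(k+1)
  and apply the Leibniz rule twice. Both results contain \<open>q\<close>, which is one derivative
  short of a Rodrigues polynomial and has to be eliminated.\<close>

lemma rodrigues_Suc_Suc_aux: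
  fixes k :: nat
  defines "q \<equiv> (pderiv ^^ k) ([:-1, 0, 1:] ^ Suc k) :: real poly"
  shows "rodrigues (Suc (Suc k)) = of_nat (2 * (k + 2)) * ([:0, 1:] * rodrigues (Suc k) + of_nat (Suc k) * q)"
    and "rodrigues (Suc (Suc k)) = [:-1, 0, 1:] * pderiv (rodrigues (Suc k))
           + of_nat (2 * (k + 2)) * [:0, 1:] * rodrigues (Suc k) + of_nat ((k + 2) * (k + 1)) * q"
proof -
  let ?h = "[:-1, 0, 1:] :: real poly" and ?X = "[:0, 1:] :: real poly"
  have d: "pderiv (?h ^ Suc (Suc k)) = of_nat (2 * (k + 2)) * (?X * ?h ^ Suc k)"
    by (simp only: pderiv_power_Suc) (simp add: pderiv_pCons of_nat_poly field_simps)
  show "rodrigues (Suc (Suc k)) = of_nat (2 * (k + 2)) * (?X * rodrigues (Suc k) + of_nat (Suc k) * q)"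
    unfolding rodrigues_def funpow_Suc_right[of "Suc k"] o_def d pderiv_funpow_of_nat_mult
    by (simp only: pderiv_funpow_X_mult q_def)
  have e: "?h ^ Suc (Suc k) = ?X * (?X * ?h ^ Suc k) - ?h ^ Suc k"
    unfolding power_Suc[of ?h "Suc k"] by (subst quadratic_eq_X) (simp only: algebra_simps mult_1_left)
  have "rodrigues (Suc (Suc k)) =
     ?X * (?X * pderiv (rodrigues (Suc k)) + of_nat (k + 2) * rodrigues (Suc k)) +
      of_nat (k + 2) * (?X * rodrigues (Suc k) + of_nat (k + 1) * q) - pderiv (rodrigues (Suc k))"
    unfolding rodrigues_def e pderiv_funpow_diff pderiv_funpow_X_mult q_def by (simp add: algebra_simps)
  also have "\<dots> = ?h * pderiv (rodrigues (Suc k))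
           + of_nat (2 * (k + 2)) * ?X * rodrigues (Suc k) + of_nat ((k + 2) * (k + 1)) * q"
    unfolding quadratic_eq_X by (simp only: of_nat_mult of_nat_add) (simp only: algebra_simps, simp)
  finally show "rodrigues (Suc (Suc k)) = \<dots>" .
qed

lemma poly_legendre: "poly (legendre l) x = poly (rodrigues l) x / (2 ^ l * fact l)"
  and pderiv_legendre: "poly (pderiv (legendre l)) x = poly (pderiv (rodrigues l)) x / (2 ^ l * fact l)"
  by (simp_all add: legendre_def rodrigues_def pderiv_smult)

lemma legendre_0 [simp]: "legendre 0 = 1"
  by (simp add: legendre_def)

lemma legendre_1: "legendre (Suc 0) = [:0, 1:]"
  by (simp add: legendre_def pderiv_pCons)

text \<open>Twice the second expression of \<open>rodrigues_Suc_Suc_aux\<close> minus the first is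
  free of \<open>q\<close>. The formula for the derivative comes from differentiating the first
  expression, since the derivative of \<open>q\<close> is again a Rodrigues polynomial.\<close>

lemma rodrigues_rec:
  "poly (rodrigues (Suc l)) x =
     2 * ((x\<^sup>2 - 1) * poly (pderiv (rodrigues l)) x + (real l + 1) * x * poly (rodrigues l) x)"
  "poly (pderiv (rodrigues (Suc l))) x =
     2 * (real l + 1) * (x * poly (pderiv (rodrigues l)) x + (real l + 1) * poly (rodrigues l) x)"
proof -
  consider "l = 0" | k where "l = Suc k" by (cases l) auto
  then have "poly (rodrigues (Suc l)) x =
      2 * ((x\<^sup>2 - 1) * poly (pderiv (rodrigues l)) x + (real l + 1) * x * poly (rodrigues l) x) \<and>
    poly (pderiv (rodrigues (Suc l))) x =
      2 * (real l + 1) * (x * poly (pderiv (rodrigues l)) x + (real l + 1) * poly (rodrigues l) x)"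
  proof cases
    case 1 then show ?thesis by (simp add: rodrigues_def pderiv_pCons)
  next
    case (2 k)
    define q where "q = (pderiv ^^ k) ([:-1, 0, 1:] ^ Suc k :: real poly)"
    have dq: "pderiv q = rodrigues (Suc k)" by (simp add: q_def rodrigues_def)
    note aux = rodrigues_Suc_Suc_aux[of k, folded q_def]
    have "poly (rodrigues (Suc (Suc k))) x = 2 * (real k + 2) * (x * poly (rodrigues (Suc k)) x + (real k + 1) * poly q x)"
      by (subst aux(1)) (simp add: of_nat_poly algebra_simps)
    moreover have "poly (rodrigues (Suc (Suc k))) x = (x\<^sup>2 - 1) * poly (pderiv (rodrigues (Suc k))) x
           + 2 * (real k + 2) * x * poly (rodrigues (Suc k)) x + (real k + 2) * (real k + 1) * poly q x"
      by (subst aux(2)) (simp add: of_nat_poly algebra_simps power2_eq_square)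
    moreover have "poly (pderiv (rodrigues (Suc (Suc k)))) x = 2 * (real k + 2) *
        (poly (rodrigues (Suc k)) x + x * poly (pderiv (rodrigues (Suc k))) x + (real k + 1) * poly (rodrigues (Suc k)) x)"
      unfolding aux(1) pderiv_mult pderiv_of_nat pderiv_add dq
      by (simp add: of_nat_poly pderiv_pCons algebra_simps)
    ultimately show ?thesis unfolding 2 by (simp add: algebra_simps)
  qed
  then show "poly (rodrigues (Suc l)) x =
     2 * ((x\<^sup>2 - 1) * poly (pderiv (rodrigues l)) x + (real l + 1) * x * poly (rodrigues l) x)"
  "poly (pderiv (rodrigues (Suc l))) x =
     2 * (real l + 1) * (x * poly (pderiv (rodrigues l)) x + (real l + 1) * poly (rodrigues l) x)" by auto
qed

lemma legendre_raise:
  "(real l + 1) * poly (legendre (Suc l)) x =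
     (x\<^sup>2 - 1) * poly (pderiv (legendre l)) x + (real l + 1) * x * poly (legendre l) x"
  unfolding poly_legendre pderiv_legendre rodrigues_rec by (simp add: divide_simps del: of_nat_Suc) (simp add: algebra_simps)

lemma pderiv_legendre_Suc:
  "poly (pderiv (legendre (Suc l))) x = x * poly (pderiv (legendre l)) x + (real l + 1) * poly (legendre l) x"
  unfolding poly_legendre pderiv_legendre rodrigues_rec by (simp add: divide_simps del: of_nat_Suc) (simp add: algebra_simps)

lemma legendre_lower:
  "(1 - x\<^sup>2) * poly (pderiv (legendre (Suc l))) x =
     (real l + 1) * (poly (legendre l) x - x * poly (legendre (Suc l)) x)"
proof -
  have "(1 - x\<^sup>2) * poly (pderiv (legendre (Suc l))) x =
    x * ((1 - x\<^sup>2) * poly (pderiv (legendre l)) x) + (real l + 1) * (1 - x\<^sup>2) * poly (legendre l) x"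
    unfolding pderiv_legendre_Suc by (simp add: algebra_simps)
  also have "(1 - x\<^sup>2) * poly (pderiv (legendre l)) x = (real l + 1) * (x * poly (legendre l) x - poly (legendre (Suc l)) x)"
    using legendre_raise[of l x] by (simp add: algebra_simps)
  finally show ?thesis by (simp add: algebra_simps power2_eq_square)
qed

text \<open>Raising and lowering at degree l + 1 contain the same term (1 - x^2) P'_{l+1} with
  opposite signs; adding them removes it.\<close>

lemma legendre_bonnet:
  "(real l + 2) * poly (legendre (Suc (Suc l))) x =
     (2 * real l + 3) * x * poly (legendre (Suc l)) x - (real l + 1) * poly (legendre l) x"
  using legendre_raise[of "Suc l" x] legendre_lower[of x l] by (simp add: algebra_simps)

text \<open>Differentiate the raising relation and replace P'_{l+1} by
  \<open>pderiv_legendre_Suc\<close>. The self-adjoint form is the one needed for the integrations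
  by parts that follow.\<close>

lemma legendre_ode:
  "pderiv ([:1, 0, -1:] * pderiv (legendre l)) = smult (- (real l * (real l + 1))) (legendre l)"
proof -
  have "[:1, 0, -1:] * pderiv (legendre l) = smult (real l + 1) ([:0, 1:] * legendre l - legendre (Suc l))"
    using legendre_raise[of l] by (intro poly_ext) (simp add: algebra_simps power2_eq_square)
  then have "pderiv ([:1, 0, -1:] * pderiv (legendre l)) =
      smult (real l + 1) (pderiv ([:0, 1:] * legendre l - legendre (Suc l)))" by (simp add: pderiv_smult)
  also have "\<dots> = smult (- (real l * (real l + 1))) (legendre l)"
    by (intro poly_ext, simp add: pderiv_diff pderiv_mult pderiv_pCons)
       (simp add: pderiv_legendre_Suc algebra_simps)
  finally show ?thesis .
qed

lemma legendre_parity: "poly (legendre l) (- x) = (-1) ^ l * poly (legendre l) x"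
proof (induction l rule: induct_nat_012)
  case (ge2 n)
  have "(real n + 2) * poly (legendre (Suc (Suc n))) (- x) =
      (-1) ^ n * ((2 * real n + 3) * x * poly (legendre (Suc n)) x - (real n + 1) * poly (legendre n) x)"
    unfolding legendre_bonnet[of n "- x"] ge2 by (simp add: algebra_simps)
  also have "\<dots> = (real n + 2) * ((-1) ^ Suc (Suc n) * poly (legendre (Suc (Suc n))) x)"
    unfolding legendre_bonnet[of n x, symmetric] by simp
  finally have "(real n + 2) * poly (legendre (Suc (Suc n))) (- x) =
      (real n + 2) * ((-1) ^ Suc (Suc n) * poly (legendre (Suc (Suc n))) x)" .
  then show ?case by (subst (asm) mult_cancel_left) auto
qed (simp_all add: legendre_1)

section \<open>Integrals of Legendre polynomials against powers\<close>

lemma integrable_poly_interval [simp]: "(poly p) integrable_on {a..b::real}"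
  by (intro integrable_continuous_real continuous_intros)

lemma integral_pderiv:
  assumes "a \<le> b" shows "integral {a..b} (poly (pderiv p)) = poly p b - poly p (a::real)"
  by (intro integral_unique fundamental_theorem_of_calculus assms)
     (auto simp: has_real_derivative_iff_has_vector_derivative[symmetric]
       intro!: DERIV_subset[OF poly_DERIV])

text \<open>With the factor 1/2 the measure dt / 2 is the law of u . x for x uniform on the sphere,
  so these numbers are the Funk-Hecke multipliers of t^k.\<close>

definition legendre_moment :: "nat \<Rightarrow> nat \<Rightarrow> real" where
  "legendre_moment m k = 1 / 2 * integral {-1..1} (\<lambda>t. t ^ k * poly (legendre m) t)"

lemma legendre_moment_0: "legendre_moment 0 k = (if even k then 1 / (k + 1) else 0)"
proof -
  have "((\<lambda>t. t ^ k) has_integral (1 ^ Suc k / (k + 1) - (- 1) ^ Suc k / (k + 1))) {-1..1::real}"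
  proof (rule fundamental_theorem_of_calculus)
    fix x :: real
    have "((\<lambda>x. x ^ Suc k / real (k + 1)) has_real_derivative x ^ k) (at x within {-1..1})"
      by (rule derivative_eq_intros refl | simp)+
    then show "((\<lambda>x. x ^ Suc k / real (k + 1)) has_vector_derivative x ^ k) (at x within {-1..1})"
      by (simp add: has_real_derivative_iff_has_vector_derivative)
  qed simp
  then show ?thesis by (auto simp: legendre_moment_def dest!: integral_unique)
qed

text \<open>Integrate the derivative of t^k (1 - t^2) P'_{m+1}, which vanishes at both ends, and use
  the Legendre equation and the lowering relation; a factor m + 1 cancels. For k = 0 the truncated
  \<open>k - 1\<close> is harmless because of the factor k.\<close>

lemma legendre_moment_rec:
  "(real k + m + 2) * legendre_moment (Suc m) k = k * legendre_moment m (k - 1)"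
proof (cases k)
  case 0
  have "integral {-1..1} (poly (pderiv ([:1, 0, -1:] * pderiv (legendre (Suc m))))) = 0"
    by (subst integral_pderiv) auto
  then have "integral {-1..1} (\<lambda>t. - ((real m + 1) * (real m + 2)) * poly (legendre (Suc m)) t) = 0"
    unfolding legendre_ode by (rule trans[rotated]) (intro arg_cong[where f = "integral _"] ext, simp add: algebra_simps)
  then have "legendre_moment (Suc m) 0 = 0"
    by (simp only: integral_mult_right) (simp add: legendre_moment_def)
  then show ?thesis using 0 by simp
next
  case (Suc n)
  let ?P = "legendre (Suc m)"
  let ?q = "[:1, 0, -1:] * pderiv ?P"
  have p0: "integral {-1..1} (poly (pderiv (monom 1 (Suc n) * ?q))) = 0"
    by (subst integral_pderiv) auto
  have d: "pderiv (monom 1 (Suc n) * ?q) = monom 1 (Suc n) * pderiv ?q + monom (of_nat (Suc n)) n * ?q"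
    unfolding pderiv_mult[of "monom 1 (Suc n)"] by (simp add: pderiv_monom algebra_simps)
  have e: "poly (pderiv (monom 1 (Suc n) * ?q)) = (\<lambda>t. - ((real m + 1) * (real m + 2)) * (t ^ Suc n * poly ?P t) +
       (real n + 1) * (real m + 1) * (t ^ n * poly (legendre m) t) - (real n + 1) * (real m + 1) * (t ^ Suc n * poly ?P t))" (is "_ = ?f")
  proof
    fix t
    have "poly (pderiv (monom 1 (Suc n) * ?q)) t = poly (monom 1 (Suc n) * pderiv ?q + monom (of_nat (Suc n)) n * ?q) t"
      unfolding d ..
    also have "\<dots> = - ((real m + 1) * (real m + 2)) * (t ^ Suc n * poly ?P t) + (real n + 1) * t ^ n * ((1 - t\<^sup>2) * poly (pderiv ?P) t)"
      unfolding legendre_ode by (simp add: poly_monom algebra_simps power2_eq_square)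
    finally show "poly (pderiv (monom 1 (Suc n) * ?q)) t = ?f t"
      unfolding legendre_lower by (simp add: algebra_simps)
  qed
  have i: "(\<lambda>t. t ^ a * poly (legendre b) t) integrable_on {-1..1::real}" for a b
    by (rule integrable_continuous_real) (auto intro!: continuous_intros)
  have "integral {-1..1} ?f = - ((real m + 1) * (real m + 2)) * integral {-1..1} (\<lambda>t. t ^ Suc n * poly ?P t) +
      (real n + 1) * (real m + 1) * integral {-1..1} (\<lambda>t. t ^ n * poly (legendre m) t)
      - (real n + 1) * (real m + 1) * integral {-1..1} (\<lambda>t. t ^ Suc n * poly ?P t)"
    by (intro integral_unique has_integral_diff has_integral_add has_integral_mult_right integrable_integral i)
  then have "(real m + 1) * ((real n + m + 3) * legendre_moment (Suc m) (Suc n)) = (real m + 1) * ((real n + 1) * legendre_moment m n)"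
    using p0 unfolding e legendre_moment_def by (simp add: field_simps)
  then show ?thesis using Suc by (simp add: add.commute add.left_commute)
qed


lemma legendre_moment_parity:
  assumes "odd (m + k)" shows "legendre_moment m k = 0"
  using assms
proof (induction m arbitrary: k)
  case 0 then show ?case by (simp add: legendre_moment_0)
next
  case (Suc m)
  then have "real k * legendre_moment m (k - 1) = 0" by (cases k) auto
  then have "(real k + m + 2) * legendre_moment (Suc m) k = 0" unfolding legendre_moment_rec .
  then show ?case by (simp add: add_nonneg_eq_0_iff)
qed

text \<open>The recurrence lowers m and k together and k reaches 0 first, where its right-hand side
  vanishes.\<close>

lemma legendre_moment_less:
  assumes "k < m" shows "legendre_moment m k = 0"
  using assms
proof (induction m arbitrary: k)
  case 0 then show ?case by simp
next
  case (Suc m)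
  then have "real k * legendre_moment m (k - 1) = 0" by (cases k) auto
  then have "(real k + m + 2) * legendre_moment (Suc m) k = 0" unfolding legendre_moment_rec .
  then show ?case by (simp add: add_nonneg_eq_0_iff)
qed

text \<open>The Legendre equation tested against t^k; \<open>funk_hecke_power\<close> matches it
  with Green's formula on the sphere. It is carried from m to m + 1 by the recurrence at k and at k
  - 2 and the induction hypothesis at k - 1. The cases k = 0 and k = 1, where \<open>k - 2\<close>
  truncates, are treated apart.\<close>

lemma legendre_moment_ode:
  "(real k * (k + 1) - real m * (m + 1)) * legendre_moment m k =
     real k * (real k - 1) * legendre_moment m (k - 2)"
proof (induction m arbitrary: k)
  case 0
  show ?case
  proof (cases k)
    case (Suc n)
    then show ?thesis
      by (cases n) (auto simp: legendre_moment_0 add_nonneg_eq_0_iff)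
  qed simp
next
  case (Suc m)
  show ?case
  proof (cases "k = 0")
    case True
    then show ?thesis using legendre_moment_less[of 0 "Suc m"] by simp
  next
    case k0: False
    show ?thesis
    proof (cases "k = 1")
      case True
      then show ?thesis using legendre_moment_less[of 1 "Suc m"] legendre_moment_parity[of 1 0]
        by (cases m) (auto simp: legendre_moment_parity)
    next
      case False
      have r1: "(real k + m + 2) * legendre_moment (Suc m) k = k * legendre_moment m (k - 1)"
        by (rule legendre_moment_rec)
      have r2: "(real k + m) * legendre_moment (Suc m) (k - 2) = (real k - 2) * legendre_moment m (k - 3)"
        using legendre_moment_rec[of "k - 2" m] False k0 by (simp add: of_nat_diff numeral_3_eq_3)
      have r3: "((real k - 1) * k - real m * (m + 1)) * legendre_moment m (k - 1) =
          (real k - 1) * (real k - 2) * legendre_moment m (k - 3)"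
        using Suc.IH[of "k - 1"] False k0 by (simp add: of_nat_diff numeral_3_eq_3)
      have "(real k + m) * ((real k + m + 2) * (real k - m - 1) * legendre_moment (Suc m) k) =
          (real k - m - 1) * (real k + m) * ((real k + m + 2) * legendre_moment (Suc m) k)" by (simp add: algebra_simps)
      also have "\<dots> = k * (((real k - 1) * k - real m * (m + 1)) * legendre_moment m (k - 1))"
        unfolding r1 by (simp add: algebra_simps)
      also have "\<dots> = k * (real k - 1) * ((real k - 2) * legendre_moment m (k - 3))"
        unfolding r3 by (simp add: algebra_simps)
      also have "\<dots> = (real k + m) * (k * (real k - 1) * legendre_moment (Suc m) (k - 2))"
        unfolding r2[symmetric] by (simp add: algebra_simps)
      finally have "(real k + m + 2) * (real k - m - 1) * legendre_moment (Suc m) k =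
          k * (real k - 1) * legendre_moment (Suc m) (k - 2)"
        using k0 by (subst (asm) mult_cancel_left) (auto simp: add_nonneg_eq_0_iff)
      then show ?thesis by (simp add: algebra_simps)
    qed
  qed
qed

section \<open>Leading coefficients, orthogonality, expansion of polynomials\<close>

lemma legendre_bonnet_poly:
  "smult (real l + 2) (legendre (Suc (Suc l))) =
     smult (2 * real l + 3) ([:0, 1:] * legendre (Suc l)) - smult (real l + 1) (legendre l)"
  using legendre_bonnet[of l] by (intro poly_ext) (simp add: algebra_simps)

lemma degree_legendre_le: "degree (legendre l) \<le> l"
proof (induction l rule: induct_nat_012)
  case (ge2 l)
  have "degree (smult (real l + 2) (legendre (Suc (Suc l)))) \<le> Suc (Suc l)"
    unfolding legendre_bonnet_poly using ge2
    by (intro degree_diff_le) (auto intro: order_trans[OF degree_smult_le] order_trans[OF degree_pCons_le])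
  then show ?case by (simp add: degree_smult_eq split: if_splits)
qed (simp_all add: legendre_1)

lemma coeff_legendre_Suc:
  "(real l + 1) * coeff (legendre (Suc l)) (Suc l) = (2 * real l + 1) * coeff (legendre l) l"
proof (cases l)
  case (Suc k)
  have "coeff (legendre k) (Suc (Suc k)) = 0"
    using degree_legendre_le[of k] by (intro coeff_eq_0) simp
  moreover have "coeff (smult (real k + 2) (legendre (Suc (Suc k)))) (Suc (Suc k)) =
    coeff (smult (2 * real k + 3) ([:0, 1:] * legendre (Suc k)) - smult (real k + 1) (legendre k)) (Suc (Suc k))"
    unfolding legendre_bonnet_poly ..
  ultimately show ?thesis using Suc by (simp add: algebra_simps)
qed (simp add: legendre_1)

lemma coeff_legendre_pos: "coeff (legendre l) l > 0"
proof (induction l)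
  case (Suc l)
  then have "(real l + 1) * coeff (legendre (Suc l)) (Suc l) > 0"
    unfolding coeff_legendre_Suc by (intro mult_pos_pos) auto
  then show ?case by (simp add: zero_less_mult_iff)
qed simp

lemma integral_poly_legendre:
  "1 / 2 * integral {-1..1} (\<lambda>t. poly p t * poly (legendre m) t) =
     (\<Sum>i\<le>degree p. coeff p i * legendre_moment m i)"
proof -
  have "integral {-1..1} (\<lambda>t. poly p t * poly (legendre m) t) =
      integral {-1..1} (\<lambda>t. \<Sum>i\<le>degree p. coeff p i * (t ^ i * poly (legendre m) t))"
    by (simp add: poly_altdef sum_distrib_right mult.assoc)
  also have "\<dots> = (\<Sum>i\<le>degree p. integral {-1..1} (\<lambda>t. coeff p i * (t ^ i * poly (legendre m) t)))"
    by (rule integral_sum) (auto intro!: integrable_continuous_real continuous_intros)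
  finally show ?thesis by (simp add: legendre_moment_def sum_divide_distrib)
qed

text \<open>From l to l + 1 the leading coefficient is multiplied by (2 l + 1) / (l + 1) and the
  diagonal moment by (l + 1) / (2 l + 3), so the product changes by (2 l + 1) / (2 l + 3).\<close>

lemma coeff_legendre_moment: "coeff (legendre l) l * legendre_moment l l = 1 / (2 * l + 1)"
proof (induction l)
  case 0 then show ?case by (simp add: legendre_moment_0)
next
  case (Suc l)
  have m: "(2 * real l + 3) * legendre_moment (Suc l) (Suc l) = (real l + 1) * legendre_moment l l"
    using legendre_moment_rec[of "Suc l" l] by (simp add: algebra_simps)
  have "(real l + 1) * (2 * real l + 3) * (coeff (legendre (Suc l)) (Suc l) * legendre_moment (Suc l) (Suc l)) =
    ((real l + 1) * coeff (legendre (Suc l)) (Suc l)) * ((2 * real l + 3) * legendre_moment (Suc l) (Suc l))"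
    by (simp add: algebra_simps)
  also have "\<dots> = (2 * real l + 1) * (real l + 1) * (coeff (legendre l) l * legendre_moment l l)"
    unfolding m coeff_legendre_Suc by (simp add: algebra_simps)
  also have "\<dots> = real l + 1" unfolding Suc by (simp add: field_simps)
  finally have "(real l + 1) * ((2 * real l + 3) * (coeff (legendre (Suc l)) (Suc l) * legendre_moment (Suc l) (Suc l))) = (real l + 1) * 1"
    by (simp only: mult.assoc mult_1_right)
  then have "(2 * real l + 3) * (coeff (legendre (Suc l)) (Suc l) * legendre_moment (Suc l) (Suc l)) = 1"
    by (subst (asm) mult_cancel_left) auto
  then show ?case by (simp add: field_simps)
qed

text \<open>Powers below m integrate to zero against P_m, so for k = m only the leading coefficient
  survives, and its contribution is \<open>coeff_legendre_moment\<close>.\<close>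

lemma legendre_orthogonal:
  "1 / 2 * integral {-1..1} (\<lambda>t. poly (legendre k) t * poly (legendre m) t) =
     (if k = m then 1 / (2 * real m + 1) else 0)"
proof -
  have lt: "1 / 2 * integral {-1..1} (\<lambda>t. poly (legendre k) t * poly (legendre m) t) = 0" if "k < m" for k m
    unfolding integral_poly_legendre
    using degree_legendre_le[of k] that by (intro sum.neutral) (auto intro!: legendre_moment_less)
  show ?thesis
  proof (cases k m rule: linorder_cases)
    case less then show ?thesis using lt by simp
  next
    case greater
    then show ?thesis using lt[of m k] by (simp add: mult.commute)
  next
    case equal
    have "degree (legendre m) = m"
      using degree_legendre_le[of m] coeff_legendre_pos[of m] le_degree[of "legendre m" m] by auto
    then have "1 / 2 * integral {-1..1} (\<lambda>t. poly (legendre m) t * poly (legendre m) t) =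
      (\<Sum>i\<le>m. if i = m then coeff (legendre m) m * legendre_moment m m else 0)"
      unfolding integral_poly_legendre by (intro sum.cong) (auto simp: legendre_moment_less)
    then show ?thesis using equal coeff_legendre_moment[of m] by simp
  qed
qed

text \<open>The leading coefficient of P_n is positive, so leading terms can be subtracted one
  degree at a time.\<close>

lemma poly_eq_sum_legendre:
  assumes "degree p \<le> n"
  shows "\<exists>c. p = (\<Sum>l\<le>n. smult (c l) (legendre l))"
  using assms
proof (induction n arbitrary: p)
  case 0
  then show ?case by (auto elim!: degree_eq_zeroE simp: one_pCons intro!: exI[of _ "\<lambda>_. coeff p 0"])
next
  case (Suc n)
  define a where "a = coeff p (Suc n) / coeff (legendre (Suc n)) (Suc n)"
  have "degree (p - smult a (legendre (Suc n))) \<le> n"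
  proof (rule degree_le, intro allI impI)
    fix i assume i: "n < i"
    show "coeff (p - smult a (legendre (Suc n))) i = 0"
    proof (cases "i = Suc n")
      case True then show ?thesis using coeff_legendre_pos[of "Suc n"] by (simp add: a_def)
    next
      case False
      then have "coeff p i = 0" "coeff (legendre (Suc n)) i = 0"
        using Suc.prems degree_legendre_le[of "Suc n"] i by (auto intro!: coeff_eq_0)
      then show ?thesis by simp
    qed
  qed
  then obtain c where "p - smult a (legendre (Suc n)) = (\<Sum>l\<le>n. smult (c l) (legendre l))" using Suc.IH by blast
  then have "p = (\<Sum>l\<le>n. smult (c l) (legendre l)) + smult a (legendre (Suc n))" by (simp add: algebra_simps)
  then have "p = (\<Sum>l\<le>Suc n. smult ((c(Suc n := a)) l) (legendre l))" by simp
  then show ?case by blast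
qed

section \<open>The coefficients a_l: closed form, sign and decay\<close>

lemma abs_coeff_odd: "odd l \<Longrightarrow> abs_coeff l = 0"
proof -
  assume l: "odd l"
  have "integral {-1..1} (\<lambda>t. \<bar>t\<bar> * poly (legendre l) t) = integral {-1..1} (\<lambda>t. \<bar>-t\<bar> * poly (legendre l) (-t))"
    using Henstock_Kurzweil_Integration.integral_reflect_real[of 1 "-1" "\<lambda>t. \<bar>t\<bar> * poly (legendre l) t"] by simp
  also have "\<dots> = - integral {-1..1} (\<lambda>t. \<bar>t\<bar> * poly (legendre l) t)"
    using l by (simp add: legendre_parity)
  finally show ?thesis by (simp add: abs_coeff_def)
qed

text \<open>Since t itself solves the Legendre equation of degree 1, the bracket (1 - t^2) (t P' -
  P) has derivative (2 - l (l + 1)) t P. Integrated over [0, 1] this leaves only the value of P at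
  0.\<close>

lemma abs_coeff_even:
  assumes "even l"
  shows "(real l - 1) * (real l + 2) * abs_coeff l = - poly (legendre l) 0"
proof -
  let ?P = "legendre l"
  let ?f = "\<lambda>t. \<bar>t\<bar> * poly ?P t"
  have i: "?f integrable_on {a..b}" for a b
    by (rule integrable_continuous_real) (auto intro!: continuous_intros)
  have "integral {-1..0} ?f = integral {0..1} (\<lambda>t. ?f (-t))"
    using Henstock_Kurzweil_Integration.integral_reflect_real[of 0 "-1" ?f] by simp
  also have "\<dots> = integral {0..1} ?f" using assms by (simp add: legendre_parity)
  finally have "integral {-1..1} ?f = 2 * integral {0..1} ?f"
    using Henstock_Kurzweil_Integration.integral_combine[of "-1" 0 1 ?f] i by simp
  also have "integral {0..1} ?f = integral {0..1} (\<lambda>t. t * poly ?P t)"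
    by (rule integral_cong) auto
  finally have a: "abs_coeff l = integral {0..1} (\<lambda>t. t * poly ?P t)" by (simp add: abs_coeff_def)
  have "pderiv ([:0, 1:] * ([:1, 0, -1:] * pderiv ?P) - [:1, 0, -1:] * ?P) =
      smult (2 - real l * (real l + 1)) ([:0, 1:] * ?P)"
    unfolding pderiv_diff pderiv_mult[of "[:0, 1:]"] legendre_ode
    unfolding pderiv_mult[of "[:1, 0, -1:]"]
    by (intro poly_ext) (simp add: pderiv_pCons algebra_simps)
  then have "integral {0..1} (poly (smult (2 - real l * (real l + 1)) ([:0, 1:] * ?P))) = poly ?P 0"
    using integral_pderiv[of 0 1 "[:0, 1:] * ([:1, 0, -1:] * pderiv ?P) - [:1, 0, -1:] * ?P"] by simp
  moreover have "poly (smult (2 - real l * (real l + 1)) ([:0, 1:] * ?P)) = (\<lambda>t. (2 - real l * (real l + 1)) * (t * poly ?P t))"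
    by auto
  ultimately have "(2 - real l * (real l + 1)) * abs_coeff l = poly ?P 0"
    unfolding a by (simp only: integral_mult_right)
  then show ?thesis by (simp add: algebra_simps)
qed

lemma legendre_at_0: "(real l + 2) * poly (legendre (Suc (Suc l))) 0 = - (real l + 1) * poly (legendre l) 0"
  using legendre_bonnet[of l 0] by (simp add: algebra_simps)

lemma double_factorial_neg: "n \<le> 0 \<Longrightarrow> double_factorial n = 1"
proof -
  assume "n \<le> 0"
  then have "{k. 1 \<le> k \<and> k \<le> n \<and> even (n - k)} = {}" by auto
  then show ?thesis unfolding double_factorial_def by (simp only: prod.empty)
qed

lemma double_factorial_rec:
  assumes "n \<ge> -1" shows "double_factorial (n + 2) = (n + 2) * double_factorial n"
proof -
  have e: "{k. 1 \<le> k \<and> k \<le> n + 2 \<and> even (n + 2 - k)} = insert (n + 2) {k. 1 \<le> k \<and> k \<le> n \<and> even (n - k)}"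
  proof (intro equalityI subsetI)
    fix k assume k: "k \<in> {k. 1 \<le> k \<and> k \<le> n + 2 \<and> even (n + 2 - k)}"
    then have "k \<noteq> n + 1" by auto
    then show "k \<in> insert (n + 2) {k. 1 \<le> k \<and> k \<le> n \<and> even (n - k)}" using k by auto
  qed (use assms in auto)
  have "finite {k. 1 \<le> k \<and> k \<le> n \<and> even (n - k)}"
    by (rule finite_subset[of _ "{1..n}"]) auto
  then show ?thesis unfolding double_factorial_def e by simp
qed

lemma double_factorial_pos: "double_factorial n > 0"
  unfolding double_factorial_def by (rule prod_pos) auto

lemma legendre_even_at_0:
  "poly (legendre (2 * j)) 0 = (-1) ^ j * of_int (double_factorial (2 * int j - 1)) / of_int (double_factorial (2 * int j))"
proof (induction j)
  case 0 then show ?case by (simp add: double_factorial_neg)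
next
  case (Suc j)
  have "double_factorial (2 * int (Suc j) - 1) = (2 * int j + 1) * double_factorial (2 * int j - 1)"
    "double_factorial (2 * int (Suc j)) = (2 * int j + 2) * double_factorial (2 * int j)"
    using double_factorial_rec[of "2 * int j - 1"] double_factorial_rec[of "2 * int j"] by (simp_all add: add.commute)
  moreover have "poly (legendre (2 * Suc j)) 0 = - ((2 * real j + 1) / (2 * real j + 2) * poly (legendre (2 * j)) 0)"
    using legendre_at_0[of "2 * j"] by (simp add: field_simps)
  ultimately show ?case unfolding Suc by simp
qed

text \<open>In \<open>abs_coeff_even\<close> at l = 2 j the factor l - 1 cancels the top factor of
  (2 j - 1)!!, and l + 2 completes (2 j)!! to (2 j + 2)!!. For j = 1 this uses (-1)!! = 1.\<close>

lemma abs_coeff_double_factorial: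
  assumes "j \<ge> 1"
  shows "abs_coeff (2 * j) = (-1) ^ (j - 1) * of_int (double_factorial (2 * int j - 3))
          / of_int (double_factorial (2 * int j + 2))"
proof -
  have d: "double_factorial (2 * int j - 1) = (2 * int j - 1) * double_factorial (2 * int j - 3)"
    "double_factorial (2 * int j + 2) = (2 * int j + 2) * double_factorial (2 * int j)"
    using double_factorial_rec[of "2 * int j - 3"] double_factorial_rec[of "2 * int j"] assms by simp_all
  have s: "(-1::real) ^ j = - ((-1) ^ (j - 1))" using assms by (cases j) auto
  have nz: "2 * real j - 1 \<noteq> 0" using assms by simp
  have pos: "real_of_int (double_factorial (2 * int j)) > 0" by (simp add: double_factorial_pos)
  have "(2 * real j - 1) * ((2 * real j + 2) * abs_coeff (2 * j)) =
     (2 * real j - 1) * ((-1) ^ (j - 1) * of_int (double_factorial (2 * int j - 3)) / of_int (double_factorial (2 * int j)))"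
    using abs_coeff_even[of "2 * j"] nz pos unfolding legendre_even_at_0 d s by (simp add: mult.assoc)
  then have "(2 * real j + 2) * abs_coeff (2 * j) = (-1) ^ (j - 1) * of_int (double_factorial (2 * int j - 3)) / of_int (double_factorial (2 * int j))"
    using nz by (subst (asm) mult_cancel_left) auto
  then have "abs_coeff (2 * j) = ((-1) ^ (j - 1) * of_int (double_factorial (2 * int j - 3)) / of_int (double_factorial (2 * int j))) / (2 * real j + 2)"
    by (subst nonzero_eq_divide_eq) (auto simp: mult.commute add_nonneg_eq_0_iff)
  then show ?thesis unfolding d by simp
qed

lemma abs_coeff_0: "abs_coeff 0 = 1 / 2"
  using abs_coeff_even[of 0] by simp

text \<open>Comparison of successive coefficients gives both the tabulated values, starting from a_0
  = 1/2, and the decay.\<close>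

lemma abs_coeff_rec: "(2 * real j + 4) * abs_coeff (2 * Suc j) = - (2 * real j - 1) * abs_coeff (2 * j)"
proof -

  have a: "(2 * real j + 1) * (2 * real j + 4) * abs_coeff (2 * Suc j) = - poly (legendre (2 * Suc j)) 0"
    using abs_coeff_even[of "2 * Suc j"] by (simp add: algebra_simps)
  have b: "(2 * real j - 1) * (2 * real j + 2) * abs_coeff (2 * j) = - poly (legendre (2 * j)) 0"
    using abs_coeff_even[of "2 * j"] by simp
  have c: "(2 * real j + 2) * poly (legendre (2 * Suc j)) 0 = - (2 * real j + 1) * poly (legendre (2 * j)) 0"
    using legendre_at_0[of "2 * j"] by simp
  have "(2 * real j + 1) * (2 * real j + 2) * ((2 * real j + 4) * abs_coeff (2 * Suc j)) =
     (2 * real j + 2) * ((2 * real j + 1) * (2 * real j + 4) * abs_coeff (2 * Suc j))" by (simp add: algebra_simps)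
  also have "\<dots> = (2 * real j + 1) * poly (legendre (2 * j)) 0" unfolding a using c by (simp add: algebra_simps)
  also have "poly (legendre (2 * j)) 0 = - ((2 * real j - 1) * (2 * real j + 2) * abs_coeff (2 * j))" using b by simp
  also have "(2 * real j + 1) * \<dots> = (2 * real j + 1) * (2 * real j + 2) * (- (2 * real j - 1) * abs_coeff (2 * j))"
    by (simp add: algebra_simps)
  finally show ?thesis by (subst (asm) mult_cancel_left) (auto simp: add_nonneg_eq_0_iff)
qed

lemma abs_coeff_values: "abs_coeff 2 = 1 / 8" "abs_coeff 4 = - 1 / 48" "abs_coeff 6 = 1 / 128" "abs_coeff 8 = - 1 / 256"
  using abs_coeff_rec[of 0] abs_coeff_rec[of 1] abs_coeff_rec[of 2] abs_coeff_rec[of 3] abs_coeff_0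
  by (simp_all add: numeral_eq_Suc)

lemma abs_coeff_nonzero: "even l \<Longrightarrow> abs_coeff l \<noteq> 0"
proof (elim evenE)
  fix j assume "l = 2 * j"
  then show ?thesis
    using abs_coeff_double_factorial[of j] double_factorial_pos[of "2 * int j - 3"] double_factorial_pos[of "2 * int j + 2"]
    by (cases "j = 0") (auto simp: abs_coeff_0)
qed

text \<open>Cruder than the true order j^(-5/2), but stable under induction: the factor |2 j - 1| /
  (2 j + 4) is at most (j + 1) / (j + 2).\<close>

lemma abs_coeff_bound: "\<bar>abs_coeff (2 * j)\<bar> \<le> 1 / (real j + 1)"
proof (induction j)
  case 0 then show ?case by (simp add: abs_coeff_0)
next
  case (Suc j)
  have "(2 * real j + 4) * \<bar>abs_coeff (2 * Suc j)\<bar> = \<bar>2 * real j - 1\<bar> * \<bar>abs_coeff (2 * j)\<bar>"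
    using arg_cong[OF abs_coeff_rec[of j], of abs] by (simp add: abs_mult abs_minus_commute)
  also have "\<dots> \<le> (2 * real j + 2) * (1 / (real j + 1))"
    by (intro mult_mono Suc) auto
  also have "\<dots> = 2" by (simp add: field_simps)
  finally show ?case by (simp add: field_simps)
qed

lemma abs_coeff_tendsto_0: "(\<lambda>j. abs_coeff (2 * j)) \<longlonglongrightarrow> 0"
proof (rule Lim_null_comparison)
  show "\<forall>\<^sub>F j in sequentially. norm (abs_coeff (2 * j)) \<le> inverse (real (Suc j))"
    using abs_coeff_bound by (simp add: inverse_eq_divide add.commute)
qed (rule LIMSEQ_inverse_real_of_nat)

section \<open>Legendre coefficients of the kernel k_2\<close>

text \<open>The primitives below involve sqrt (1 - t^2) and arcsin, which are continuous on [-1, 1]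
  but not differentiable at the ends.\<close>

lemma has_integral_FTC_interior:
  fixes f :: "real \<Rightarrow> real"
  assumes "continuous_on {-1..1} F" "\<And>t. \<bar>t\<bar> < 1 \<Longrightarrow> (F has_real_derivative f t) (at t)"
  shows "(f has_integral (F 1 - F (-1))) {-1..1}"
  by (rule fundamental_theorem_of_calculus_interior)
     (use assms in \<open>auto simp: has_real_derivative_iff_has_vector_derivative[symmetric] abs_less_iff\<close>)

lemma one_minus_square_pos: "\<bar>t\<bar> < 1 \<Longrightarrow> 0 < 1 - (t::real)\<^sup>2"
  by (simp add: abs_square_less_1)

lemma DERIV_sqrt_one_minus_square:
  assumes "\<bar>t\<bar> < 1"
  shows "((\<lambda>t. sqrt (1 - t\<^sup>2)) has_real_derivative - t / sqrt (1 - t\<^sup>2)) (at t)"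
  using one_minus_square_pos[OF assms] by (auto intro!: derivative_eq_intros simp: field_simps)

text \<open>With weight \<open>1 / sqrt (1 - t\<^sup>2)\<close>, the recurrences for the Legendre polynomials make
  \<open>(l + 2)\<^sup>2 P\<^bsub>l+2\<^esub> - (l + 1)\<^sup>2 P\<^bsub>l\<^esub>\<close> exact, with primitive \<open>- (2 l + 3) sqrt (1 - t\<^sup>2) P\<^bsub>l+1\<^esub>\<close>.\<close>

lemma has_integral_legendre_div_sqrt:
  "((\<lambda>t. poly (legendre l) t / sqrt (1 - t\<^sup>2)) has_integral (pi * (poly (legendre l) 0)\<^sup>2)) {-1..1}"
proof (induction l rule: induct_nat_012)
  case 0
  have "((\<lambda>t. 1 / sqrt (1 - t\<^sup>2)) has_integral (arcsin 1 - arcsin (-1))) {-1..1}"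
  proof (rule has_integral_FTC_interior)
    show "(arcsin has_real_derivative 1 / sqrt (1 - t\<^sup>2)) (at t)" if "\<bar>t\<bar> < 1" for t
      using that by (auto intro!: derivative_eq_intros simp: divide_inverse)
  qed (rule continuous_on_arcsin')
  then show ?case by simp
next
  case 1
  have "((\<lambda>t. t / sqrt (1 - t\<^sup>2)) has_integral (- sqrt (1 - 1\<^sup>2) - - sqrt (1 - (-1)\<^sup>2))) {-1..1}"
  proof (rule has_integral_FTC_interior)
    show "((\<lambda>t. - sqrt (1 - t\<^sup>2)) has_real_derivative t / sqrt (1 - t\<^sup>2)) (at t)" if "\<bar>t\<bar> < 1" for t
      using DERIV_minus[OF DERIV_sqrt_one_minus_square[OF that]] by simp
  qed (intro continuous_intros)
  then show ?case by (simp add: legendre_1)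
next
  case (ge2 l)
  let ?w = "\<lambda>t::real. sqrt (1 - t\<^sup>2)"
  have "((\<lambda>t. ((real l + 1)\<^sup>2 * poly (legendre l) t - (real l + 2)\<^sup>2 * poly (legendre (Suc (Suc l))) t) / ?w t)
      has_integral ((2 * real l + 3) * ?w 1 * poly (legendre (Suc l)) 1 -
        (2 * real l + 3) * ?w (-1) * poly (legendre (Suc l)) (-1))) {-1..1}"
  proof (rule has_integral_FTC_interior)
    fix t :: real assume t: "\<bar>t\<bar> < 1"
    have w: "?w t > 0" "?w t * ?w t = 1 - t\<^sup>2" using one_minus_square_pos[OF t] by auto
    let ?P = "poly (legendre (Suc l)) t" and ?P' = "poly (pderiv (legendre (Suc l))) t"
    have b: "(real l + 2) * poly (legendre (Suc (Suc l))) t = (2 * real l + 3) * t * ?P - (real l + 1) * poly (legendre l) t"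
      by (rule legendre_bonnet)
    have low: "(1 - t\<^sup>2) * ?P' = (real l + 1) * (poly (legendre l) t - t * ?P)" by (rule legendre_lower)
    have "((\<lambda>t. (2 * real l + 3) * ?w t * poly (legendre (Suc l)) t) has_real_derivative
       (2 * real l + 3) * (?w t * ?P' + - t / ?w t * ?P)) (at t)"
      by (rule derivative_eq_intros DERIV_sqrt_one_minus_square t poly_DERIV refl)+ (simp add: algebra_simps)
    moreover have "(2 * real l + 3) * (?w t * ?P' + - t / ?w t * ?P) =
      (2 * real l + 3) * (?w t * ?w t * ?P' - t * ?P) / ?w t"
      using w(1) by (simp add: field_simps)
    moreover have "(2 * real l + 3) * (?w t * ?w t * ?P' - t * ?P) =
       (real l + 1)\<^sup>2 * poly (legendre l) t - (real l + 2) * ((real l + 2) * poly (legendre (Suc (Suc l))) t)"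
      unfolding w low b by (simp add: algebra_simps power2_eq_square)
    ultimately show "((\<lambda>t. (2 * real l + 3) * ?w t * poly (legendre (Suc l)) t) has_real_derivative
      ((real l + 1)\<^sup>2 * poly (legendre l) t - (real l + 2)\<^sup>2 * poly (legendre (Suc (Suc l))) t) / ?w t) (at t)"
      by (simp add: power2_eq_square mult.assoc)
  qed (intro continuous_intros)
  then have z: "((\<lambda>t. ((real l + 1)\<^sup>2 * poly (legendre l) t - (real l + 2)\<^sup>2 * poly (legendre (Suc (Suc l))) t) / ?w t)
      has_integral 0) {-1..1}" by simp
  have "((\<lambda>t. (real l + 1)\<^sup>2 / (real l + 2)\<^sup>2 * (poly (legendre l) t / ?w t) - 1 / (real l + 2)\<^sup>2 *
      (((real l + 1)\<^sup>2 * poly (legendre l) t - (real l + 2)\<^sup>2 * poly (legendre (Suc (Suc l))) t) / ?w t))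
      has_integral ((real l + 1)\<^sup>2 / (real l + 2)\<^sup>2 * (pi * (poly (legendre l) 0)\<^sup>2) - 1 / (real l + 2)\<^sup>2 * 0)) {-1..1}"
    by (intro has_integral_diff has_integral_mult_right ge2(1) z)
  moreover have "(real l + 1)\<^sup>2 / (real l + 2)\<^sup>2 * (poly (legendre l) t / ?w t) - 1 / (real l + 2)\<^sup>2 *
      (((real l + 1)\<^sup>2 * poly (legendre l) t - (real l + 2)\<^sup>2 * poly (legendre (Suc (Suc l))) t) / ?w t) =
      poly (legendre (Suc (Suc l))) t / ?w t" for t
    by (simp add: diff_divide_distrib algebra_simps)
  moreover have "poly (legendre (Suc (Suc l))) 0 = - ((real l + 1) / (real l + 2) * poly (legendre l) 0)"
    using legendre_at_0[of l] by (simp add: field_simps)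
  ultimately show ?case by (simp add: power_mult_distrib power_divide mult_ac)
qed

text \<open>Put w = sqrt (1 - t^2), K = w + t arcsin t, e = (l - 1) (l + 2). The brackets (1 - t^2)
  (w P' - w' P) and (1 - t^2) (K P' - K' P) vanish at both ends and have the derivatives - e w P - P
  / w and - e K P - 3 w P. So the integral of K P is 3 / e^2 times that of P / w, which is pi
  P(0)^2, and P(0) / e = - a_l.\<close>

lemma has_integral_legendre_kernel2:
  assumes "even l"
  shows "((\<lambda>t. (sqrt (1 - t\<^sup>2) + t * arcsin t) * poly (legendre l) t)
     has_integral (3 * pi * (abs_coeff l)\<^sup>2)) {-1..1}"
proof -
  let ?w = "\<lambda>t::real. sqrt (1 - t\<^sup>2)" and ?P = "poly (legendre l)" and ?P' = "poly (pderiv (legendre l))"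
  let ?K = "\<lambda>t. ?w t + t * arcsin t"
  define e where "e = (real l - 1) * (real l + 2)"
  have e: "real l * (real l + 1) = e + 2" by (simp add: e_def algebra_simps)
  \<comment> \<open>Evenness keeps \<open>e\<close> away from 0, whose only nonnegative root is l =
    1.\<close>
  have "real l \<noteq> 1" using assms by auto
  then have e0: "e \<noteq> 0" by (auto simp: e_def add_nonneg_eq_0_iff)
  have ode: "((\<lambda>t. (1 - t\<^sup>2) * ?P' t) has_real_derivative - (real l * (real l + 1)) * ?P t) (at t)" for t
    using poly_DERIV[of "[:1, 0, -1:] * pderiv (legendre l)" t] unfolding legendre_ode
    by (simp add: algebra_simps power2_eq_square)
  have i1: "((\<lambda>t. - e * (?w t * ?P t) - ?P t / ?w t) has_integral
      ((?w 1 * ((1 - 1\<^sup>2) * ?P' 1) + 1 * ?w 1 * ?P 1) - (?w (-1) * ((1 - (-1)\<^sup>2) * ?P' (-1)) + (-1) * ?w (-1) * ?P (-1)))) {-1..1}"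
  proof (rule has_integral_FTC_interior)
    fix t :: real assume t: "\<bar>t\<bar> < 1"
    have w: "?w t > 0" using one_minus_square_pos[OF t] by simp
    have D: "((\<lambda>t. ?w t * ((1 - t\<^sup>2) * ?P' t) + t * ?w t * ?P t) has_real_derivative
      (- t / ?w t * ((1 - t\<^sup>2) * ?P' t) + ?w t * (- (real l * (real l + 1)) * ?P t)) +
      ((?w t + t * (- t / ?w t)) * ?P t + t * ?w t * ?P' t)) (at t)"
      by (rule derivative_eq_intros DERIV_sqrt_one_minus_square t poly_DERIV ode refl)+ (simp add: algebra_simps)
    have f1: "- t / ?w t * ((1 - t\<^sup>2) * ?P' t) = - t * ?w t * ?P' t"
    proof -
      have "- t / ?w t * ((1 - t\<^sup>2) * ?P' t) = - t * ((1 - t\<^sup>2) / ?w t) * ?P' t" by simp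
      also have "(1 - t\<^sup>2) / ?w t = ?w t"
        using one_minus_square_pos[OF t] by (intro real_div_sqrt) simp
      finally show ?thesis .
    qed
    have f2: "?w t + t * (- t / ?w t) = 2 * ?w t - 1 / ?w t"
    proof -
      have "?w t * ?w t = 1 - t * t" using one_minus_square_pos[OF t] by (simp add: power2_eq_square)
      then have "?w t * (?w t + t * (- t / ?w t)) = ?w t * (2 * ?w t - 1 / ?w t)"
        using w by (simp add: right_diff_distrib distrib_left mult.left_commute)
      then show ?thesis using w by (subst (asm) mult_cancel_left) auto
    qed
    have E: "(- t / ?w t * ((1 - t\<^sup>2) * ?P' t) + ?w t * (- (real l * (real l + 1)) * ?P t)) +
      ((?w t + t * (- t / ?w t)) * ?P t + t * ?w t * ?P' t) = - e * (?w t * ?P t) - ?P t / ?w t"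
      unfolding f1 f2 e by (simp add: algebra_simps)
    show "((\<lambda>t. ?w t * ((1 - t\<^sup>2) * ?P' t) + t * ?w t * ?P t) has_real_derivative - e * (?w t * ?P t) - ?P t / ?w t) (at t)"
      using D unfolding E .
  qed (intro continuous_intros)
  have i2: "((\<lambda>t. - e * (?K t * ?P t) - 3 * (?w t * ?P t)) has_integral
      ((?K 1 * ((1 - 1\<^sup>2) * ?P' 1) - arcsin 1 * (1 - 1\<^sup>2) * ?P 1) -
       (?K (-1) * ((1 - (-1)\<^sup>2) * ?P' (-1)) - arcsin (-1) * (1 - (-1)\<^sup>2) * ?P (-1)))) {-1..1}"
  proof (rule has_integral_FTC_interior)
    fix t :: real assume t: "\<bar>t\<bar> < 1"
    have w: "?w t > 0" using one_minus_square_pos[OF t] by simp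
    have as: "(arcsin has_real_derivative 1 / ?w t) (at t)"
      using t by (auto intro!: derivative_eq_intros simp: divide_inverse)
    have "(?K has_real_derivative (- t / ?w t + (1 * arcsin t + (1 / ?w t) * t))) (at t)"
      by (rule DERIV_add DERIV_sqrt_one_minus_square t DERIV_mult DERIV_ident as)+
    then have K: "(?K has_real_derivative arcsin t) (at t)" by simp
    have q: "((\<lambda>t. 1 - t\<^sup>2) has_real_derivative - 2 * t) (at t)"
      by (auto intro!: derivative_eq_intros)
    have D: "((\<lambda>t. ?K t * ((1 - t\<^sup>2) * ?P' t) - arcsin t * (1 - t\<^sup>2) * ?P t) has_real_derivative
      (arcsin t * ((1 - t\<^sup>2) * ?P' t) + (- (real l * (real l + 1)) * ?P t) * ?K t) -
      ((1 / ?w t * (1 - t\<^sup>2) + (- 2 * t) * arcsin t) * ?P t + ?P' t * (arcsin t * (1 - t\<^sup>2)))) (at t)"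
      by (intro DERIV_diff DERIV_mult K ode as q poly_DERIV)
    have f: "1 / ?w t * (1 - t\<^sup>2) = ?w t"
      using one_minus_square_pos[OF t] real_div_sqrt[of "1 - t\<^sup>2"] by simp
    have E: "(arcsin t * ((1 - t\<^sup>2) * ?P' t) + (- (real l * (real l + 1)) * ?P t) * ?K t) -
      ((1 / ?w t * (1 - t\<^sup>2) + (- 2 * t) * arcsin t) * ?P t + ?P' t * (arcsin t * (1 - t\<^sup>2))) =
      - e * (?K t * ?P t) - 3 * (?w t * ?P t)"
      unfolding f e by (simp add: algebra_simps)
    show "((\<lambda>t. ?K t * ((1 - t\<^sup>2) * ?P' t) - arcsin t * (1 - t\<^sup>2) * ?P t) has_real_derivative - e * (?K t * ?P t) - 3 * (?w t * ?P t)) (at t)"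
      using D unfolding E .
  qed (auto intro!: continuous_intros continuous_on_arcsin)
  have "((\<lambda>t. - (1 / e) * ((- e * (?w t * ?P t) - ?P t / ?w t) + ?P t / ?w t)) has_integral
     (- (1 / e) * (0 + pi * (?P 0)\<^sup>2))) {-1..1}"
    by (intro has_integral_mult_right has_integral_add has_integral_legendre_div_sqrt) (use i1 in simp)
  then have w: "((\<lambda>t. ?w t * ?P t) has_integral (- (1 / e) * (pi * (?P 0)\<^sup>2))) {-1..1}"
    using e0 by simp
  have "((\<lambda>t. - (1 / e) * ((- e * (?K t * ?P t) - 3 * (?w t * ?P t)) + 3 * (?w t * ?P t))) has_integral
     (- (1 / e) * (0 + 3 * (- (1 / e) * (pi * (?P 0)\<^sup>2))))) {-1..1}"
    by (intro has_integral_mult_right has_integral_add w) (use i2 in simp)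
  then have "((\<lambda>t. ?K t * ?P t) has_integral (3 * pi * (?P 0 / e)\<^sup>2)) {-1..1}"
    using e0 by (simp add: power_divide power2_eq_square mult.assoc)
  moreover have "?P 0 / e = - abs_coeff l"
    using abs_coeff_even[OF assms] e0 by (simp add: e_def field_simps)
  ultimately show ?thesis by simp
qed

lemma kernel2_abs: "\<bar>t\<bar> \<le> 1 \<Longrightarrow> kernel2 \<bar>t\<bar> = kernel2 t"
  by (auto simp: kernel2_def abs_if arcsin_minus)

text \<open>The constant 1/4 in the kernel is a_0^2, so subtracting it cancels exactly the
  coefficient of degree 0. Odd degrees drop out by parity.\<close>

lemma kernel2_legendre_coeff:
  "1 / 2 * integral {-1..1} (\<lambda>t. kernel2 \<bar>t\<bar> * poly (legendre l) t) = (if l = 0 then 0 else (abs_coeff l)\<^sup>2)"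
proof (cases "even l")
  case True
  let ?K = "\<lambda>t::real. sqrt (1 - t\<^sup>2) + t * arcsin t" and ?P = "poly (legendre l)"
  have o: "integral {-1..1} ?P = (if l = 0 then 2 else 0)"
    using legendre_orthogonal[of 0 l] by (auto simp: field_simps)
  have "((\<lambda>t. 2 / (3 * pi) * (?K t * ?P t) - 1 / 4 * ?P t) has_integral
      (2 / (3 * pi) * (3 * pi * (abs_coeff l)\<^sup>2) - 1 / 4 * (if l = 0 then 2 else 0))) {-1..1}"
    unfolding o[symmetric]
    by (intro has_integral_diff has_integral_mult_right has_integral_legendre_kernel2 True integrable_integral integrable_poly_interval)
  then have "integral {-1..1} (\<lambda>t. kernel2 t * ?P t) = 2 / (3 * pi) * (3 * pi * (abs_coeff l)\<^sup>2) - 1 / 4 * (if l = 0 then 2 else 0)"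
    by (auto simp: kernel2_def algebra_simps dest!: integral_unique)
  also have "integral {-1..1} (\<lambda>t. kernel2 t * ?P t) = integral {-1..1} (\<lambda>t. kernel2 \<bar>t\<bar> * ?P t)"
    by (rule integral_cong) (simp add: kernel2_abs abs_le_iff)
  finally show ?thesis by (auto simp: abs_coeff_0 power2_eq_square)
next
  case False
  have "integral {-1..1} (\<lambda>t. kernel2 \<bar>t\<bar> * poly (legendre l) t) = integral {-1..1} (\<lambda>t. kernel2 \<bar>-t\<bar> * poly (legendre l) (-t))"
    using Henstock_Kurzweil_Integration.integral_reflect_real[of 1 "-1" "\<lambda>t. kernel2 \<bar>t\<bar> * poly (legendre l) t"] by simp
  also have "\<dots> = - integral {-1..1} (\<lambda>t. kernel2 \<bar>t\<bar> * poly (legendre l) t)"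
    using False by (simp add: legendre_parity)
  finally show ?thesis using False abs_coeff_odd by auto
qed

lemma continuous_on_kernel2_abs: "continuous_on {-1..1} (\<lambda>t. kernel2 \<bar>t\<bar>)"
  unfolding kernel2_def by (intro continuous_intros continuous_on_arcsin) auto

section \<open>Moments of the sphere\<close>

lemma borel_measurable_sphere_continuous:
  "continuous_on S2 f \<Longrightarrow> f \<in> borel_measurable sphere_borel"
  unfolding sphere_borel_def by (rule borel_measurable_continuous_on_restrict)

lemma bounded_continuous_sphere:
  fixes f :: "real^3 \<Rightarrow> 'b::real_normed_vector"
  assumes "continuous_on S2 f" shows "\<exists>B\<ge>0. \<forall>x\<in>S2. norm (f x) \<le> B"
proof -
  have "bounded (f ` S2)" using assms by (intro compact_imp_bounded compact_continuous_image) auto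
  then show ?thesis unfolding bounded_pos by (auto intro: less_imp_le)
qed

lemma integrable_sphere_continuous:
  fixes f :: "real^3 \<Rightarrow> 'b::euclidean_space"
  assumes "sets \<nu> = sets sphere_borel" "finite_measure \<nu>" "continuous_on S2 f"
  shows "integrable \<nu> f"
proof -
  obtain B where B: "\<forall>x\<in>S2. norm (f x) \<le> B" using bounded_continuous_sphere[OF assms(3)] by auto
  have "space \<nu> = S2" using sets_eq_imp_space_eq[OF assms(1)] by simp
  moreover have "f \<in> borel_measurable \<nu>"
    using borel_measurable_sphere_continuous[OF assms(3)] by (simp add: measurable_cong_sets[OF assms(1) refl])
  ultimately show ?thesis
    using B by (intro finite_measure.integrable_const_bound[OF assms(2), of _ B] AE_I2) auto
qed

lemma finite_sphere_measure: "finite_measure sphere_measure"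
  by (rule prob_space.finite_measure[OF prob_space_sphere_measure])

lemma integrable_sphere_measure:
  fixes f :: "real^3 \<Rightarrow> 'b::euclidean_space"
  shows "continuous_on S2 f \<Longrightarrow> integrable sphere_measure f"
  by (rule integrable_sphere_continuous) (auto simp: finite_sphere_measure)

lemma measure_sphere_measure [simp]: "measure sphere_measure S2 = 1"
  using prob_space.prob_space[OF prob_space_sphere_measure] by simp

lemma integral_sphere_const: "(\<integral>x. (c::'b::euclidean_space) \<partial>sphere_measure) = c"
  by simp

lemma integral_sphere_cong:
  "(\<And>x. x \<in> S2 \<Longrightarrow> f x = g x) \<Longrightarrow> integral\<^sup>L sphere_measure f = integral\<^sup>L sphere_measure g"
  by (rule Bochner_Integration.integral_cong) auto

section \<open>Moment recursion from rotations in coordinate planes\<close>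

text \<open>The plane is given by two indices, so that one computation covers every ordering of the
  coordinates in the moment recursion.\<close>

definition plane_rotation :: "3 \<Rightarrow> 3 \<Rightarrow> real \<Rightarrow> real^3^3" where
  "plane_rotation p q \<theta> = (\<chi> i j.
     if i = p then (if j = p then cos \<theta> else if j = q then - sin \<theta> else 0)
     else if i = q then (if j = p then sin \<theta> else if j = q then cos \<theta> else 0)
     else (if i = j then 1 else 0))"

lemma plane_rotation_apply:
  assumes "p \<noteq> q" "r \<noteq> p" "r \<noteq> q"
  shows "(plane_rotation p q \<theta> *v x) $ p = cos \<theta> * x $ p - sin \<theta> * x $ q"
    "(plane_rotation p q \<theta> *v x) $ q = sin \<theta> * x $ p + cos \<theta> * x $ q"
    "(plane_rotation p q \<theta> *v x) $ r = x $ r"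
  using assms exhaust_3[of p] exhaust_3[of q] exhaust_3[of r]
  by (auto simp: plane_rotation_def matrix_vector_mult_def sum_3)

lemma rotation_matrix_plane_rotation:
  assumes "p \<noteq> q" shows "rotation_matrix (plane_rotation p q \<theta>)"
proof -
  have sc: "sin \<theta> * sin \<theta> + cos \<theta> * cos \<theta> = 1" "cos \<theta> * cos \<theta> + sin \<theta> * sin \<theta> = 1"
    using sin_cos_squared_add[of \<theta>] by (simp_all add: power2_eq_square)
  have "\<forall>p q. p \<noteq> q \<longrightarrow> transpose (plane_rotation p q \<theta>) ** plane_rotation p q \<theta> = mat 1"
    unfolding forall_3
    by (simp add: plane_rotation_def vec_eq_iff forall_3 matrix_matrix_mult_def transpose_def mat_def sum_3 sc)
  moreover have "\<forall>p q. p \<noteq> q \<longrightarrow> det (plane_rotation p q \<theta>) = 1"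
    unfolding forall_3 by (simp add: plane_rotation_def det_3 sc)
  ultimately show ?thesis using assms by (simp add: rotation_matrix_def orthogonal_matrix)
qed

lemma integral_sphere_plane_rotation:
  fixes f :: "real^3 \<Rightarrow> real"
  assumes "p \<noteq> q" "continuous_on S2 f"
  shows "(\<integral>x. f (plane_rotation p q \<theta> *v x) \<partial>sphere_measure) = (\<integral>x. f x \<partial>sphere_measure)"
proof -
  let ?A = "plane_rotation p q \<theta>"
  have rm: "rotation_matrix ?A" by (rule rotation_matrix_plane_rotation[OF assms(1)])
  have "orthogonal_transformation (\<lambda>x. ?A *v x)"
    using rm by (auto simp: orthogonal_transformation_matrix rotation_matrix_def)
  then have n: "norm (?A *v x) = norm x" for x by (simp add: orthogonal_transformation)
  have m: "(\<lambda>x. ?A *v x) \<in> measurable sphere_measure sphere_borel"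
    unfolding measurable_cong_sets[OF sets_sphere_measure refl] sphere_borel_def
    by (intro measurable_restrict_space2 measurable_restrict_space1 borel_measurable_continuous_onI linear_continuous_on)
       (auto simp: linear_linear[symmetric] space_restrict_space n)
  have "(\<integral>x. f x \<partial>sphere_measure) = (\<integral>x. f x \<partial>distr sphere_measure sphere_borel (\<lambda>x. ?A *v x))"
    by (simp add: sphere_measure_rotation_invariant[OF rm])
  also have "\<dots> = (\<integral>x. f (?A *v x) \<partial>sphere_measure)"
    by (rule integral_distr[OF m borel_measurable_sphere_continuous[OF assms(2)]])
  finally show ?thesis ..
qed

text \<open>Infinitesimal rotation invariance in the \<open>p\<close>-\<open>q\<close>-plane, applied to
  \<open>x\<^sub>p ^ a * x\<^sub>q ^ Suc b * x\<^sub>r ^ c\<close>.\<close>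

lemma sphere_moment_shift:
  fixes p q r :: 3
  assumes pqr: "p \<noteq> q" "r \<noteq> p" "r \<noteq> q"
  shows "(real b + 1) * (\<integral>x. (x $ p) ^ Suc a * (x $ q) ^ b * (x $ r) ^ c \<partial>sphere_measure) =
     a * (\<integral>x. (x $ p) ^ (a - 1) * (x $ q) ^ (b + 2) * (x $ r) ^ c \<partial>sphere_measure)"
proof -
  define g where "g x = (x $ p) ^ a * (x $ q) ^ Suc b * (x $ r) ^ c" for x :: "real^3"
  define R where "R \<theta> x = plane_rotation p q \<theta> *v x" for \<theta> and x :: "real^3"
  define L where "L x = (real b + 1) * ((x $ p) ^ Suc a * (x $ q) ^ b * (x $ r) ^ c) -
      a * ((x $ p) ^ (a - 1) * (x $ q) ^ (b + 2) * (x $ r) ^ c)" for x :: "real^3"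
  have gc: "continuous_on S2 g" and Lc: "continuous_on S2 L"
    unfolding g_def L_def by (intro continuous_intros)+
  have Rp: "R \<theta> x $ p = cos \<theta> * x $ p - sin \<theta> * x $ q"
    and Rq: "R \<theta> x $ q = sin \<theta> * x $ p + cos \<theta> * x $ q" and Rr: "R \<theta> x $ r = x $ r" for \<theta> x
    unfolding R_def by (rule plane_rotation_apply[OF pqr])+
  have Rn: "R \<theta> x \<in> S2" if "x \<in> S2" for \<theta> x
  proof -
    have "orthogonal_transformation (\<lambda>x. plane_rotation p q \<theta> *v x)"
      using rotation_matrix_plane_rotation[OF pqr(1)] by (auto simp: orthogonal_transformation_matrix rotation_matrix_def)
    then show ?thesis using that by (simp add: R_def orthogonal_transformation)
  qed
  have dp: "((\<lambda>\<theta>. R \<theta> x $ p) has_real_derivative - (R \<theta> x $ q)) (at \<theta>)"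
    and dq: "((\<lambda>\<theta>. R \<theta> x $ q) has_real_derivative (R \<theta> x $ p)) (at \<theta>)" for x \<theta>
    unfolding Rp Rq by (auto intro!: derivative_eq_intros)
  have d: "((\<lambda>\<theta>. g (R \<theta> x)) has_real_derivative L (R \<theta> x)) (at \<theta>)" for x \<theta>
  proof -
    have "((\<lambda>\<theta>. (R \<theta> x $ p) ^ a * (R \<theta> x $ q) ^ Suc b * (x $ r) ^ c) has_real_derivative L (R \<theta> x)) (at \<theta>)"
      unfolding L_def Rr
      by (rule derivative_eq_intros dp dq refl)+ (simp add: algebra_simps)
    then show ?thesis by (simp add: g_def Rr)
  qed
  obtain B where B: "\<And>x. x \<in> S2 \<Longrightarrow> norm (L x) \<le> B" using bounded_continuous_sphere[OF Lc] by blast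
  have bd: "norm ((g (R \<theta> x) - g (R 0 x)) / \<theta>) \<le> B" if "x \<in> S2" "\<theta> \<noteq> 0" for x \<theta>
  proof -
    have "norm (g (R \<theta> x) - g (R 0 x)) \<le> B * norm (\<theta> - 0)"
      by (rule field_differentiable_bound[of UNIV])
         (use d B Rn that in \<open>auto simp: has_field_derivative_at_within\<close>)
    then show ?thesis using that by (simp add: field_simps)
  qed
  have R0: "R 0 x = x" if "x \<in> S2" for x
    using Rp[of 0 x] Rq[of 0 x] Rr[of 0 x] pqr exhaust_3[of p] exhaust_3[of q] exhaust_3[of r]
    by (auto simp: vec_eq_iff forall_3)
  define t where "t n = inverse (real (Suc n))" for n
  have t: "t \<longlonglongrightarrow> 0" "t n \<noteq> 0" for n unfolding t_def by (rule LIMSEQ_inverse_real_of_nat) simp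
  have gm: "(\<lambda>x. g (R \<theta> x)) \<in> borel_measurable sphere_measure" for \<theta>
    unfolding measurable_cong_sets[OF sets_sphere_measure refl]
    by (rule borel_measurable_sphere_continuous) (simp add: g_def Rp Rq Rr, intro continuous_intros)
  have "(\<lambda>n. \<integral>x. (g (R (t n) x) - g (R 0 x)) / t n \<partial>sphere_measure) \<longlonglongrightarrow> (\<integral>x. L x \<partial>sphere_measure)"
  proof (rule integral_dominated_convergence[where w = "\<lambda>_. B"])
    show "L \<in> borel_measurable sphere_measure"
      using integrable_sphere_measure[OF Lc] by simp
    show "(\<lambda>x. (g (R (t n) x) - g (R 0 x)) / t n) \<in> borel_measurable sphere_measure" for n
      by (intro borel_measurable_divide borel_measurable_diff gm) simp
    show "AE x in sphere_measure. (\<lambda>n. (g (R (t n) x) - g (R 0 x)) / t n) \<longlonglongrightarrow> L x"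
    proof (rule AE_I2)
      fix x assume "x \<in> space sphere_measure"
      then have "((\<lambda>\<theta>. (g (R \<theta> x) - g (R 0 x)) / \<theta>) \<longlongrightarrow> L x) (at 0)"
        using d[of x 0] R0[of x] by (simp add: has_field_derivative_iff)
      then show "(\<lambda>n. (g (R (t n) x) - g (R 0 x)) / t n) \<longlonglongrightarrow> L x"
        by (rule filterlim_compose) (simp add: filterlim_at t)
    qed
    show "AE x in sphere_measure. norm ((g (R (t n) x) - g (R 0 x)) / t n) \<le> B" for n
      using bd t(2) by (intro AE_I2) auto
  qed (auto simp: finite_measure.integrable_const[OF finite_sphere_measure])
  moreover have "(\<integral>x. (g (R (t n) x) - g (R 0 x)) / t n \<partial>sphere_measure) = 0" for n
  proof -
    have i: "integrable sphere_measure (\<lambda>x. g (R \<theta> x))" for \<theta>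
      by (rule integrable_sphere_measure) (simp add: g_def Rp Rq Rr, intro continuous_intros)
    have "(\<integral>x. g (R \<theta> x) \<partial>sphere_measure) = (\<integral>x. g x \<partial>sphere_measure)" for \<theta>
      unfolding R_def by (rule integral_sphere_plane_rotation[OF pqr(1) gc])
    then show ?thesis using i by simp
  qed
  ultimately have "(\<lambda>n::nat. 0) \<longlonglongrightarrow> (\<integral>x. L x \<partial>sphere_measure)" by (simp only:)
  then have "(\<integral>x. L x \<partial>sphere_measure) = 0" by (simp only: LIMSEQ_const_iff)
  moreover have "(\<integral>x. L x \<partial>sphere_measure) =
     (real b + 1) * (\<integral>x. (x $ p) ^ Suc a * (x $ q) ^ b * (x $ r) ^ c \<partial>sphere_measure) -
     a * (\<integral>x. (x $ p) ^ (a - 1) * (x $ q) ^ (b + 2) * (x $ r) ^ c \<partial>sphere_measure)"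
    unfolding L_def
    by (subst Bochner_Integration.integral_diff)
       (auto intro!: integrable_sphere_measure continuous_intros)
  ultimately show ?thesis by simp
qed

lemma sphere_sum_squares:
  fixes p q r :: 3
  assumes "p \<noteq> q" "r \<noteq> p" "r \<noteq> q" "x \<in> S2"
  shows "(x $ p)\<^sup>2 + (x $ q)\<^sup>2 + (x $ r)\<^sup>2 = 1"
proof -
  have "(x $ 1)\<^sup>2 + (x $ 2)\<^sup>2 + (x $ 3)\<^sup>2 = 1"
    using assms(4) by (simp add: norm_eq_1 inner_vec_def sum_3 power2_eq_square)
  then show ?thesis
    using assms exhaust_3[of p] exhaust_3[of q] exhaust_3[of r] by auto
qed

text \<open>Multiply by x_p^2 + x_q^2 + x_r^2 = 1 and move the squares of x_q and x_r onto x_p with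
  \<open>sphere_moment_shift\<close>; the weights add up to a + (b + 1) + (c + 1). For a = 0 the
  truncated exponent is masked by the factor a, and the moment on the right vanishes.\<close>

lemma sphere_moment_rec:
  fixes p q r :: 3
  assumes pqr: "p \<noteq> q" "r \<noteq> p" "r \<noteq> q"
  shows "real a * (\<integral>x. (x $ p) ^ (a - 1) * (x $ q) ^ b * (x $ r) ^ c \<partial>sphere_measure) =
     (real (a + b + c) + 2) * (\<integral>x. (x $ p) ^ Suc a * (x $ q) ^ b * (x $ r) ^ c \<partial>sphere_measure)"
proof (cases a)
  case 0
  then show ?thesis using sphere_moment_shift[OF pqr, of b 0 c] by (simp add: add_nonneg_eq_0_iff)
next
  case (Suc a')
  let ?M = "\<lambda>a b c. \<integral>x. (x $ p) ^ a * (x $ q) ^ b * (x $ r) ^ c \<partial>sphere_measure"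
  have "?M a' b c = (\<integral>x. (x $ p) ^ (a' + 2) * (x $ q) ^ b * (x $ r) ^ c +
      (x $ p) ^ a' * (x $ q) ^ (b + 2) * (x $ r) ^ c + (x $ p) ^ a' * (x $ q) ^ b * (x $ r) ^ (c + 2) \<partial>sphere_measure)"
  proof (rule integral_sphere_cong)
    fix x :: "real^3" assume "x \<in> S2"
    then have "(x $ p) ^ a' * (x $ q) ^ b * (x $ r) ^ c = ((x $ p) ^ a' * (x $ q) ^ b * (x $ r) ^ c) * ((x $ p)\<^sup>2 + (x $ q)\<^sup>2 + (x $ r)\<^sup>2)"
      using sphere_sum_squares[OF pqr] by simp
    also have "\<dots> = (x $ p) ^ (a' + 2) * (x $ q) ^ b * (x $ r) ^ c +
      (x $ p) ^ a' * (x $ q) ^ (b + 2) * (x $ r) ^ c + (x $ p) ^ a' * (x $ q) ^ b * (x $ r) ^ (c + 2)"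
      by (simp add: power_add algebra_simps power2_eq_square)
    finally show "(x $ p) ^ a' * (x $ q) ^ b * (x $ r) ^ c = (x $ p) ^ (a' + 2) * (x $ q) ^ b * (x $ r) ^ c +
      (x $ p) ^ a' * (x $ q) ^ (b + 2) * (x $ r) ^ c + (x $ p) ^ a' * (x $ q) ^ b * (x $ r) ^ (c + 2)" .
  qed
  also have "\<dots> = ?M (a' + 2) b c + ?M a' (b + 2) c + ?M a' b (c + 2)"
    by (subst Bochner_Integration.integral_add Bochner_Integration.integral_add,
        auto intro!: integrable_sphere_measure continuous_intros Bochner_Integration.integral_add)
  finally have s: "?M a' b c = ?M (a' + 2) b c + ?M a' (b + 2) c + ?M a' b (c + 2)" .
  have 1: "(real b + 1) * ?M (a' + 2) b c = real (Suc a') * ?M a' (b + 2) c"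
    using sphere_moment_shift[OF pqr, of b "Suc a'" c] by simp
  have 2: "(real c + 1) * ?M (a' + 2) b c = real (Suc a') * ?M a' b (c + 2)"
    using sphere_moment_shift[of p r q c "Suc a'" b] pqr by (simp add: mult_ac)
  show ?thesis using arg_cong[OF s, of "\<lambda>t. real (Suc a') * t"] 1 2 Suc
    by (simp add: algebra_simps)
qed

section \<open>Homogeneous polynomials and the Funk-Hecke formula\<close>

definition monomial :: "nat \<Rightarrow> nat \<Rightarrow> nat \<Rightarrow> real^3 \<Rightarrow> complex" where
  "monomial i j k x = of_real ((x $ 1) ^ i * (x $ 2) ^ j * (x $ 3) ^ k)"

lemma finite_exponents: "finite {(i, j, k). i + j + k = (l::nat)}"
  by (rule finite_subset[of _ "{..l} \<times> {..l} \<times> {..l}"]) auto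

lemma homogeneous_polynomial_iff:
  "homogeneous_polynomial l p \<longleftrightarrow>
    (\<exists>c. p = (\<lambda>x. \<Sum>e\<in>{(i, j, k). i + j + k = l}. c e * (case e of (i, j, k) \<Rightarrow> monomial i j k x)))"
proof
  assume "homogeneous_polynomial l p"
  then obtain c where "\<forall>x. p x = (\<Sum>(i, j, k) \<in> {(i, j, k). i + j + k = l}.
               c i j k * of_real ((x $ 1) ^ i * (x $ 2) ^ j * (x $ 3) ^ k))"
    unfolding homogeneous_polynomial_def by blast
  then show "\<exists>c. p = (\<lambda>x. \<Sum>e\<in>{(i, j, k). i + j + k = l}. c e * (case e of (i, j, k) \<Rightarrow> monomial i j k x))"
    by (intro exI[of _ "\<lambda>(i, j, k). c i j k"]) (auto simp: monomial_def case_prod_unfold fun_eq_iff)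
next
  assume "\<exists>c. p = (\<lambda>x. \<Sum>e\<in>{(i, j, k). i + j + k = l}. c e * (case e of (i, j, k) \<Rightarrow> monomial i j k x))"
  then obtain c where "p = (\<lambda>x. \<Sum>e\<in>{(i, j, k). i + j + k = l}. c e * (case e of (i, j, k) \<Rightarrow> monomial i j k x))" by blast
  then show "homogeneous_polynomial l p"
    unfolding homogeneous_polynomial_def
    by (intro exI[of _ "\<lambda>i j k. c (i, j, k)"]) (auto simp: monomial_def case_prod_unfold)
qed

lemma homogeneous_polynomial_monomial: 
  assumes "i + j + k = l" shows "homogeneous_polynomial l (monomial i j k)"
  unfolding homogeneous_polynomial_iff
proof (intro exI ext)
  fix x
  have "(\<Sum>e\<in>{(i, j, k). i + j + k = l}. (if e = (i, j, k) then 1 else 0) * (case e of (i, j, k) \<Rightarrow> monomial i j k x)) =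
      (\<Sum>e\<in>{(i, j, k). i + j + k = l}. if e = (i, j, k) then monomial i j k x else 0)"
    by (intro sum.cong) auto
  also have "\<dots> = monomial i j k x" using finite_exponents[of l] assms by simp
  finally show "monomial i j k x = (\<Sum>e\<in>{(i, j, k). i + j + k = l}. (if e = (i, j, k) then 1 else 0) * (case e of (i, j, k) \<Rightarrow> monomial i j k x))" ..
qed

lemma homogeneous_polynomial_zero: "homogeneous_polynomial l (\<lambda>_. 0)"
  unfolding homogeneous_polynomial_iff by (intro exI[of _ "\<lambda>_. 0"]) simp

lemma homogeneous_polynomial_add:
  assumes "homogeneous_polynomial l f" "homogeneous_polynomial l g"
  shows "homogeneous_polynomial l (\<lambda>x. f x + g x)"
proof -
  obtain c d where "f = (\<lambda>x. \<Sum>e\<in>{(i, j, k). i + j + k = l}. c e * (case e of (i, j, k) \<Rightarrow> monomial i j k x))"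
    "g = (\<lambda>x. \<Sum>e\<in>{(i, j, k). i + j + k = l}. d e * (case e of (i, j, k) \<Rightarrow> monomial i j k x))"
    using assms unfolding homogeneous_polynomial_iff by blast
  then show ?thesis unfolding homogeneous_polynomial_iff
    by (intro exI[of _ "\<lambda>e. c e + d e"]) (simp add: sum.distrib distrib_right)
qed

lemma homogeneous_polynomial_scale:
  assumes "homogeneous_polynomial l f" shows "homogeneous_polynomial l (\<lambda>x. c * f x)"
proof -
  obtain d where "f = (\<lambda>x. \<Sum>e\<in>{(i, j, k). i + j + k = l}. d e * (case e of (i, j, k) \<Rightarrow> monomial i j k x))"
    using assms unfolding homogeneous_polynomial_iff by blast
  then show ?thesis unfolding homogeneous_polynomial_iff
    by (intro exI[of _ "\<lambda>e. c * d e"]) (simp add: sum_distrib_left mult.assoc)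
qed

lemma homogeneous_polynomial_sum:
  "(\<And>a. a \<in> A \<Longrightarrow> homogeneous_polynomial l (f a)) \<Longrightarrow> homogeneous_polynomial l (\<lambda>x. \<Sum>a\<in>A. f a x)"
  by (induction A rule: infinite_finite_induct)
     (auto intro: homogeneous_polynomial_zero homogeneous_polynomial_add)

text \<open>Facts that are linear in the polynomial are reduced to monomials. Homogeneity of the
  parts stays among the hypotheses, so that their smoothness is available in the linear
  steps.\<close>

lemma homogeneous_polynomial_induct [consumes 1, case_names zero monomial add scale]:
  assumes "homogeneous_polynomial l f"
    and zero: "P (\<lambda>_. 0)"
    and mono: "\<And>i j k. i + j + k = l \<Longrightarrow> P (monomial i j k)"
    and add: "\<And>f g. homogeneous_polynomial l f \<Longrightarrow> homogeneous_polynomial l g \<Longrightarrow> P f \<Longrightarrow> P g \<Longrightarrow> P (\<lambda>x. f x + g x)"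
    and scale: "\<And>c f. homogeneous_polynomial l f \<Longrightarrow> P f \<Longrightarrow> P (\<lambda>x. c * f x)"
  shows "P f"
proof -
  let ?I = "{(i, j, k). i + j + k = l}" and ?m = "\<lambda>e x. case e of (i, j, k) \<Rightarrow> monomial i j k x"
  obtain c where f: "f = (\<lambda>x. \<Sum>e\<in>?I. c e * ?m e x)"
    using assms(1) unfolding homogeneous_polynomial_iff by blast
  have m: "homogeneous_polynomial l (?m e) \<and> P (?m e)" if "e \<in> ?I" for e
    using that mono homogeneous_polynomial_monomial by (cases e) auto
  have "homogeneous_polynomial l (\<lambda>x. \<Sum>e\<in>A. c e * ?m e x) \<and> P (\<lambda>x. \<Sum>e\<in>A. c e * ?m e x)" if "A \<subseteq> ?I" for A
    using finite_subset[OF that finite_exponents] that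
  proof (induction A rule: finite_induct)
    case empty then show ?case using zero homogeneous_polynomial_zero by simp
  next
    case (insert e A)
    then have "homogeneous_polynomial l (\<lambda>x. c e * ?m e x) \<and> P (\<lambda>x. c e * ?m e x)"
      using m[of e] scale[of "?m e" "c e"] homogeneous_polynomial_scale[of l "?m e" "c e"] by auto
    then show ?case using insert
        add[of "\<lambda>x. c e * ?m e x" "\<lambda>x. \<Sum>e\<in>A. c e * ?m e x"]
        homogeneous_polynomial_add[of l "\<lambda>x. c e * ?m e x" "\<lambda>x. \<Sum>e\<in>A. c e * ?m e x"] by auto
  qed
  then show ?thesis unfolding f by blast
qed

lemma monomial_mult: "monomial i j k x * monomial i' j' k' x = monomial (i + i') (j + j') (k + k') x"
  by (simp add: monomial_def power_add)

lemma homogeneous_polynomial_mult: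
  assumes "homogeneous_polynomial l f" "homogeneous_polynomial m g"
  shows "homogeneous_polynomial (l + m) (\<lambda>x. f x * g x)"
  using assms(1)
proof (induction rule: homogeneous_polynomial_induct)
  case (monomial i j k)
  then have ijk: "l = i + j + k" by simp
  show ?case using assms(2)
  proof (induction rule: homogeneous_polynomial_induct)
    case (monomial i' j' k')
    then show ?case unfolding monomial_mult ijk
      by (intro homogeneous_polynomial_monomial) simp
  qed (auto simp: distrib_left mult.left_commute intro: homogeneous_polynomial_zero homogeneous_polynomial_add homogeneous_polynomial_scale)
qed (auto simp: distrib_right mult.assoc intro: homogeneous_polynomial_zero homogeneous_polynomial_add homogeneous_polynomial_scale)

lemma homogeneous_polynomial_const: "homogeneous_polynomial 0 (\<lambda>_. c)"
  using homogeneous_polynomial_scale[OF homogeneous_polynomial_monomial[of 0 0 0 0], of c] by (simp add: monomial_def)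

lemma homogeneous_polynomial_inner: "homogeneous_polynomial 1 (\<lambda>x. of_real (u \<bullet> x))"
proof -
  have "homogeneous_polynomial 1 (\<lambda>x. of_real (u $ 1) * monomial 1 0 0 x + (of_real (u $ 2) * monomial 0 1 0 x + of_real (u $ 3) * monomial 0 0 1 x))"
    by (intro homogeneous_polynomial_add homogeneous_polynomial_scale homogeneous_polynomial_monomial) auto
  moreover have "of_real (u $ 1) * monomial 1 0 0 x + (of_real (u $ 2) * monomial 0 1 0 x + of_real (u $ 3) * monomial 0 0 1 x) = of_real (u \<bullet> x)" for x
    by (simp add: monomial_def inner_vec_def sum_3)
  ultimately show ?thesis by simp
qed

lemma homogeneous_polynomial_inner_power: "homogeneous_polynomial k (\<lambda>x. of_real ((u \<bullet> x) ^ k))"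
proof (induction k)
  case 0 then show ?case using homogeneous_polynomial_const[of 1] by simp
next
  case (Suc k)
  show ?case using homogeneous_polynomial_mult[OF homogeneous_polynomial_inner[of u] Suc] by simp
qed

lemma homogeneous_polynomial_scaleR:
  "homogeneous_polynomial l f \<Longrightarrow> f (t *\<^sub>R x) = of_real t ^ l * f x"
proof (induction rule: homogeneous_polynomial_induct)
  case (monomial i j k)
  then have l: "l = i + j + k" by simp
  show ?case unfolding l monomial_def by (simp add: power_mult_distrib power_add mult_ac)
qed (auto simp: algebra_simps)

lemma continuous_on_homogeneous_polynomial:
  "homogeneous_polynomial l f \<Longrightarrow> continuous_on S f"
proof (induction rule: homogeneous_polynomial_induct)
  case (monomial i j k)
  then show ?case unfolding monomial_def[abs_def] by (intro continuous_intros)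
qed (auto intro!: continuous_intros)

section \<open>Differentiation along lines and the Laplacian\<close>

text \<open>Only one-variable derivatives enter, as in the definition of \<open>laplacian\<close>;
  the calculus below is built from them alone.\<close>

definition line_smooth :: "(real^3 \<Rightarrow> complex) \<Rightarrow> bool" where
  "line_smooth f \<longleftrightarrow> (\<forall>x v s. (\<lambda>t. f (x + t *\<^sub>R v)) differentiable (at s))"

definition dir_deriv :: "real^3 \<Rightarrow> (real^3 \<Rightarrow> complex) \<Rightarrow> real^3 \<Rightarrow> complex" where
  "dir_deriv v f x = vector_derivative (\<lambda>t. f (x + t *\<^sub>R v)) (at 0)"

lemma has_dir_deriv:
  assumes "line_smooth f"
  shows "((\<lambda>t. f (x + t *\<^sub>R v)) has_vector_derivative dir_deriv v f (x + s *\<^sub>R v)) (at s)"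
proof -
  obtain D where D: "((\<lambda>t. f (x + t *\<^sub>R v)) has_vector_derivative D) (at s)"
    using assms unfolding line_smooth_def by (metis vector_derivative_works)
  have "(((\<lambda>t. f (x + t *\<^sub>R v)) \<circ> (\<lambda>t. s + t)) has_vector_derivative 1 *\<^sub>R D) (at 0)"
    by (rule vector_diff_chain_at) (auto intro!: derivative_eq_intros simp: D)
  then have "((\<lambda>t. f ((x + s *\<^sub>R v) + t *\<^sub>R v)) has_vector_derivative D) (at 0)"
    by (simp add: o_def algebra_simps)
  then show ?thesis using D unfolding dir_deriv_def by (simp add: vector_derivative_at)
qed

lemma has_dir_deriv_0:
  "line_smooth f \<Longrightarrow> ((\<lambda>t. f (x + t *\<^sub>R v)) has_vector_derivative dir_deriv v f x) (at 0)"
  using has_dir_deriv[of f x v 0] by simp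

lemma dir_deriv_eqI:
  "((\<lambda>t. f (x + t *\<^sub>R v)) has_vector_derivative D) (at 0) \<Longrightarrow> dir_deriv v f x = D"
  unfolding dir_deriv_def by (rule vector_derivative_at)

lemma line_smoothI:
  "(\<And>x v s. ((\<lambda>t. f (x + t *\<^sub>R v)) has_vector_derivative D x v s) (at s)) \<Longrightarrow> line_smooth f"
  unfolding line_smooth_def using differentiableI_vector by blast

lemma line_smooth_const: "line_smooth (\<lambda>_. c)"
  by (rule line_smoothI) (rule derivative_intros)

lemma line_smooth_add: "line_smooth f \<Longrightarrow> line_smooth g \<Longrightarrow> line_smooth (\<lambda>x. f x + g x)"
  by (rule line_smoothI) (rule has_vector_derivative_add has_dir_deriv | assumption)+

lemma line_smooth_mult: "line_smooth f \<Longrightarrow> line_smooth g \<Longrightarrow> line_smooth (\<lambda>x. f x * g x)"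
  by (rule line_smoothI) (rule has_vector_derivative_mult has_dir_deriv | assumption)+

lemma dir_deriv_const: "dir_deriv v (\<lambda>_. c) = (\<lambda>_. 0)"
  by (rule ext, rule dir_deriv_eqI) (rule derivative_intros)

lemma dir_deriv_add:
  "line_smooth f \<Longrightarrow> line_smooth g \<Longrightarrow> dir_deriv v (\<lambda>x. f x + g x) = (\<lambda>x. dir_deriv v f x + dir_deriv v g x)"
  by (rule ext, rule dir_deriv_eqI) (rule has_vector_derivative_add has_dir_deriv_0 | assumption)+

lemma dir_deriv_mult:
  "line_smooth f \<Longrightarrow> line_smooth g \<Longrightarrow>
    dir_deriv v (\<lambda>x. f x * g x) = (\<lambda>x. f x * dir_deriv v g x + dir_deriv v f x * g x)"
  by (rule ext, rule dir_deriv_eqI)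
     (use has_vector_derivative_mult[OF has_dir_deriv_0 has_dir_deriv_0] in fastforce)

lemma dir_deriv_scale:
  "line_smooth f \<Longrightarrow> dir_deriv v (\<lambda>x. c * f x) = (\<lambda>x. c * dir_deriv v f x)"
  by (simp add: dir_deriv_mult line_smooth_const dir_deriv_const)

lemma line_smooth_sum: "(\<And>a. a \<in> A \<Longrightarrow> line_smooth (f a)) \<Longrightarrow> line_smooth (\<lambda>x. \<Sum>a\<in>A. f a x)"
  by (induction A rule: infinite_finite_induct) (auto intro: line_smooth_const line_smooth_add)

lemma dir_deriv_sum:
  "(\<And>a. a \<in> A \<Longrightarrow> line_smooth (f a)) \<Longrightarrow> dir_deriv v (\<lambda>x. \<Sum>a\<in>A. f a x) = (\<lambda>x. \<Sum>a\<in>A. dir_deriv v (f a) x)"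
  by (induction A rule: infinite_finite_induct) (auto simp: dir_deriv_const dir_deriv_add line_smooth_sum)

lemma laplacian_dir_deriv:
  assumes "line_smooth f" shows "laplacian f x = (\<Sum>b\<in>Basis. dir_deriv b (dir_deriv b f) x)"
  unfolding laplacian_def vector_derivative_at[OF has_dir_deriv[OF assms]]
  by (simp add: dir_deriv_def)

lemma has_vector_derivative_monomial:
  "((\<lambda>t. monomial i j k (x + t *\<^sub>R v)) has_vector_derivative
     (of_real (v $ 1) * (of_nat i * monomial (i - 1) j k (x + s *\<^sub>R v)) +
      (of_real (v $ 2) * (of_nat j * monomial i (j - 1) k (x + s *\<^sub>R v)) +
       of_real (v $ 3) * (of_nat k * monomial i j (k - 1) (x + s *\<^sub>R v))))) (at s)"
proof -
  let ?X = "\<lambda>i t. (x + t *\<^sub>R v) $ i"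
  have "((\<lambda>t. (?X 1 t) ^ i * (?X 2 t) ^ j * (?X 3 t) ^ k) has_real_derivative
      (v $ 1 * (i * (?X 1 s ^ (i - 1) * ?X 2 s ^ j * ?X 3 s ^ k)) +
       (v $ 2 * (j * (?X 1 s ^ i * ?X 2 s ^ (j - 1) * ?X 3 s ^ k)) +
        v $ 3 * (k * (?X 1 s ^ i * ?X 2 s ^ j * ?X 3 s ^ (k - 1)))))) (at s)"
    by (auto intro!: derivative_eq_intros simp: algebra_simps)
  then have "((\<lambda>t. of_real ((?X 1 t) ^ i * (?X 2 t) ^ j * (?X 3 t) ^ k)) has_vector_derivative
      complex_of_real (v $ 1 * (i * (?X 1 s ^ (i - 1) * ?X 2 s ^ j * ?X 3 s ^ k)) +
       (v $ 2 * (j * (?X 1 s ^ i * ?X 2 s ^ (j - 1) * ?X 3 s ^ k)) +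
        v $ 3 * (k * (?X 1 s ^ i * ?X 2 s ^ j * ?X 3 s ^ (k - 1)))))) (at s)"
    by (intro has_vector_derivative_of_real) (simp add: has_real_derivative_iff_has_vector_derivative)
  then show ?thesis unfolding monomial_def by simp
qed

lemma line_smooth_monomial: "line_smooth (monomial i j k)"
  by (rule line_smoothI) (rule has_vector_derivative_monomial)

lemma dir_deriv_monomial:
  "dir_deriv v (monomial i j k) = (\<lambda>x. of_real (v $ 1) * (of_nat i * monomial (i - 1) j k x) +
      (of_real (v $ 2) * (of_nat j * monomial i (j - 1) k x) +
       of_real (v $ 3) * (of_nat k * monomial i j (k - 1) x)))"
  by (rule ext, rule dir_deriv_eqI) (use has_vector_derivative_monomial[of i j k _ v 0] in simp)

lemma line_smooth_homogeneous_polynomial: "homogeneous_polynomial l f \<Longrightarrow> line_smooth f"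
  by (induction rule: homogeneous_polynomial_induct)
     (auto intro: line_smooth_const line_smooth_monomial line_smooth_add line_smooth_mult)

lemma homogeneous_polynomial_dir_deriv:
  "homogeneous_polynomial l f \<Longrightarrow> homogeneous_polynomial (l - 1) (dir_deriv v f)"
proof (induction rule: homogeneous_polynomial_induct)
  case zero then show ?case by (simp add: dir_deriv_const homogeneous_polynomial_zero)
next
  case (monomial i j k)
  have 1: "homogeneous_polynomial (l - 1) (\<lambda>x. of_nat i * monomial (i - 1) j k x)"
    using monomial
    by (cases "i = 0") (simp add: homogeneous_polynomial_zero, intro homogeneous_polynomial_scale homogeneous_polynomial_monomial, simp)
  have 2: "homogeneous_polynomial (l - 1) (\<lambda>x. of_nat j * monomial i (j - 1) k x)"
    using monomial
    by (cases "j = 0") (simp add: homogeneous_polynomial_zero, intro homogeneous_polynomial_scale homogeneous_polynomial_monomial, simp)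
  have 3: "homogeneous_polynomial (l - 1) (\<lambda>x. of_nat k * monomial i j (k - 1) x)"
    using monomial
    by (cases "k = 0") (simp add: homogeneous_polynomial_zero, intro homogeneous_polynomial_scale homogeneous_polynomial_monomial, simp)
  show ?case unfolding dir_deriv_monomial by (intro homogeneous_polynomial_add homogeneous_polynomial_scale 1 2 3)
next
  case (add f g)
  then show ?case by (simp add: dir_deriv_add line_smooth_homogeneous_polynomial homogeneous_polynomial_add)
next
  case (scale c f)
  then show ?case by (simp add: dir_deriv_scale line_smooth_homogeneous_polynomial homogeneous_polynomial_scale)
qed

lemmas line_smooth_dir_deriv = line_smooth_homogeneous_polynomial[OF homogeneous_polynomial_dir_deriv]

lemma dir_deriv_commute:
  "homogeneous_polynomial l f \<Longrightarrow> dir_deriv u (dir_deriv v f) = dir_deriv v (dir_deriv u f)"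
proof (induction rule: homogeneous_polynomial_induct)
  case zero then show ?case by (simp add: dir_deriv_const)
next
  case (monomial i j k)
  show ?case
    unfolding dir_deriv_monomial
    by (simp add: dir_deriv_add dir_deriv_scale line_smooth_add line_smooth_mult line_smooth_const
          line_smooth_monomial dir_deriv_monomial)
       (simp add: fun_eq_iff algebra_simps)
next
  case (add f g)
  then show ?case using line_smooth_dir_deriv line_smooth_homogeneous_polynomial by (simp add: dir_deriv_add)
next
  case (scale c f)
  then show ?case using line_smooth_dir_deriv line_smooth_homogeneous_polynomial by (simp add: dir_deriv_scale)
qed

lemma Basis_3: "(Basis :: (real^3) set) = {axis 1 1, axis 2 1, axis 3 1}"
  by (auto simp: Basis_vec_def UNIV_3)

lemma sum_Basis_3: "(\<Sum>b\<in>(Basis :: (real^3) set). g b) = g (axis 1 1) + (g (axis 2 1) + g (axis 3 1))"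
  unfolding Basis_3 by (simp add: axis_eq_axis)

text \<open>Linearity of the derivative in its direction. \<open>line_smooth\<close> alone does not
  give it, so it is checked on monomials, where the derivative is an explicit linear form in
  u.\<close>

lemma dir_deriv_Basis:
  "homogeneous_polynomial l f \<Longrightarrow> (\<Sum>b\<in>Basis. of_real (u \<bullet> b) * dir_deriv b f x) = dir_deriv u f x"
proof (induction rule: homogeneous_polynomial_induct)
  case zero then show ?case by (simp add: dir_deriv_const)
next
  case (monomial i j k)
  have "axis p (1::real) $ q = (if p = q then 1 else 0)" for p q :: 3 by (simp add: axis_def)
  then show ?case unfolding sum_Basis_3 dir_deriv_monomial by (simp add: inner_axis)
next
  case (add f g)
  then show ?case using line_smooth_homogeneous_polynomial by (simp add: dir_deriv_add distrib_left sum.distrib)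
next
  case (scale c f)
  then show ?case using line_smooth_homogeneous_polynomial
    by (simp add: dir_deriv_scale mult.left_commute sum_distrib_left[symmetric])
qed

text \<open>Euler's identity: at u + t u the polynomial is (1 + t)^l times its value at u.\<close>

lemma dir_deriv_self:
  assumes "homogeneous_polynomial l f" shows "dir_deriv u f u = of_nat l * f u"
proof (rule dir_deriv_eqI)
  have "f (u + t *\<^sub>R u) = of_real ((1 + t) ^ l) * f u" for t
    using homogeneous_polynomial_scaleR[OF assms, of "1 + t" u] by (simp add: algebra_simps)
  moreover have "((\<lambda>t. of_real ((1 + t) ^ l) * f u) has_vector_derivative of_real (real l) * f u) (at 0)"
    by (intro has_vector_derivative_mult_left has_vector_derivative_of_real)
       (auto simp: has_real_derivative_iff_has_vector_derivative[symmetric] intro!: derivative_eq_intros)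
  ultimately show "((\<lambda>t. f (u + t *\<^sub>R u)) has_vector_derivative of_nat l * f u) (at 0)" by simp
qed

text \<open>\<open>dir_deriv u\<close> commutes with the second derivatives that make up the
  Laplacian. This keeps the induction for \<open>funk_hecke_power\<close> inside the harmonic
  polynomials.\<close>

lemma laplacian_dir_deriv_eq_0:
  assumes f: "homogeneous_polynomial l f" "\<And>x. laplacian f x = 0"
  shows "laplacian (dir_deriv u f) x = 0"
proof -
  have h: "homogeneous_polynomial (l - 1 - 1) (dir_deriv b (dir_deriv b f))" for b
    by (intro homogeneous_polynomial_dir_deriv f)
  have "laplacian (dir_deriv u f) x = (\<Sum>b\<in>Basis. dir_deriv u (dir_deriv b (dir_deriv b f)) x)"
    by (simp add: laplacian_dir_deriv[OF line_smooth_dir_deriv[OF f(1)]] dir_deriv_commute[OF f(1), of _ u]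
       dir_deriv_commute[OF homogeneous_polynomial_dir_deriv[OF f(1)], of _ u])
  also have "\<dots> = dir_deriv u (\<lambda>x. \<Sum>b\<in>Basis. dir_deriv b (dir_deriv b f) x) x"
    by (subst dir_deriv_sum) (auto intro: line_smooth_homogeneous_polynomial h)
  also have "(\<lambda>x. \<Sum>b\<in>Basis. dir_deriv b (dir_deriv b f) x) = (\<lambda>_. 0)"
    using f(2) by (simp add: laplacian_dir_deriv[OF line_smooth_homogeneous_polynomial[OF f(1)]])
  finally show ?thesis by (simp add: dir_deriv_const)
qed

lemma homogeneous_polynomial_laplacian:
  assumes "homogeneous_polynomial l f" shows "homogeneous_polynomial (l - 1 - 1) (laplacian f)"
proof -
  have "laplacian f = (\<lambda>x. \<Sum>b\<in>Basis. dir_deriv b (dir_deriv b f) x)"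
    by (rule ext, rule laplacian_dir_deriv[OF line_smooth_homogeneous_polynomial[OF assms]])
  then show ?thesis by (simp only:) (intro homogeneous_polynomial_sum homogeneous_polynomial_dir_deriv assms)
qed

section \<open>Green's formula and the Funk-Hecke formula\<close>

lemma integrable_homogeneous_polynomial:
  "homogeneous_polynomial l f \<Longrightarrow> integrable sphere_measure f"
  by (rule integrable_sphere_measure) (rule continuous_on_homogeneous_polynomial)

lemma integral_monomial:
  "(\<integral>x. monomial i j k x \<partial>sphere_measure) = of_real (\<integral>x. (x $ 1) ^ i * (x $ 2) ^ j * (x $ 3) ^ k \<partial>sphere_measure)"
  unfolding monomial_def by (rule integral_complex_of_real)

lemma laplacian_monomial:
  "laplacian (monomial i j k) = (\<lambda>x. of_nat i * (of_nat (i - 1) * monomial (i - 1 - 1) j k x) +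
    (of_nat j * (of_nat (j - 1) * monomial i (j - 1 - 1) k x) +
     of_nat k * (of_nat (k - 1) * monomial i j (k - 1 - 1) x)))"
  by (rule ext, subst laplacian_dir_deriv[OF line_smooth_monomial])
    (simp add: sum_Basis_3 dir_deriv_monomial axis_def dir_deriv_scale line_smooth_monomial)

text \<open>On the sphere the radial part of the Laplacian multiplies degree d by d (d + 1), and the
  spherical part integrates to zero. On a monomial this is \<open>sphere_moment_rec\<close> in each
  coordinate: the contributions are i (d + 1), j (d + 1) and k (d + 1) times the moment.\<close>

lemma integral_laplacian:
  "homogeneous_polynomial d f \<Longrightarrow>
    (\<integral>x. laplacian f x \<partial>sphere_measure) = of_nat (d * (d + 1)) * (\<integral>x. f x \<partial>sphere_measure)"
proof (induction rule: homogeneous_polynomial_induct)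
  case zero
  then show ?case by (simp add: laplacian_dir_deriv[OF line_smooth_const] dir_deriv_const)
next
  case (monomial i j k)
  let ?M = "\<lambda>i j k. \<integral>x. (x $ 1) ^ i * (x $ 2) ^ j * (x $ (3::3)) ^ k \<partial>sphere_measure"
  have 1: "real i * (real (i - 1) * ?M (i - 1 - 1) j k) = real i * ((real d + 1) * ?M i j k)"
    using sphere_moment_rec[of 1 2 3 "i - 1" j k] monomial by (cases i) auto
  have 2: "real j * (real (j - 1) * ?M i (j - 1 - 1) k) = real j * ((real d + 1) * ?M i j k)"
    using sphere_moment_rec[of 2 1 3 "j - 1" i k] monomial by (cases j) (auto simp: mult_ac)
  have 3: "real k * (real (k - 1) * ?M i j (k - 1 - 1)) = real k * ((real d + 1) * ?M i j k)"
    using sphere_moment_rec[of 3 2 1 "k - 1" j i] monomial by (cases k) (auto simp: mult_ac)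
  have s: "real i * ((real d + 1) * ?M i j k) + (real j * ((real d + 1) * ?M i j k) + real k * ((real d + 1) * ?M i j k)) =
      real (d * (d + 1)) * ?M i j k" using monomial by (auto simp: algebra_simps)
  have h: "integrable sphere_measure (\<lambda>x. c * monomial a b e x)" for a b e c
    by (rule integrable_homogeneous_polynomial[OF homogeneous_polynomial_scale[OF homogeneous_polynomial_monomial[OF refl]]])
  have "(\<integral>x. laplacian (monomial i j k) x \<partial>sphere_measure) = 
     of_real (real i * (real (i - 1) * ?M (i - 1 - 1) j k) + (real j * (real (j - 1) * ?M i (j - 1 - 1) k) +
       real k * (real (k - 1) * ?M i j (k - 1 - 1))))"
    unfolding laplacian_monomial
    by (simp add: h mult.assoc[symmetric] integral_monomial del: of_nat_mult)
  then show ?case unfolding 1 2 3 s integral_monomial by simp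
next
  case (add f g)
  have "laplacian (\<lambda>x. f x + g x) = (\<lambda>x. laplacian f x + laplacian g x)"
    using add line_smooth_homogeneous_polynomial line_smooth_dir_deriv
    by (simp add: fun_eq_iff laplacian_dir_deriv line_smooth_add dir_deriv_add sum.distrib)
  moreover have "integrable sphere_measure (laplacian f)" "integrable sphere_measure (laplacian g)"
    using add integrable_homogeneous_polynomial homogeneous_polynomial_laplacian by blast+
  ultimately show ?case using add integrable_homogeneous_polynomial by (simp add: distrib_left)
next
  case (scale c f)
  have "laplacian (\<lambda>x. c * f x) = (\<lambda>x. c * laplacian f x)"
    using scale line_smooth_homogeneous_polynomial line_smooth_dir_deriv
    by (simp add: fun_eq_iff laplacian_dir_deriv line_smooth_mult line_smooth_const dir_deriv_scale sum_distrib_left)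
  then show ?case using scale by (simp add: integrable_homogeneous_polynomial homogeneous_polynomial_laplacian)
qed

lemma dir_deriv_inner_power:
  "dir_deriv v (\<lambda>x. of_real ((u \<bullet> x) ^ k)) = (\<lambda>x. of_real (real k * (u \<bullet> v)) * of_real ((u \<bullet> x) ^ (k - 1)))"
proof (rule ext, rule dir_deriv_eqI)
  fix x
  have "((\<lambda>t. (u \<bullet> (x + t *\<^sub>R v)) ^ k) has_real_derivative real k * (u \<bullet> v) * (u \<bullet> x) ^ (k - 1)) (at 0)"
    by (auto intro!: derivative_eq_intros simp: inner_add_right algebra_simps)
  then show "((\<lambda>t. of_real ((u \<bullet> (x + t *\<^sub>R v)) ^ k)) has_vector_derivative
      complex_of_real (real k * (u \<bullet> v)) * of_real ((u \<bullet> x) ^ (k - 1))) (at 0)"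
    unfolding of_real_mult[symmetric]
    by (intro has_vector_derivative_of_real) (simp add: has_real_derivative_iff_has_vector_derivative)
qed

text \<open>Product rule for the Laplacian: the term with the Laplacian of f drops out, the mixed
  terms assemble to \<open>dir_deriv u f\<close>, and the squares (u . b)^2 sum to 1.\<close>

lemma laplacian_inner_power_mult:
  assumes f: "homogeneous_polynomial l f" "\<And>x. laplacian f x = 0" and u: "u \<in> S2"
  shows "laplacian (\<lambda>x. of_real ((u \<bullet> x) ^ k) * f x) x =
    of_nat (k * (k - 1)) * (of_real ((u \<bullet> x) ^ (k - 2)) * f x) +
    of_nat (2 * k) * (of_real ((u \<bullet> x) ^ (k - 1)) * dir_deriv u f x)"
proof -
  define g where "g k x = complex_of_real ((u \<bullet> x) ^ k)" for k x
  have g: "homogeneous_polynomial k (g k)" for k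
    unfolding g_def by (rule homogeneous_polynomial_inner_power)
  have dg: "dir_deriv b (g k) = (\<lambda>x. of_real (real k * (u \<bullet> b)) * g (k - 1) x)" for b k
    unfolding g_def by (rule dir_deriv_inner_power)
  have sg: "line_smooth (g k)" for k by (rule line_smooth_homogeneous_polynomial[OF g])
  have sf: "line_smooth f" by (rule line_smooth_homogeneous_polynomial[OF f(1)])
  have sdf: "line_smooth (dir_deriv b f)" for b by (rule line_smooth_dir_deriv[OF f(1)])
  have d1: "dir_deriv b (\<lambda>x. g k x * f x) = (\<lambda>x. g k x * dir_deriv b f x + of_real (real k * (u \<bullet> b)) * (g (k - 1) x * f x))" for b
    by (simp add: dir_deriv_mult sg sf dg mult.assoc)
  have d2: "dir_deriv b (dir_deriv b (\<lambda>x. g k x * f x)) x = g k x * dir_deriv b (dir_deriv b f) x +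
      2 * of_nat k * g (k - 1) x * (of_real (u \<bullet> b) * dir_deriv b f x) +
      of_nat (k * (k - 1)) * (g (k - 2) x * f x) * of_real ((u \<bullet> b)\<^sup>2)" for b
  proof -
    have "dir_deriv b (dir_deriv b (\<lambda>x. g k x * f x)) x =
       (g k x * dir_deriv b (dir_deriv b f) x + of_real (real k * (u \<bullet> b)) * g (k - 1) x * dir_deriv b f x) +
       of_real (real k * (u \<bullet> b)) * (g (k - 1) x * dir_deriv b f x + of_real (real (k - 1) * (u \<bullet> b)) * g (k - 1 - 1) x * f x)"
      unfolding d1
      by (simp only: dir_deriv_add dir_deriv_scale dir_deriv_mult line_smooth_mult line_smooth_const sg sf sdf dg)
    also have "k - 1 - 1 = k - 2" by simp
    finally show ?thesis unfolding of_nat_mult by (simp add: algebra_simps power2_eq_square)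
  qed
  have "(\<Sum>b\<in>Basis. (u \<bullet> b)\<^sup>2) = 1"
    using u euclidean_inner[of u u] by (simp add: norm_eq_1 power2_eq_square)
  then have s1: "(\<Sum>b\<in>Basis. complex_of_real ((u \<bullet> b)\<^sup>2)) = 1" by (metis of_real_1 of_real_sum)
  have s2: "(\<Sum>b\<in>Basis. dir_deriv b (dir_deriv b f) x) = 0"
    using f(2) laplacian_dir_deriv[OF sf] by simp
  have "laplacian (\<lambda>x. g k x * f x) x = (\<Sum>b\<in>Basis. g k x * dir_deriv b (dir_deriv b f) x +
      2 * of_nat k * g (k - 1) x * (of_real (u \<bullet> b) * dir_deriv b f x) +
      of_nat (k * (k - 1)) * (g (k - 2) x * f x) * of_real ((u \<bullet> b)\<^sup>2))"
    by (simp only: laplacian_dir_deriv line_smooth_mult sg sf d2)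
  also have "\<dots> = 2 * of_nat k * g (k - 1) x * dir_deriv u f x + of_nat (k * (k - 1)) * (g (k - 2) x * f x)"
    by (simp only: sum.distrib sum_distrib_left[symmetric] s1 s2 dir_deriv_Basis[OF f(1)]) simp
  finally show ?thesis unfolding g_def by simp
qed

text \<open>Green's formula applied to \<open>(u \<bullet> x) ^ k * f x\<close> lowers \<open>k\<close>, and the new
  factor \<open>dir_deriv u f\<close> is again harmonic, with the value \<open>m * f u\<close> at \<open>u\<close>.\<close>

lemma funk_hecke_power:
  assumes "homogeneous_polynomial m f" "\<And>x. laplacian f x = 0" "u \<in> S2"
  shows "(\<integral>x. of_real ((u \<bullet> x) ^ k) * f x \<partial>sphere_measure) = of_real (legendre_moment m k) * f u"
  using assms(1,2)
proof (induction k arbitrary: m f rule: less_induct)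
  case (less k)
  let ?J = "\<lambda>k f. \<integral>x. of_real ((u \<bullet> x) ^ k) * f x \<partial>sphere_measure"
  have ig: "integrable sphere_measure (\<lambda>x. of_real ((u \<bullet> x) ^ k) * f x)" if "homogeneous_polynomial l f" for k l f
    by (rule integrable_homogeneous_polynomial[OF homogeneous_polynomial_mult[OF homogeneous_polynomial_inner_power that]])
  have df: "homogeneous_polynomial (m - 1) (dir_deriv u f)" "\<And>x. laplacian (dir_deriv u f) x = 0"
    using homogeneous_polynomial_dir_deriv[OF less.prems(1)] laplacian_dir_deriv_eq_0[OF less.prems] by auto
  have rec: "of_nat ((k + m) * (k + m + 1)) * ?J k f = of_nat (k * (k - 1)) * ?J (k - 2) f + of_nat (2 * k) * ?J (k - 1) (dir_deriv u f)"
    unfolding integral_laplacian[OF homogeneous_polynomial_mult[OF homogeneous_polynomial_inner_power less.prems(1)], symmetric]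
      laplacian_inner_power_mult[OF less.prems assms(3)]
    using ig[OF less.prems(1)] ig[OF df(1)] by simp
  show ?case
  proof (cases "k = 0")
    case True
    show ?thesis
    proof (cases "m = 0")
      case m: True
      have "f x = f 0" for x
        using homogeneous_polynomial_scaleR[OF less.prems(1), of 0 x] m by simp
      then have "(\<integral>x. f x \<partial>sphere_measure) = (\<integral>x. f u \<partial>sphere_measure)"
        by (intro integral_sphere_cong) metis
      then show ?thesis using True m unfolding integral_sphere_const by (simp add: legendre_moment_0)
    next
      case False
      then show ?thesis using rec True legendre_moment_less[of 0 m] by (simp del: of_nat_mult of_nat_add)
    qed
  next
    case k: False
    have i1: "?J (k - 1) (dir_deriv u f) = of_real (legendre_moment (m - 1) (k - 1)) * (of_nat m * f u)"
      using less.IH[OF _ df, of "k - 1"] k by (simp add: dir_deriv_self[OF less.prems(1)])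
    have i2: "of_nat (k * (k - 1)) * ?J (k - 2) f = of_nat (k * (k - 1)) * (of_real (legendre_moment m (k - 2)) * f u)"
      using less.IH[OF _ less.prems, of "k - 2"] k by (cases "k = 1") auto
    have e1: "real k * (real k - 1) * legendre_moment m (k - 2) = (real k * (k + 1) - real m * (m + 1)) * legendre_moment m k"
      by (rule legendre_moment_ode[symmetric])
    have e2: "real m * (real k * legendre_moment (m - 1) (k - 1)) = real m * ((real k + m + 1) * legendre_moment m k)"
      using legendre_moment_rec[of k "m - 1"] by (cases m) (auto simp: algebra_simps)
    have "of_nat ((k + m) * (k + m + 1)) * ?J k f = of_real (real k * (real k - 1) * legendre_moment m (k - 2) +
       2 * (real m * (real k * legendre_moment (m - 1) (k - 1)))) * f u"
      unfolding rec i1 i2 using k by (simp add: algebra_simps of_nat_diff)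
    also have "real k * (real k - 1) * legendre_moment m (k - 2) + 2 * (real m * (real k * legendre_moment (m - 1) (k - 1))) =
        real ((k + m) * (k + m + 1)) * legendre_moment m k"
      unfolding e1 e2 by (simp add: algebra_simps)
    finally have eq: "of_nat ((k + m) * (k + m + 1)) * ?J k f = of_nat ((k + m) * (k + m + 1)) * (of_real (legendre_moment m k) * f u)"
      by (simp only: of_real_mult of_real_of_nat_eq mult.assoc)
    have nz: "complex_of_nat ((k + m) * (k + m + 1)) \<noteq> 0"
      unfolding of_nat_eq_0_iff using k by simp
    show ?thesis by (rule mult_left_cancel[THEN iffD1, OF nz eq])
  qed
qed

text \<open>Both sides are continuous in g for the sup norm and agree on polynomials by
  \<open>funk_hecke_power\<close>; \<open>T\<close> is their difference, and Weierstrass' theorem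
  forces it to vanish.\<close>

lemma funk_hecke:
  fixes g :: "real \<Rightarrow> real"
  assumes f: "homogeneous_polynomial m f" "\<And>x. laplacian f x = 0" and u: "u \<in> S2"
    and g: "continuous_on {-1..1} g"
  shows "(\<integral>x. of_real (g (u \<bullet> x)) * f x \<partial>sphere_measure) =
     of_real (1 / 2 * integral {-1..1} (\<lambda>t. g t * poly (legendre m) t)) * f u"
proof -
  define T where "T h = (\<integral>x. of_real (h (u \<bullet> x)) * f x \<partial>sphere_measure) -
     of_real (1 / 2 * integral {-1..1} (\<lambda>t. h t * poly (legendre m) t)) * f u" for h :: "real \<Rightarrow> real"
  have ux: "u \<bullet> x \<in> {-1..1}" if "x \<in> S2" for x
    using Cauchy_Schwarz_ineq2[of u x] u that by (auto simp: abs_le_iff)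
  have fc: "continuous_on S2 f" by (rule continuous_on_homogeneous_polynomial[OF f(1)])
  have hc: "continuous_on S2 (\<lambda>x. of_real (h (u \<bullet> x)) * f x)" if "continuous_on {-1..1} h" for h :: "real \<Rightarrow> real"
    by (intro continuous_intros fc continuous_on_compose2[OF that]) (use ux in auto)
  have Lc: "continuous_on {-1..1} (\<lambda>t. h t * poly (legendre m) t)" if "continuous_on {-1..1} h" for h :: "real \<Rightarrow> real"
    by (intro continuous_intros that)
  obtain B where B: "\<And>x. x \<in> S2 \<Longrightarrow> norm (f x) \<le> B" using bounded_continuous_sphere[OF fc] by blast
  have "bounded (poly (legendre m) ` {-1..1})"
    by (rule compact_imp_bounded, rule compact_continuous_image) (auto intro: continuous_intros)
  then obtain C where "\<forall>y\<in>poly (legendre m) ` {-1..1}. norm y \<le> C"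
    unfolding bounded_iff by (rule exE)
  then have C: "\<And>t. t \<in> {-1..1} \<Longrightarrow> \<bar>poly (legendre m) t\<bar> \<le> C" by auto
  have B0: "B \<ge> 0" using B[OF u] norm_ge_zero order_trans by blast
  have C0: "C \<ge> 0" using C[of 0] by (simp add: order_trans[OF abs_ge_zero])
  have "T g = 0"
  proof (rule ccontr)
    assume "T g \<noteq> 0"
    \<comment> \<open>An approximation within e changes the integral over the sphere by at most e B
      and the other side by at most e C B. With this e the total is at most half of norm (T g); the
      summand 1 keeps the denominator positive.\<close>
    define e where "e = norm (T g) / (2 * (B + C * B + 1))"
    have e: "e > 0" using \<open>T g \<noteq> 0\<close> B0 C0 by (simp add: e_def add_nonneg_pos)
    obtain p where p: "real_polynomial_function p" "\<And>t. t \<in> {-1..1} \<Longrightarrow> \<bar>g t - p t\<bar> < e"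
      using Stone_Weierstrass_real_polynomial_function[of "{-1..1}" g e] g e by auto
    obtain a n where pn: "p = (\<lambda>t. \<Sum>i\<le>n. a i * t ^ i)" using p(1) unfolding real_polynomial_function_iff_sum by blast
    have pc: "continuous_on {-1..1} p" unfolding pn by (intro continuous_intros)
    have Tp: "T p = 0"
    proof -
      have "(\<integral>x. of_real (p (u \<bullet> x)) * f x \<partial>sphere_measure) = (\<integral>x. (\<Sum>i\<le>n. of_real (a i) * (of_real ((u \<bullet> x) ^ i) * f x)) \<partial>sphere_measure)"
        unfolding pn by (simp add: sum_distrib_right mult.assoc)
      also have "\<dots> = (\<Sum>i\<le>n. of_real (a i) * (\<integral>x. of_real ((u \<bullet> x) ^ i) * f x \<partial>sphere_measure))"
        by (subst Bochner_Integration.integral_sum)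
          (auto intro!: integrable_homogeneous_polynomial[OF homogeneous_polynomial_scale[OF homogeneous_polynomial_mult[OF homogeneous_polynomial_inner_power f(1)]]] simp del: of_real_power)
      also have "\<dots> = (\<Sum>i\<le>n. of_real (a i * legendre_moment m i)) * f u"
        unfolding funk_hecke_power[OF f u] by (simp add: sum_distrib_right mult.assoc)
      also have "(\<Sum>i\<le>n. complex_of_real (a i * legendre_moment m i)) = of_real (1 / 2 * integral {-1..1} (\<lambda>t. p t * poly (legendre m) t))"
      proof -
        have "integral {-1..1} (\<lambda>t. p t * poly (legendre m) t) = integral {-1..1} (\<lambda>t. \<Sum>i\<le>n. a i * (t ^ i * poly (legendre m) t))"
          unfolding pn by (simp add: sum_distrib_right mult.assoc)
        also have "\<dots> = (\<Sum>i\<le>n. integral {-1..1} (\<lambda>t. a i * (t ^ i * poly (legendre m) t)))"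
          by (rule integral_sum) (auto intro!: integrable_continuous_real continuous_intros)
        finally show ?thesis by (simp add: legendre_moment_def sum_divide_distrib)
      qed
      finally show ?thesis by (simp add: T_def)
    qed
    have "norm (\<integral>x. of_real (g (u \<bullet> x)) * f x - of_real (p (u \<bullet> x)) * f x \<partial>sphere_measure) \<le> (\<integral>x. e * B \<partial>sphere_measure)"
    proof (rule order_trans[OF integral_norm_bound], rule Bochner_Integration.integral_mono)
      fix x assume "x \<in> space sphere_measure"
      then have x: "x \<in> S2" by simp
      have "norm (of_real (g (u \<bullet> x)) * f x - of_real (p (u \<bullet> x)) * f x) = \<bar>g (u \<bullet> x) - p (u \<bullet> x)\<bar> * norm (f x)"
        by (metis left_diff_distrib norm_mult norm_of_real of_real_diff real_norm_def)
      also have "\<dots> \<le> e * B"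
        using p(2)[OF ux[OF x]] B[OF x] e by (intro mult_mono) auto
      finally show "norm (of_real (g (u \<bullet> x)) * f x - of_real (p (u \<bullet> x)) * f x) \<le> e * B" .
    qed (use integrable_sphere_measure[OF hc[OF g]] integrable_sphere_measure[OF hc[OF pc]]
          finite_measure.integrable_const[OF finite_sphere_measure] in auto)
    then have b1: "norm ((\<integral>x. of_real (g (u \<bullet> x)) * f x \<partial>sphere_measure) - (\<integral>x. of_real (p (u \<bullet> x)) * f x \<partial>sphere_measure)) \<le> e * B"
      using integrable_sphere_measure[OF hc[OF g]] integrable_sphere_measure[OF hc[OF pc]] by simp
    have "norm (integral {-1..1} (\<lambda>t. g t * poly (legendre m) t - p t * poly (legendre m) t)) \<le> integral {-1..1} (\<lambda>t::real. e * C)"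
    proof (rule integral_norm_bound_integral)
      fix t :: real assume t: "t \<in> {-1..1}"
      have "norm (g t * poly (legendre m) t - p t * poly (legendre m) t) = \<bar>g t - p t\<bar> * \<bar>poly (legendre m) t\<bar>"
        by (metis abs_mult left_diff_distrib real_norm_def)
      also have "\<dots> \<le> e * C"
        using p(2)[OF t] C[OF t] e by (intro mult_mono) auto
      finally show "norm (g t * poly (legendre m) t - p t * poly (legendre m) t) \<le> e * C" .
    qed (auto intro!: integrable_continuous_real continuous_on_diff Lc g pc)
    then have b2: "\<bar>integral {-1..1} (\<lambda>t. g t * poly (legendre m) t) - integral {-1..1} (\<lambda>t. p t * poly (legendre m) t)\<bar> \<le> 2 * (e * C)"
      using integrable_continuous_real[OF Lc[OF g]] integrable_continuous_real[OF Lc[OF pc]]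
      by (simp add: Henstock_Kurzweil_Integration.integral_diff)
    have "T g = T g - T p" using Tp by simp
    also have "\<dots> = ((\<integral>x. of_real (g (u \<bullet> x)) * f x \<partial>sphere_measure) - (\<integral>x. of_real (p (u \<bullet> x)) * f x \<partial>sphere_measure)) -
      of_real (1 / 2 * (integral {-1..1} (\<lambda>t. g t * poly (legendre m) t) - integral {-1..1} (\<lambda>t. p t * poly (legendre m) t))) * f u"
      by (simp add: T_def algebra_simps diff_divide_distrib)
    also have "norm \<dots> \<le> e * B + e * C * B"
    proof (rule order_trans[OF norm_triangle_ineq4 add_mono[OF b1]])
      have "norm (complex_of_real (1 / 2 * (integral {-1..1} (\<lambda>t. g t * poly (legendre m) t) - integral {-1..1} (\<lambda>t. p t * poly (legendre m) t)))) \<le> e * C"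
        unfolding norm_of_real using b2 by simp
      then show "norm (of_real (1 / 2 * (integral {-1..1} (\<lambda>t. g t * poly (legendre m) t) - integral {-1..1} (\<lambda>t. p t * poly (legendre m) t))) * f u) \<le> e * C * B"
        unfolding norm_mult using B[OF u] e C0 by (intro mult_mono) auto
    qed
    also have "\<dots> \<le> e * (B + C * B + 1)" using e by (simp add: algebra_simps)
    also have "\<dots> = norm (T g) / 2" using B0 C0 by (simp add: e_def field_simps add_nonneg_eq_0_iff)
    finally show False using \<open>T g \<noteq> 0\<close> by simp
  qed
  then show ?thesis by (simp add: T_def)
qed

section \<open>Completeness of the spherical harmonics\<close>

lemma sum_fun_apply: "(\<Sum>a\<in>A. f a) x = (\<Sum>a\<in>A. (f a x :: complex))"
  by (induction A rule: infinite_finite_induct) simp_all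

text \<open>Completing the square. With d = c it yields Bessel's inequality, with general d the best
  approximation property, and with F = 0 the norm of a finite combination.\<close>

lemma integral_norm_diff_orthonormal:
  fixes \<phi> :: "'i \<Rightarrow> 'a \<Rightarrow> complex" and F :: "'a \<Rightarrow> complex"
  assumes fin: "finite B"
    and iF: "integrable M (\<lambda>x. F x * cnj (F x))"
    and iF\<phi>: "\<And>i. i \<in> B \<Longrightarrow> integrable M (\<lambda>x. F x * cnj (\<phi> i x))"
    and i\<phi>: "\<And>i j. i \<in> B \<Longrightarrow> j \<in> B \<Longrightarrow> integrable M (\<lambda>x. \<phi> i x * cnj (\<phi> j x))"
    and orth: "\<And>i j. i \<in> B \<Longrightarrow> j \<in> B \<Longrightarrow> (\<integral>x. \<phi> i x * cnj (\<phi> j x) \<partial>M) = (if i = j then 1 else 0)"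
  defines "c \<equiv> \<lambda>i. \<integral>x. F x * cnj (\<phi> i x) \<partial>M"
  shows "(\<integral>x. (cmod (F x - (\<Sum>i\<in>B. d i * \<phi> i x)))\<^sup>2 \<partial>M) =
    (\<integral>x. (cmod (F x))\<^sup>2 \<partial>M) - (\<Sum>i\<in>B. (cmod (c i))\<^sup>2) + (\<Sum>i\<in>B. (cmod (d i - c i))\<^sup>2)"
proof -
  have iF\<phi>': "integrable M (\<lambda>x. \<phi> i x * cnj (F x))" if "i \<in> B" for i
  proof -
    have "integrable M (\<lambda>x. cnj (F x * cnj (\<phi> i x)))" using iF\<phi>[OF that] by (simp only: integrable_cnj)
    then show ?thesis by (simp add: mult.commute)
  qed
  have cF: "(\<integral>x. F x * cnj (\<phi> i x) \<partial>M) = c i" for i by (simp add: c_def)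
  have c': "(\<integral>x. \<phi> i x * cnj (F x) \<partial>M) = cnj (c i)" for i
  proof -
    have "(\<integral>x. \<phi> i x * cnj (F x) \<partial>M) = (\<integral>x. cnj (F x * cnj (\<phi> i x)) \<partial>M)"
      by (simp add: mult.commute)
    then show ?thesis by (simp only: Bochner_Integration.integral_cnj c_def)
  qed
  have "complex_of_real (\<integral>x. (cmod (F x - (\<Sum>i\<in>B. d i * \<phi> i x)))\<^sup>2 \<partial>M) =
     (\<integral>x. F x * cnj (F x) - (\<Sum>i\<in>B. cnj (d i) * (F x * cnj (\<phi> i x))) - (\<Sum>i\<in>B. d i * (\<phi> i x * cnj (F x))) +
       (\<Sum>i\<in>B. \<Sum>j\<in>B. d i * cnj (d j) * (\<phi> i x * cnj (\<phi> j x))) \<partial>M)"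
    unfolding integral_complex_of_real[symmetric] complex_norm_square
  proof (intro Bochner_Integration.integral_cong refl)
    fix x
    let ?G = "\<Sum>i\<in>B. d i * \<phi> i x"
    have "?G * cnj ?G = (\<Sum>i\<in>B. \<Sum>j\<in>B. d i * cnj (d j) * (\<phi> i x * cnj (\<phi> j x)))"
      unfolding cnj_sum sum_product by (simp add: mult_ac)
    moreover have "F x * cnj ?G = (\<Sum>i\<in>B. cnj (d i) * (F x * cnj (\<phi> i x)))"
      unfolding cnj_sum sum_distrib_left by (simp add: mult_ac)
    moreover have "?G * cnj (F x) = (\<Sum>i\<in>B. d i * (\<phi> i x * cnj (F x)))"
      unfolding sum_distrib_right by (simp add: mult_ac)
    moreover have "(F x - ?G) * cnj (F x - ?G) = F x * cnj (F x) - F x * cnj ?G - ?G * cnj (F x) + ?G * cnj ?G"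
      unfolding complex_cnj_diff by (simp only: algebra_simps)
    ultimately show "(F x - ?G) * cnj (F x - ?G) = F x * cnj (F x) - (\<Sum>i\<in>B. cnj (d i) * (F x * cnj (\<phi> i x))) -
      (\<Sum>i\<in>B. d i * (\<phi> i x * cnj (F x))) + (\<Sum>i\<in>B. \<Sum>j\<in>B. d i * cnj (d j) * (\<phi> i x * cnj (\<phi> j x)))"
      by (simp only:)
  qed
  also have "\<dots> = (\<integral>x. F x * cnj (F x) \<partial>M) - (\<Sum>i\<in>B. cnj (d i) * c i) - (\<Sum>i\<in>B. d i * cnj (c i)) +
       (\<Sum>i\<in>B. \<Sum>j\<in>B. d i * cnj (d j) * (if i = j then 1 else 0))"
    using iF iF\<phi> iF\<phi>' i\<phi> orth by (simp add: cF c' cong: sum.cong)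
  also have "(\<Sum>i\<in>B. \<Sum>j\<in>B. d i * cnj (d j) * (if i = j then 1 else 0)) = (\<Sum>i\<in>B. d i * cnj (d i))"
    using fin by (intro sum.cong) (simp_all add: if_distrib[of "\<lambda>t. _ * t"] sum.delta cong: if_cong)
  also have "(\<integral>x. F x * cnj (F x) \<partial>M) - (\<Sum>i\<in>B. cnj (d i) * c i) - (\<Sum>i\<in>B. d i * cnj (c i)) + (\<Sum>i\<in>B. d i * cnj (d i)) =
     (\<integral>x. F x * cnj (F x) \<partial>M) - (\<Sum>i\<in>B. c i * cnj (c i)) + (\<Sum>i\<in>B. (d i - c i) * cnj (d i - c i))"
    by (simp add: algebra_simps sum.distrib sum_subtractf)
  also have "\<dots> = complex_of_real ((\<integral>x. (cmod (F x))\<^sup>2 \<partial>M) - (\<Sum>i\<in>B. (cmod (c i))\<^sup>2) + (\<Sum>i\<in>B. (cmod (d i - c i))\<^sup>2))"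
    by (simp only: of_real_diff of_real_add of_real_sum complex_norm_square integral_complex_of_real[symmetric])
  finally show ?thesis by (simp only: of_real_eq_iff)
qed

lemma homogeneous_polynomial_inner_self_power: "homogeneous_polynomial (2 * k) (\<lambda>x. of_real ((x \<bullet> x) ^ k))"
proof (induction k)
  case 0 then show ?case using homogeneous_polynomial_const[of 1] by simp
next
  case (Suc k)
  have "homogeneous_polynomial 2 (\<lambda>x. monomial 2 0 0 x + (monomial 0 2 0 x + monomial 0 0 2 x))"
    by (intro homogeneous_polynomial_add homogeneous_polynomial_monomial) auto
  moreover have "monomial 2 0 0 x + (monomial 0 2 0 x + monomial 0 0 2 x) = of_real (x \<bullet> x)" for x
    by (simp add: monomial_def inner_vec_def sum_3 power2_eq_square)
  ultimately have "homogeneous_polynomial 2 (\<lambda>x. of_real (x \<bullet> x))" by simp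
  from homogeneous_polynomial_mult[OF this Suc] show ?case by simp
qed

lemma card_exponents: "2 * card {(i, j, k). i + j + k = (d::nat)} = (d + 1) * (d + 2)"
proof -
  have "{(i, j, k). i + j + k = d} = (\<lambda>(i, j). (i, j, d - i - j)) ` (SIGMA i:{..d}. {..d - i})"
    by (force simp: image_iff)
  moreover have "inj_on (\<lambda>(i, j). (i, j, d - i - j)) (SIGMA i:{..d}. {..d - i})" by (auto simp: inj_on_def)
  ultimately have "card {(i, j, k). i + j + k = d} = (\<Sum>i\<le>d. Suc (d - i))"
    by (simp add: card_image)
  also have "\<dots> = (\<Sum>i\<le>d. Suc i)"
    by (rule sum.reindex_bij_witness[of _ "\<lambda>i. d - i" "\<lambda>i. d - i"]) auto
  also have "2 * \<dots> = (d + 1) * (d + 2)" by (induction d) auto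
  finally show ?thesis .
qed

text \<open>Multiplication by |x|^(d - l), a polynomial when d - l is even, raises degree l to d
  without changing values on the sphere. These are the degrees that make up a homogeneous polynomial
  of degree d.\<close>

definition harmonic_index :: "nat \<Rightarrow> (nat \<times> int) set" where
  "harmonic_index d = (SIGMA l:{l. l \<le> d \<and> even (d - l)}. {- int l..int l})"

lemma finite_harmonic_index: "finite (harmonic_index d)"
  unfolding harmonic_index_def by auto

lemma card_harmonic_index: "2 * card (harmonic_index d) = (d + 1) * (d + 2)"
proof -
  have c: "card (harmonic_index d) = (\<Sum>l | l \<le> d \<and> even (d - l). 2 * l + 1)"
    unfolding harmonic_index_def by (subst card_SigmaI) (auto intro!: sum.cong)
  have "2 * (\<Sum>l | l \<le> d \<and> even (d - l). 2 * l + 1) = (d + 1) * (d + 2)"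
  proof (induction d rule: induct_nat_012)
    case 0
    have "{l. l \<le> (0::nat) \<and> even (0 - l)} = {0}" by auto
    then show ?case by (simp only:) simp
  next
    case 1
    have "{l. l \<le> Suc 0 \<and> even (Suc 0 - l)} = {1}" by (auto simp: le_Suc_eq)
    then show ?case by (simp only:) simp
  next
    case (ge2 n)
    have "{l. l \<le> Suc (Suc n) \<and> even (Suc (Suc n) - l)} = insert (Suc (Suc n)) {l. l \<le> n \<and> even (n - l)}"
    proof (intro set_eqI iffI)
      fix l assume l: "l \<in> {l. l \<le> Suc (Suc n) \<and> even (Suc (Suc n) - l)}"
      then consider "l = Suc (Suc n)" | "l = Suc n" | "l \<le> n" by force
      then show "l \<in> insert (Suc (Suc n)) {l. l \<le> n \<and> even (n - l)}"
        using l by cases (auto simp: Suc_diff_le)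
    qed (auto simp: Suc_diff_le)
    then show ?case using ge2(1) by (simp add: algebra_simps)
  qed
  then show ?thesis using c by simp
qed

lemma spherical_harmonicE:
  assumes "spherical_harmonic l f"
  obtains p where "homogeneous_polynomial l p" "\<And>x. laplacian p x = 0" "\<And>x. x \<in> S2 \<Longrightarrow> f x = p x"
  using assms unfolding spherical_harmonic_def by blast

lemma continuous_on_spherical_harmonic:
  assumes "spherical_harmonic l f" shows "continuous_on S2 f"
proof -
  obtain p where "homogeneous_polynomial l p" "\<And>x. x \<in> S2 \<Longrightarrow> f x = p x" using assms spherical_harmonicE by metis
  then show ?thesis using continuous_on_homogeneous_polynomial by (metis continuous_on_cong)
qed

context
  fixes Y :: "nat \<Rightarrow> int \<Rightarrow> real^3 \<Rightarrow> complex"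
  assumes Y: "orthonormal_harmonics Y"
begin

lemma spherical_harmonic_Y: "m \<in> {-int l..int l} \<Longrightarrow> spherical_harmonic l (Y l m)"
  using Y unfolding orthonormal_harmonics_def by blast

lemma continuous_on_Y: "m \<in> {-int l..int l} \<Longrightarrow> continuous_on S2 (Y l m)"
  by (rule continuous_on_spherical_harmonic[OF spherical_harmonic_Y])

lemma orthonormal_Y:
  "m \<in> {-int l..int l} \<Longrightarrow> m' \<in> {-int l'..int l'} \<Longrightarrow>
    (\<integral>n. Y l m n * cnj (Y l' m' n) \<partial>sphere_measure) = (if l = l' \<and> m = m' then 1 else 0)"
  using Y unfolding orthonormal_harmonics_def by blast

text \<open>Both sides of the expansion have \<open>(d + 1) (d + 2) / 2\<close> generators, and the harmonics are
  linearly independent.\<close>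

lemma homogeneous_polynomial_harmonic_expansion:
  assumes f: "homogeneous_polynomial d f"
  shows "\<exists>c. \<forall>x\<in>S2. f x = (\<Sum>(l, m)\<in>harmonic_index d. c (l, m) * Y l m x)"
proof -
  interpret vs: vector_space "\<lambda>(c::complex) (f :: real^3 \<Rightarrow> complex) x. c * f x"
    by unfold_locales (auto simp: fun_eq_iff algebra_simps)
  \<comment> \<open>Only values on the sphere count. Cutting off to zero elsewhere turns agreement
    on the sphere into equality, so that span and independence can be taken in the space of all
    functions.\<close>
  define R :: "(real^3 \<Rightarrow> complex) \<Rightarrow> real^3 \<Rightarrow> complex" where "R f x = (if x \<in> S2 then f x else 0)" for f x
  define \<phi> where "\<phi> p = R (Y (fst p) (snd p))" for p :: "nat \<times> int"
  let ?E = "{(i, j, k). i + j + k = d}"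
  define \<psi> where "\<psi> e = R (case e of (i, j, k) \<Rightarrow> monomial i j k)" for e :: "nat \<times> nat \<times> nat"
  have mem: "snd p \<in> {-int (fst p)..int (fst p)}" if "p \<in> harmonic_index d" for p
    using that by (auto simp: harmonic_index_def)
  have orth: "(\<integral>x. \<phi> p x * cnj (\<phi> q x) \<partial>sphere_measure) = (if p = q then 1 else 0)"
    if "p \<in> harmonic_index d" "q \<in> harmonic_index d" for p q
  proof -
    have "(\<integral>x. \<phi> p x * cnj (\<phi> q x) \<partial>sphere_measure) =
        (\<integral>n. Y (fst p) (snd p) n * cnj (Y (fst q) (snd q) n) \<partial>sphere_measure)"
      by (rule integral_sphere_cong) (simp add: \<phi>_def R_def)
    then show ?thesis using orthonormal_Y[OF mem[OF that(1)] mem[OF that(2)]] by (auto simp: prod_eq_iff)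
  qed
  have inj: "inj_on \<phi> (harmonic_index d)"
  proof (rule inj_onI)
    fix p q assume pq: "p \<in> harmonic_index d" "q \<in> harmonic_index d" "\<phi> p = \<phi> q"
    then show "p = q" using orth[of p q] orth[of q q] by (auto split: if_splits)
  qed
  have hp_span: "R g \<in> vs.span (\<psi> ` ?E)" if g: "homogeneous_polynomial d g" for g
  proof -
    obtain c where "g = (\<lambda>x. \<Sum>e\<in>?E. c e * (case e of (i, j, k) \<Rightarrow> monomial i j k x))"
      using g unfolding homogeneous_polynomial_iff by blast
    then have "R g = (\<Sum>e\<in>?E. (\<lambda>x. c e * \<psi> e x))"
      by (auto simp: fun_eq_iff R_def \<psi>_def sum_fun_apply case_prod_unfold)
    also have "\<dots> \<in> vs.span (\<psi> ` ?E)"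
      by (intro vs.span_sum vs.span_scale vs.span_base imageI)
    finally show ?thesis .
  qed
  have i\<phi>: "integrable sphere_measure (\<lambda>x. \<phi> p x * cnj (\<phi> q x))" if "p \<in> harmonic_index d" "q \<in> harmonic_index d" for p q
  proof (rule integrable_sphere_measure)
    have "continuous_on S2 (\<lambda>x. Y (fst p) (snd p) x * cnj (Y (fst q) (snd q) x))"
      by (intro continuous_intros continuous_on_Y mem that)
    then show "continuous_on S2 (\<lambda>x. \<phi> p x * cnj (\<phi> q x))"
      by (rule continuous_on_eq) (simp add: \<phi>_def R_def)
  qed
  have ind: "vs.independent (\<phi> ` harmonic_index d)"
  proof (rule vs.independent_if_scalars_zero)
    show "finite (\<phi> ` harmonic_index d)" using finite_harmonic_index by simp
    fix u g assume z: "(\<Sum>g\<in>\<phi> ` harmonic_index d. (\<lambda>x. u g * g x)) = 0" and "g \<in> \<phi> ` harmonic_index d"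
    then obtain q where q: "q \<in> harmonic_index d" "g = \<phi> q" by blast
    have "(\<Sum>p\<in>harmonic_index d. u (\<phi> p) * \<phi> p x) = 0" for x
      using fun_cong[OF z, of x] by (simp add: sum_fun_apply sum.reindex[OF inj])
    then have "0 = (\<integral>x. (\<Sum>p\<in>harmonic_index d. u (\<phi> p) * (\<phi> p x * cnj (\<phi> q x))) \<partial>sphere_measure)"
      by (simp add: sum_distrib_right[symmetric] mult.assoc[symmetric])
    also have "\<dots> = (\<Sum>p\<in>harmonic_index d. u (\<phi> p) * (if p = q then 1 else 0))"
      using i\<phi> q orth by simp
    also have "\<dots> = u (\<phi> q)" using q finite_harmonic_index by (simp add: if_distrib[of "\<lambda>t. _ * t"] cong: if_cong)
    finally show "u g = 0" using q by simp
  qed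
  have sub: "\<phi> ` harmonic_index d \<subseteq> vs.span (\<psi> ` ?E)"
  proof
    fix g assume "g \<in> \<phi> ` harmonic_index d"
    then obtain l m where lm: "(l, m) \<in> harmonic_index d" "g = R (Y l m)" by (auto simp: \<phi>_def)
    then have "l \<le> d" "even (d - l)" by (auto simp: harmonic_index_def)
    then obtain k where "d - l = 2 * k" by (elim evenE)
    then have k: "d = 2 * k + l" using \<open>l \<le> d\<close> by linarith
    have "spherical_harmonic l (Y l m)" using lm(1) by (intro spherical_harmonic_Y) (simp add: harmonic_index_def)
    then obtain p where p: "homogeneous_polynomial l p" "\<And>x. x \<in> S2 \<Longrightarrow> Y l m x = p x" using spherical_harmonicE by metis
    have h1: "homogeneous_polynomial d (\<lambda>x. of_real ((x \<bullet> x) ^ k) * p x)"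
      unfolding k by (rule homogeneous_polynomial_mult[OF homogeneous_polynomial_inner_self_power p(1)])
    have h2: "R (\<lambda>x. of_real ((x \<bullet> x) ^ k) * p x) = g"
      using p(2) by (auto simp: lm(2) R_def fun_eq_iff norm_eq_1)
    show "g \<in> vs.span (\<psi> ` ?E)" using hp_span[OF h1] unfolding h2 .
  qed
  have "R f \<in> vs.span (\<phi> ` harmonic_index d)"
  proof (rule ccontr)
    assume n: "R f \<notin> vs.span (\<phi> ` harmonic_index d)"
    have fE: "finite (\<psi> ` ?E)" using finite_exponents by simp
    have "vs.independent (insert (R f) (\<phi> ` harmonic_index d))"
      using ind n vs.independent_insertI by blast
    moreover have "insert (R f) (\<phi> ` harmonic_index d) \<subseteq> vs.span (\<psi> ` ?E)" using sub hp_span[OF f] by simp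
    ultimately have "card (insert (R f) (\<phi> ` harmonic_index d)) \<le> card (\<psi> ` ?E)"
      using vs.independent_span_bound[OF fE] by blast
    also have "\<dots> \<le> card ?E" by (rule card_image_le[OF finite_exponents])
    also have "\<dots> = card (harmonic_index d)" using card_exponents[of d] card_harmonic_index[of d] by simp
    also have "\<dots> = card (\<phi> ` harmonic_index d)" by (simp add: card_image[OF inj])
    finally show False using n vs.span_base finite_harmonic_index by (auto simp: card_insert_if split: if_splits)
  qed
  then obtain u where u: "R f = (\<Sum>g\<in>\<phi> ` harmonic_index d. (\<lambda>x. u g * g x))"
    using vs.span_finite[of "\<phi> ` harmonic_index d"] finite_harmonic_index by auto
  have "f x = (\<Sum>p\<in>harmonic_index d. u (\<phi> p) * Y (fst p) (snd p) x)" if "x \<in> S2" for x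
  proof -
    have "R f x = (\<Sum>p\<in>harmonic_index d. u (\<phi> p) * \<phi> p x)"
      using fun_cong[OF u, of x] by (simp add: sum_fun_apply sum.reindex[OF inj])
    moreover have "\<phi> p x = Y (fst p) (snd p) x" for p using that by (simp add: \<phi>_def R_def)
    ultimately show ?thesis using that by (simp add: R_def)
  qed
  then show ?thesis by (intro exI[of _ "\<lambda>p. u (\<phi> p)"]) (simp add: case_prod_unfold)
qed

section \<open>Density of harmonic combinations and Parseval's identity\<close>

definition harmonic_index_le :: "nat \<Rightarrow> (nat \<times> int) set" where
  "harmonic_index_le N = (SIGMA l:{..N}. {- int l..int l})"

lemma finite_harmonic_index_le: "finite (harmonic_index_le N)"
  unfolding harmonic_index_le_def by auto

definition harmonic_combination :: "nat \<Rightarrow> (real^3 \<Rightarrow> complex) \<Rightarrow> bool" where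
  "harmonic_combination N f \<longleftrightarrow> (\<exists>c. \<forall>x\<in>S2. f x = (\<Sum>(l, m)\<in>harmonic_index_le N. c (l, m) * Y l m x))"

lemma harmonic_combination_superset:
  assumes "A \<subseteq> harmonic_index_le N" "\<And>x. x \<in> S2 \<Longrightarrow> f x = (\<Sum>(l, m)\<in>A. c (l, m) * Y l m x)"
  shows "harmonic_combination N f"
  unfolding harmonic_combination_def
proof (intro exI ballI)
  fix x assume "x \<in> S2"
  then have "f x = (\<Sum>(l, m)\<in>A. c (l, m) * Y l m x)" by (rule assms)
  also have "\<dots> = (\<Sum>(l, m)\<in>harmonic_index_le N. (if (l, m) \<in> A then c (l, m) else 0) * Y l m x)"
    using assms(1) finite_harmonic_index_le by (intro sum.mono_neutral_cong_left) auto
  finally show "f x = (\<Sum>(l, m)\<in>harmonic_index_le N. (\<lambda>p. if p \<in> A then c p else 0) (l, m) * Y l m x)" .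
qed

lemma harmonic_combination_mono:
  assumes "harmonic_combination N f" "N \<le> N'" shows "harmonic_combination N' f"
proof -
  have "harmonic_index_le N \<subseteq> harmonic_index_le N'" using assms(2) by (auto simp: harmonic_index_le_def)
  moreover obtain c where "\<forall>x\<in>S2. f x = (\<Sum>(l, m)\<in>harmonic_index_le N. c (l, m) * Y l m x)"
    using assms(1) unfolding harmonic_combination_def by blast
  ultimately show ?thesis by (intro harmonic_combination_superset[of "harmonic_index_le N" N' f c]) auto
qed

text \<open>Polynomials of mixed degree. Being closed under products, the class contains every real
  polynomial function, the form in which the Stone-Weierstrass theorem delivers its
  approximants.\<close>

inductive polynomial_sum :: "(real^3 \<Rightarrow> complex) \<Rightarrow> bool" where
  homogeneous: "homogeneous_polynomial d f \<Longrightarrow> polynomial_sum f"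
| add: "polynomial_sum f \<Longrightarrow> polynomial_sum g \<Longrightarrow> polynomial_sum (\<lambda>x. f x + g x)"

lemma polynomial_sum_mult:
  assumes "polynomial_sum f" "polynomial_sum g" shows "polynomial_sum (\<lambda>x. f x * g x)"
  using assms(1)
proof induction
  case (homogeneous d f)
  show ?case using assms(2)
  proof induction
    case (homogeneous e g)
    then show ?case using homogeneous_polynomial_mult[OF \<open>homogeneous_polynomial d f\<close>] polynomial_sum.homogeneous by blast
  next
    case (add g h)
    then show ?case using polynomial_sum.add by (simp add: distrib_left)
  qed
next
  case (add f h)
  then show ?case using polynomial_sum.add by (simp add: distrib_right)
qed

lemma polynomial_sum_real_polynomial_function:
  "real_polynomial_function g \<Longrightarrow> polynomial_sum (\<lambda>x. of_real (g x))"
proof (induction rule: real_polynomial_function.induct)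
  case (linear f)
  \<comment> \<open>Riesz representation: \<open>adjoint f 1\<close> is the vector that represents
    the linear functional.\<close>
  have "f x = adjoint f 1 \<bullet> x" for x
    using adjoint_works[OF bounded_linear.linear[OF linear], of x 1] by (simp add: inner_commute)
  then have "(\<lambda>x. complex_of_real (f x)) = (\<lambda>x. of_real (adjoint f 1 \<bullet> x))" by simp
  then show ?case using homogeneous_polynomial_inner polynomial_sum.homogeneous by metis
next
  case (const c)
  then show ?case by (rule polynomial_sum.homogeneous[OF homogeneous_polynomial_const])
next
  case (add f g)
  then show ?case using polynomial_sum.add by simp
next
  case (mult f g)
  then show ?case using polynomial_sum_mult by simp
qed

lemma polynomial_sum_harmonic_combination:
  "polynomial_sum f \<Longrightarrow> \<exists>N. harmonic_combination N f"
proof (induction rule: polynomial_sum.induct)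
  case (homogeneous d f)
  have "harmonic_index d \<subseteq> harmonic_index_le d" by (auto simp: harmonic_index_def harmonic_index_le_def)
  moreover obtain c where "\<forall>x\<in>S2. f x = (\<Sum>(l, m)\<in>harmonic_index d. c (l, m) * Y l m x)"
    using homogeneous_polynomial_harmonic_expansion[OF homogeneous] by blast
  ultimately show ?case by (intro exI[of _ d] harmonic_combination_superset[of "harmonic_index d" d f c]) auto
next
  case (add f g)
  then obtain N N' where "harmonic_combination N f" "harmonic_combination N' g" by blast
  then have "harmonic_combination (max N N') f" "harmonic_combination (max N N') g"
    by (auto intro: harmonic_combination_mono)
  then obtain c d where "\<forall>x\<in>S2. f x = (\<Sum>(l, m)\<in>harmonic_index_le (max N N'). c (l, m) * Y l m x)"
    "\<forall>x\<in>S2. g x = (\<Sum>(l, m)\<in>harmonic_index_le (max N N'). d (l, m) * Y l m x)"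
    unfolding harmonic_combination_def by blast
  then have "harmonic_combination (max N N') (\<lambda>x. f x + g x)"
    unfolding harmonic_combination_def
    by (intro exI[of _ "\<lambda>p. c p + d p"]) (simp add: case_prod_unfold distrib_right sum.distrib)
  then show ?case by blast
qed

text \<open>A uniform polynomial approximant is a harmonic combination of some degree N0, and for N
  \<ge> N0 the Fourier sum of degree N is at least as close in mean square. Bessel's inequality is
  the bound from the other side.\<close>

lemma parseval:
  fixes F :: "real^3 \<Rightarrow> real"
  assumes F: "continuous_on S2 F"
  shows "(\<lambda>l. \<Sum>m = - int l..int l. (cmod (\<integral>x. of_real (F x) * cnj (Y l m x) \<partial>sphere_measure))\<^sup>2)
     sums (\<integral>x. (F x)\<^sup>2 \<partial>sphere_measure)"
proof -
  define c where "c p = (\<integral>x. of_real (F x) * cnj (Y (fst p) (snd p) x) \<partial>sphere_measure)" for p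
  define \<phi> where "\<phi> p = Y (fst p) (snd p)" for p
  have mem: "snd p \<in> {-int (fst p)..int (fst p)}" if "p \<in> harmonic_index_le N" for p N
    using that by (cases p) (simp add: harmonic_index_le_def)
  have id: "(\<integral>x. (cmod (of_real (F x) - (\<Sum>p\<in>harmonic_index_le N. d p * \<phi> p x)))\<^sup>2 \<partial>sphere_measure) =
    (\<integral>x. (F x)\<^sup>2 \<partial>sphere_measure) - (\<Sum>p\<in>harmonic_index_le N. (cmod (c p))\<^sup>2) + (\<Sum>p\<in>harmonic_index_le N. (cmod (d p - c p))\<^sup>2)" for d N
  proof -
    have "(\<integral>x. (cmod (of_real (F x) - (\<Sum>p\<in>harmonic_index_le N. d p * \<phi> p x)))\<^sup>2 \<partial>sphere_measure) =
      (\<integral>x. (cmod (of_real (F x)))\<^sup>2 \<partial>sphere_measure) - (\<Sum>p\<in>harmonic_index_le N. (cmod (\<integral>x. of_real (F x) * cnj (\<phi> p x) \<partial>sphere_measure))\<^sup>2) +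
      (\<Sum>p\<in>harmonic_index_le N. (cmod (d p - (\<integral>x. of_real (F x) * cnj (\<phi> p x) \<partial>sphere_measure)))\<^sup>2)"
    proof (rule integral_norm_diff_orthonormal[OF finite_harmonic_index_le])
      show "integrable sphere_measure (\<lambda>x. complex_of_real (F x) * cnj (complex_of_real (F x)))"
        by (intro integrable_sphere_measure continuous_intros F)
      show "integrable sphere_measure (\<lambda>x. complex_of_real (F x) * cnj (\<phi> p x))" if "p \<in> harmonic_index_le N" for p
        unfolding \<phi>_def by (intro integrable_sphere_measure continuous_intros F continuous_on_Y mem[OF that])
      show "integrable sphere_measure (\<lambda>x. \<phi> p x * cnj (\<phi> q x))" if "p \<in> harmonic_index_le N" "q \<in> harmonic_index_le N" for p q
        unfolding \<phi>_def by (intro integrable_sphere_measure continuous_intros continuous_on_Y mem[OF that(1)] mem[OF that(2)])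
      show "(\<integral>x. \<phi> p x * cnj (\<phi> q x) \<partial>sphere_measure) = (if p = q then 1 else 0)"
        if "p \<in> harmonic_index_le N" "q \<in> harmonic_index_le N" for p q
        unfolding \<phi>_def orthonormal_Y[OF mem[OF that(1)] mem[OF that(2)]] by (simp add: prod_eq_iff)
    qed
    then show ?thesis by (simp add: c_def \<phi>_def)
  qed
  have le: "(\<Sum>p\<in>harmonic_index_le N. (cmod (c p))\<^sup>2) \<le> (\<integral>x. (F x)\<^sup>2 \<partial>sphere_measure)" for N
  proof -
    have "0 \<le> (\<integral>x. (cmod (of_real (F x) - (\<Sum>p\<in>harmonic_index_le N. c p * \<phi> p x)))\<^sup>2 \<partial>sphere_measure)"
      by (rule Bochner_Integration.integral_nonneg) simp
    then show ?thesis unfolding id by simp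
  qed
  have "(\<lambda>N. \<Sum>p\<in>harmonic_index_le N. (cmod (c p))\<^sup>2) \<longlonglongrightarrow> (\<integral>x. (F x)\<^sup>2 \<partial>sphere_measure)"
  proof (rule LIMSEQ_I)
    fix r :: real assume r: "r > 0"
    \<comment> \<open>The measure has total mass 1, so a uniform error below e costs at most e^2 = r
      / 2 in mean square.\<close>
    define e where "e = sqrt (r / 2)"
    have e: "e > 0" "e\<^sup>2 < r" using r by (auto simp: e_def)
    obtain g where g: "real_polynomial_function g" "\<And>x. x \<in> S2 \<Longrightarrow> \<bar>F x - g x\<bar> < e"
      using Stone_Weierstrass_real_polynomial_function[OF compact_sphere F e(1)] by blast
    obtain N0 where N0: "harmonic_combination N0 (\<lambda>x. of_real (g x))"
      using polynomial_sum_harmonic_combination[OF polynomial_sum_real_polynomial_function[OF g(1)]] by blast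
    have "norm ((\<Sum>p\<in>harmonic_index_le N. (cmod (c p))\<^sup>2) - (\<integral>x. (F x)\<^sup>2 \<partial>sphere_measure)) < r" if N: "N \<ge> N0" for N
    proof -
      obtain d where d: "\<And>x. x \<in> S2 \<Longrightarrow> of_real (g x) = (\<Sum>(l, m)\<in>harmonic_index_le N. d (l, m) * Y l m x)"
        using harmonic_combination_mono[OF N0 N] unfolding harmonic_combination_def by blast
      have "(\<integral>x. (F x)\<^sup>2 \<partial>sphere_measure) - (\<Sum>p\<in>harmonic_index_le N. (cmod (c p))\<^sup>2) \<le>
          (\<integral>x. (cmod (of_real (F x) - (\<Sum>p\<in>harmonic_index_le N. d p * \<phi> p x)))\<^sup>2 \<partial>sphere_measure)"
        unfolding id by (simp add: sum_nonneg)
      also have "\<dots> = (\<integral>x. (F x - g x)\<^sup>2 \<partial>sphere_measure)"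
      proof (rule integral_sphere_cong)
        fix x assume x: "x \<in> S2"
        have "of_real (F x) - (\<Sum>p\<in>harmonic_index_le N. d p * \<phi> p x) = complex_of_real (F x - g x)"
          using d[OF x] by (simp add: \<phi>_def case_prod_unfold)
        then show "(cmod (of_real (F x) - (\<Sum>p\<in>harmonic_index_le N. d p * \<phi> p x)))\<^sup>2 = (F x - g x)\<^sup>2"
          by (simp only: norm_of_real) simp
      qed
      also have "\<dots> \<le> (\<integral>x. e\<^sup>2 \<partial>sphere_measure)"
      proof (rule integral_mono)
        have "continuous_on S2 g" by (rule continuous_on_polymonial_function) (use g(1) in \<open>simp add: real_polynomial_function_eq\<close>)
        then show "integrable sphere_measure (\<lambda>x. (F x - g x)\<^sup>2)"
          by (intro integrable_sphere_measure continuous_intros F)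
        show "integrable sphere_measure (\<lambda>x. e\<^sup>2)" by (intro integrable_sphere_measure continuous_intros)
        show "(F x - g x)\<^sup>2 \<le> e\<^sup>2" if "x \<in> space sphere_measure" for x
          using g(2)[of x] that e by (intro power2_le_iff_abs_le[THEN iffD2]) auto
      qed
      also have "\<dots> < r" using e unfolding integral_sphere_const by simp
      finally show ?thesis using le[of N] by simp
    qed
    then show "\<exists>N0. \<forall>N\<ge>N0. norm ((\<Sum>p\<in>harmonic_index_le N. (cmod (c p))\<^sup>2) - (\<integral>x. (F x)\<^sup>2 \<partial>sphere_measure)) < r" by blast
  qed
  moreover have "(\<Sum>p\<in>harmonic_index_le N. (cmod (c p))\<^sup>2) = (\<Sum>l\<le>N. \<Sum>m = - int l..int l. (cmod (c (l, m)))\<^sup>2)" for N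
    unfolding harmonic_index_le_def by (subst sum.Sigma) auto
  ultimately show ?thesis unfolding sums_def_le c_def by simp
qed

end

section \<open>Cosine transforms\<close>

definition cosine_transform :: "(real^3) measure \<Rightarrow> real^3 \<Rightarrow> real" where
  "cosine_transform \<nu> u = (\<integral>n. \<bar>u \<bullet> n\<bar> \<partial>\<nu>)"

text \<open>For unit n the integrand |u . n| is 1-Lipschitz in u, so the total mass is a Lipschitz
  constant.\<close>

lemma continuous_on_cosine_transform:
  assumes \<nu>: "sets \<nu> = sets sphere_borel" "finite_measure \<nu>"
  shows "continuous_on S (cosine_transform \<nu>)"
proof -
  have sp: "space \<nu> = S2" using sets_eq_imp_space_eq[OF \<nu>(1)] by simp
  have i: "integrable \<nu> (\<lambda>n. \<bar>u \<bullet> n\<bar>)" for u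
    by (intro integrable_sphere_continuous[OF \<nu>] continuous_intros)
  have "(measure \<nu> S2)-lipschitz_on S (cosine_transform \<nu>)"
  proof (rule lipschitz_onI)
    fix u v
    have "dist (cosine_transform \<nu> u) (cosine_transform \<nu> v) = norm (\<integral>n. \<bar>u \<bullet> n\<bar> - \<bar>v \<bullet> n\<bar> \<partial>\<nu>)"
      using i by (simp add: cosine_transform_def dist_norm)
    also have "\<dots> \<le> (\<integral>n. norm (\<bar>u \<bullet> n\<bar> - \<bar>v \<bullet> n\<bar>) \<partial>\<nu>)" by (rule integral_norm_bound)
    also have "\<dots> \<le> (\<integral>n. norm (u - v) \<partial>\<nu>)"
    proof (rule Bochner_Integration.integral_mono)
      fix n assume n: "n \<in> space \<nu>"
      have "norm (\<bar>u \<bullet> n\<bar> - \<bar>v \<bullet> n\<bar>) \<le> \<bar>(u - v) \<bullet> n\<bar>" by (simp add: inner_diff_left abs_triangle_ineq3)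
      also have "\<dots> \<le> norm (u - v)" using Cauchy_Schwarz_ineq2[of "u - v" n] n sp by simp
      finally show "norm (\<bar>u \<bullet> n\<bar> - \<bar>v \<bullet> n\<bar>) \<le> norm (u - v)" .
    qed (use i finite_measure.integrable_const[OF \<nu>(2)] in auto)
    also have "\<dots> = measure \<nu> S2 * dist u v" by (simp add: sp dist_norm)
    finally show "dist (cosine_transform \<nu> u) (cosine_transform \<nu> v) \<le> measure \<nu> S2 * dist u v" .
  qed simp
  then show ?thesis by (rule lipschitz_on_continuous_on)
qed

text \<open>Exchange the integrals: for fixed n the inner one is Funk-Hecke for the kernel |t|,
  whose multiplier is \<open>abs_coeff l\<close> by definition. The kernel is real, so conjugation
  passes through. Most of the work is the joint measurability for Fubini's theorem.\<close>

lemma cosine_transform_harmonic_coeff: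
  assumes Y: "orthonormal_harmonics Y" and \<nu>: "sets \<nu> = sets sphere_borel" "finite_measure \<nu>"
    and m: "m \<in> {- int l..int l}"
  shows "(\<integral>u. of_real (cosine_transform \<nu> u) * cnj (Y l m u) \<partial>sphere_measure) =
     of_real (abs_coeff l) * harmonic_coeff Y \<nu> l m"
proof -
  have sp: "space \<nu> = S2" using sets_eq_imp_space_eq[OF \<nu>(1)] by simp
  interpret N: finite_measure \<nu> by fact
  interpret S: prob_space sphere_measure by (rule prob_space_sphere_measure)
  interpret P: pair_sigma_finite sphere_measure \<nu> ..
  interpret PF: finite_measure "sphere_measure \<Otimes>\<^sub>M \<nu>"
    by (rule finite_measure_pair_measure) unfold_locales
  note Yc = continuous_on_Y[OF Y m]
  obtain p where p: "homogeneous_polynomial l p" "\<And>x. laplacian p x = 0" "\<And>x. x \<in> S2 \<Longrightarrow> Y l m x = p x"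
    using spherical_harmonic_Y[OF Y m] spherical_harmonicE by metis
  obtain B where B: "\<And>x. x \<in> S2 \<Longrightarrow> norm (Y l m x) \<le> B" using bounded_continuous_sphere[OF Yc] by blast
  have id: "(\<lambda>x. x) \<in> borel_measurable sphere_borel" by (rule borel_measurable_sphere_continuous) (rule continuous_on_id)
  have mS: "g \<in> borel_measurable sphere_measure \<longleftrightarrow> g \<in> borel_measurable sphere_borel"
    and mN: "g \<in> borel_measurable \<nu> \<longleftrightarrow> g \<in> borel_measurable sphere_borel" for g :: "real^3 \<Rightarrow> 'c::topological_space"
    using \<nu>(1) by (simp_all cong: measurable_cong_sets)
  have [measurable]: "(\<lambda>x. x) \<in> borel_measurable sphere_measure" "(\<lambda>x. x) \<in> borel_measurable \<nu>"
    "Y l m \<in> borel_measurable sphere_measure"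
    using id borel_measurable_sphere_continuous[OF Yc] by (simp_all add: mS mN)
  have f1: "fst \<in> borel_measurable (sphere_measure \<Otimes>\<^sub>M \<nu>)"
    by (rule measurable_compose[OF measurable_fst, of "\<lambda>x. x", simplified]) measurable
  have f2: "snd \<in> borel_measurable (sphere_measure \<Otimes>\<^sub>M \<nu>)"
    by (rule measurable_compose[OF measurable_snd, of "\<lambda>x. x", simplified]) measurable
  have f3: "(\<lambda>x. Y l m (fst x)) \<in> borel_measurable (sphere_measure \<Otimes>\<^sub>M \<nu>)"
    by (rule measurable_compose[OF measurable_fst]) measurable
  have cm: "cnj \<in> borel_measurable borel" by (intro borel_measurable_continuous_onI continuous_intros)
  have meas: "(\<lambda>(u, n). of_real \<bar>u \<bullet> n\<bar> * cnj (Y l m u)) \<in> borel_measurable (sphere_measure \<Otimes>\<^sub>M \<nu>)"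
    unfolding case_prod_unfold
    using f1 f2 measurable_compose[OF f3 cm] by measurable
  have int: "integrable (sphere_measure \<Otimes>\<^sub>M \<nu>) (\<lambda>(u, n). of_real \<bar>u \<bullet> n\<bar> * cnj (Y l m u))"
  proof (rule PF.integrable_const_bound[of _ B])
    show "AE x in sphere_measure \<Otimes>\<^sub>M \<nu>. norm (case x of (u, n) \<Rightarrow> complex_of_real \<bar>u \<bullet> n\<bar> * cnj (Y l m u)) \<le> B"
    proof (rule AE_I2)
      fix x assume "x \<in> space (sphere_measure \<Otimes>\<^sub>M \<nu>)"
      then obtain u n where x: "x = (u, n)" "u \<in> S2" "n \<in> S2" by (auto simp: space_pair_measure sp)
      have "\<bar>u \<bullet> n\<bar> \<le> 1" using Cauchy_Schwarz_ineq2[of u n] x by simp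
      then have "\<bar>u \<bullet> n\<bar> * norm (Y l m u) \<le> 1 * B" using B[OF x(2)] by (intro mult_mono) auto
      then show "norm (case x of (u, n) \<Rightarrow> complex_of_real \<bar>u \<bullet> n\<bar> * cnj (Y l m u)) \<le> B"
        by (simp add: x(1) norm_mult)
    qed
  qed (rule meas)
  have "(\<integral>u. of_real (cosine_transform \<nu> u) * cnj (Y l m u) \<partial>sphere_measure) =
     (\<integral>u. (\<integral>n. of_real \<bar>u \<bullet> n\<bar> * cnj (Y l m u) \<partial>\<nu>) \<partial>sphere_measure)"
    by (rule integral_sphere_cong) (simp add: cosine_transform_def)
  also have "\<dots> = (\<integral>n. (\<integral>u. of_real \<bar>u \<bullet> n\<bar> * cnj (Y l m u) \<partial>sphere_measure) \<partial>\<nu>)"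
    by (rule P.Fubini_integral[symmetric]) (rule int)
  also have "\<dots> = (\<integral>n. of_real (abs_coeff l) * cnj (Y l m n) \<partial>\<nu>)"
  proof (rule Bochner_Integration.integral_cong[OF refl])
    fix n assume "n \<in> space \<nu>"
    then have n: "n \<in> S2" by (simp add: sp)
    have "(\<integral>u. of_real \<bar>u \<bullet> n\<bar> * cnj (Y l m u) \<partial>sphere_measure) = (\<integral>u. cnj (of_real \<bar>n \<bullet> u\<bar> * p u) \<partial>sphere_measure)"
      by (rule integral_sphere_cong) (simp add: p(3) inner_commute)
    also have "\<dots> = cnj (\<integral>u. of_real \<bar>n \<bullet> u\<bar> * p u \<partial>sphere_measure)" by (rule Bochner_Integration.integral_cnj)
    also have "(\<integral>u. of_real \<bar>n \<bullet> u\<bar> * p u \<partial>sphere_measure) = of_real (abs_coeff l) * p n"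
      unfolding abs_coeff_def
      by (rule funk_hecke[OF p(1,2) n, where g = abs]) (intro continuous_intros)
    finally show "(\<integral>u. of_real \<bar>u \<bullet> n\<bar> * cnj (Y l m u) \<partial>sphere_measure) = of_real (abs_coeff l) * cnj (Y l m n)"
      by (simp add: p(3)[OF n])
  qed
  also have "\<dots> = of_real (abs_coeff l) * harmonic_coeff Y \<nu> l m"
    by (simp add: harmonic_coeff_def)
  finally show ?thesis .
qed

section \<open>Variances as sums over harmonic coefficients\<close>

text \<open>\<open>X\<close> only has to agree with a continuous \<open>F\<close> on the sphere.
  Width and brightness, defined by suprema and by a choice of isometry, are thus replaced by cosine
  transforms, and their measurability comes from \<open>F\<close>.\<close>

lemma variance_sphere:
  fixes F :: "real^3 \<Rightarrow> real"
  assumes M: "prob_space M" and U: "U \<in> measurable M sphere_borel"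
    and UM: "distr M sphere_borel U = sphere_measure"
    and F: "continuous_on S2 F" and X: "\<And>u. u \<in> S2 \<Longrightarrow> X u = F u"
  shows "prob_space.variance M (\<lambda>\<omega>. X (U \<omega>)) =
    (\<integral>u. (F u)\<^sup>2 \<partial>sphere_measure) - (\<integral>u. F u \<partial>sphere_measure)\<^sup>2"
proof -
  interpret prob_space M by fact
  have "U \<omega> \<in> S2" if "\<omega> \<in> space M" for \<omega> using measurable_space[OF U that] by simp
  then have XF: "X (U \<omega>) = F (U \<omega>)" if "\<omega> \<in> space M" for \<omega> using that X by blast
  have t: "integrable M (\<lambda>\<omega>. g (U \<omega>))" "expectation (\<lambda>\<omega>. g (U \<omega>)) = (\<integral>u. g u \<partial>sphere_measure)"
    if "continuous_on S2 g" for g :: "real^3 \<Rightarrow> real"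
  proof -
    note gm = borel_measurable_sphere_continuous[OF that]
    show "integrable M (\<lambda>\<omega>. g (U \<omega>))"
      using integrable_sphere_measure[OF that] unfolding UM[symmetric] integrable_distr_eq[OF U gm] .
    show "expectation (\<lambda>\<omega>. g (U \<omega>)) = (\<integral>u. g u \<partial>sphere_measure)"
      unfolding UM[symmetric] integral_distr[OF U gm] ..
  qed
  have F2: "continuous_on S2 (\<lambda>u. (F u)\<^sup>2)" by (intro continuous_intros F)
  have e: "expectation (\<lambda>\<omega>. X (U \<omega>)) = expectation (\<lambda>\<omega>. F (U \<omega>))"
    by (rule Bochner_Integration.integral_cong[OF refl XF])
  have "variance (\<lambda>\<omega>. X (U \<omega>)) = variance (\<lambda>\<omega>. F (U \<omega>))"
    unfolding e by (rule Bochner_Integration.integral_cong) (simp_all add: XF)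
  also have "\<dots> = expectation (\<lambda>\<omega>. (F (U \<omega>))\<^sup>2) - (expectation (\<lambda>\<omega>. F (U \<omega>)))\<^sup>2"
    by (rule variance_eq[OF t(1)[OF F] t(1)[OF F2]])
  finally show ?thesis unfolding t(2)[OF F] t(2)[OF F2] .
qed

lemma homogeneous_polynomial_0_const: "homogeneous_polynomial 0 p \<Longrightarrow> p x = p y"
  using homogeneous_polynomial_scaleR[of 0 p 0 x] homogeneous_polynomial_scaleR[of 0 p 0 y] by simp

text \<open>A normalised harmonic of degree 0 is a constant of modulus 1, so this term of Parseval's
  identity is the squared mean that the variance subtracts.\<close>

lemma parseval_0:
  fixes F :: "real^3 \<Rightarrow> real"
  assumes Y: "orthonormal_harmonics Y"
  shows "(\<Sum>m = - int 0..int 0. (cmod (\<integral>x. of_real (F x) * cnj (Y 0 m x) \<partial>sphere_measure))\<^sup>2) = (\<integral>x. F x \<partial>sphere_measure)\<^sup>2"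
proof -
  have m: "0 \<in> {- int 0..int 0}" by simp
  obtain p where p: "homogeneous_polynomial 0 p" "\<And>x. x \<in> S2 \<Longrightarrow> Y 0 0 x = p x"
    using spherical_harmonic_Y[OF Y m] spherical_harmonicE by metis
  define k where "k = p 0"
  have k: "Y 0 0 x = k" if "x \<in> S2" for x
    using p(2)[OF that] homogeneous_polynomial_0_const[OF p(1), of x 0] by (simp add: k_def)
  have "(\<integral>x. Y 0 0 x * cnj (Y 0 0 x) \<partial>sphere_measure) = (\<integral>x. k * cnj k \<partial>sphere_measure)"
    by (rule integral_sphere_cong) (simp add: k)
  then have "k * cnj k = 1" using orthonormal_Y[OF Y m m] by simp
  then have "(cmod k)\<^sup>2 = 1" by (metis complex_norm_square of_real_eq_1_iff)
  moreover have "(\<integral>x. of_real (F x) * cnj (Y 0 0 x) \<partial>sphere_measure) = (\<integral>x. of_real (F x) * cnj k \<partial>sphere_measure)"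
    by (rule integral_sphere_cong) (simp add: k)
  ultimately show ?thesis by (simp add: norm_mult power_mult_distrib)
qed

text \<open>Odd degrees carry the factor \<open>abs_coeff l\<close>, which is 0 there, so the sum
  over positive degrees may be reindexed by l = 2 j.\<close>

lemma has_sum_cosine_transform:
  assumes Y: "orthonormal_harmonics Y" and \<nu>: "sets \<nu> = sets sphere_borel" "finite_measure \<nu>"
  shows "((\<lambda>j. (abs_coeff (2 * j))\<^sup>2 * (\<Sum>m = - int (2 * j)..int (2 * j). (cmod (harmonic_coeff Y \<nu> (2 * j) m))\<^sup>2))
    has_sum ((\<integral>u. (cosine_transform \<nu> u)\<^sup>2 \<partial>sphere_measure) - (\<integral>u. cosine_transform \<nu> u \<partial>sphere_measure)\<^sup>2)) {1..}"
proof -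
  define s where "s l = (\<Sum>m = - int l..int l. (cmod (\<integral>x. of_real (cosine_transform \<nu> x) * cnj (Y l m x) \<partial>sphere_measure))\<^sup>2)" for l
  have s: "s l = (abs_coeff l)\<^sup>2 * (\<Sum>m = - int l..int l. (cmod (harmonic_coeff Y \<nu> l m))\<^sup>2)" for l
    unfolding s_def sum_distrib_left
    by (intro sum.cong refl) (simp add: cosine_transform_harmonic_coeff[OF Y \<nu>] norm_mult power_mult_distrib)
  have "(s has_sum (\<integral>u. (cosine_transform \<nu> u)\<^sup>2 \<partial>sphere_measure)) UNIV"
    using parseval[OF Y continuous_on_cosine_transform[OF \<nu>]] unfolding s_def
    by (intro sums_nonneg_imp_has_sum) (auto intro: sum_nonneg)
  then have "(s has_sum ((\<integral>u. (cosine_transform \<nu> u)\<^sup>2 \<partial>sphere_measure) - s 0)) (UNIV - {0})"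
    by (rule has_sum_Diff) (auto intro: has_sum_finiteI)
  also have "s 0 = (\<integral>u. cosine_transform \<nu> u \<partial>sphere_measure)\<^sup>2"
    unfolding s_def by (rule parseval_0[OF Y])
  also have "(s has_sum ((\<integral>u. (cosine_transform \<nu> u)\<^sup>2 \<partial>sphere_measure) - (\<integral>u. cosine_transform \<nu> u \<partial>sphere_measure)\<^sup>2)) (UNIV - {0}) \<longleftrightarrow>
     (s has_sum ((\<integral>u. (cosine_transform \<nu> u)\<^sup>2 \<partial>sphere_measure) - (\<integral>u. cosine_transform \<nu> u \<partial>sphere_measure)\<^sup>2)) ((\<lambda>j. 2 * j) ` {1..})"
  proof (rule has_sum_cong_neutral)
    fix l :: nat assume l: "l \<in> UNIV - {0} - (\<lambda>j. 2 * j) ` {1..}"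
    have "odd l"
    proof
      assume "even l"
      then obtain j where "l = 2 * j" by (elim evenE)
      then show False using l by auto
    qed
    then show "s l = 0" unfolding s by (simp add: abs_coeff_odd)
  qed auto
  finally show ?thesis
    by (subst (asm) has_sum_reindex) (auto simp: inj_on_def o_def s)
qed

section \<open>Failure of an estimate in all degrees\<close>

text \<open>The measure is the image of a fair coin under the choice between n and - n. Real and
  complex integrands are listed separately because \<open>f\<close> is bound inside the existential
  statement and so has a fixed type.\<close>

lemma symmetric_two_point_measure_exists:
  assumes n: "n \<in> S2"
  shows "\<exists>\<mu>. sets \<mu> = sets sphere_borel \<and> finite_measure \<mu> \<and> even_measure \<mu> \<and>
    (\<forall>f :: real^3 \<Rightarrow> real. f \<in> borel_measurable sphere_borel \<longrightarrow> (\<integral>x. f x \<partial>\<mu>) = (f n + f (- n)) / 2) \<and>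
    (\<forall>f :: real^3 \<Rightarrow> complex. f \<in> borel_measurable sphere_borel \<longrightarrow> (\<integral>x. f x \<partial>\<mu>) = (f n + f (- n)) / 2)"
proof -
  let ?g = "\<lambda>b. if b then n else - n" and ?B = "measure_pmf (bernoulli_pmf (1 / 2))"
  define \<mu> where "\<mu> = distr ?B sphere_borel ?g"
  have g: "?g \<in> measurable ?B sphere_borel" using n by simp
  have "sets \<mu> = sets sphere_borel" by (simp add: \<mu>_def)
  moreover have "finite_measure \<mu>"
    unfolding \<mu>_def by (intro prob_space.finite_measure prob_space.prob_space_distr[OF prob_space_measure_pmf g])
  moreover have "even_measure \<mu>"
    unfolding even_measure_def
  proof
    fix E assume "E \<in> sets \<mu>"
    then have E: "E \<in> sets sphere_borel" by (simp add: \<mu>_def)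
    have "uminus -` E \<inter> space sphere_borel \<in> sets sphere_borel"
    proof (rule measurable_sets[OF _ E])
      show "uminus \<in> measurable sphere_borel sphere_borel"
        unfolding sphere_borel_def
        by (intro measurable_restrict_space2 measurable_restrict_space1) (auto simp: space_restrict_space)
    qed
    moreover have "uminus -` E \<inter> space sphere_borel = uminus ` E"
      using E by (force simp: sets_sphere_borel)
    ultimately have E': "uminus ` E \<in> sets sphere_borel" by simp
    have e: "emeasure \<mu> A = indicator A n * ennreal (1 / 2) + indicator A (- n) * ennreal (1 / 2)"
      if "A \<in> sets sphere_borel" for A
    proof -
      have "emeasure \<mu> A = (\<integral>\<^sup>+x. indicator A x \<partial>\<mu>)" using that by (simp add: \<mu>_def)
      also have "\<dots> = (\<integral>\<^sup>+b. indicator A (?g b) \<partial>?B)"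
        unfolding \<mu>_def using that by (intro nn_integral_distr[OF g]) simp
      finally show ?thesis by simp
    qed
    have "n \<in> uminus ` E \<longleftrightarrow> - n \<in> E" "- n \<in> uminus ` E \<longleftrightarrow> n \<in> E" by (force simp: image_iff)+
    then show "emeasure \<mu> (uminus ` E) = emeasure \<mu> E"
      unfolding e[OF E] e[OF E'] by (auto simp: indicator_def add.commute)
  qed
  moreover have "(\<integral>x. f x \<partial>\<mu>) = (f n + f (- n)) / 2" if "f \<in> borel_measurable sphere_borel" for f :: "real^3 \<Rightarrow> real"
    unfolding \<mu>_def integral_distr[OF g that] by (simp add: field_simps)
  moreover have "(\<integral>x. f x \<partial>\<mu>) = (f n + f (- n)) / 2" if "f \<in> borel_measurable sphere_borel" for f :: "real^3 \<Rightarrow> complex"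
    unfolding \<mu>_def integral_distr[OF g that]
    by (subst integral_measure_pmf[of UNIV]) (auto simp: UNIV_bool scaleR_conv_of_real field_simps)
  ultimately show ?thesis by blast
qed

lemma width_segment: "width (closed_segment 0 n) u = \<bar>u \<bullet> n\<bar>"
proof -
  have "(\<lambda>x. u \<bullet> x) ` closed_segment 0 n = closed_segment (u \<bullet> 0) (u \<bullet> n)"
    by (rule closed_segment_linear_image[symmetric]) (rule bounded_linear.linear[OF bounded_linear_inner_right])
  then show ?thesis unfolding width_def by (auto simp: closed_segment_eq_real_ivl)
qed

lemma zonoid_segment: "zonoid (closed_segment 0 n)"
  unfolding zonoid_def convex_body_def
proof (intro conjI allI impI)
  fix e :: real assume e: "e > 0"
  have "zonotope (closed_segment 0 n)"
    unfolding zonotope_def by (intro exI[of _ "1::nat"] exI[of _ "\<lambda>_. 0"] exI[of _ "\<lambda>_. n"]) simp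
  then show "\<exists>P. zonotope P \<and> closed_segment 0 n \<subseteq> (\<Union>x\<in>P. cball x e) \<and> P \<subseteq> (\<Union>x\<in>closed_segment 0 n. cball x e)"
    using e by (intro exI[of _ "closed_segment 0 n"]) force
qed auto

text \<open>Expanding \<open>(n \<bullet> x) ^ (2 * k)\<close>, which has value \<open>1\<close> at \<open>n\<close> and square norm \<open>1 / (4 k + 1)\<close>,
  and applying the Cauchy-Schwarz inequality.\<close>

lemma sum_harmonics_at_point_ge:
  assumes Y: "orthonormal_harmonics Y" and n: "n \<in> S2"
  shows "4 * real k + 1 \<le> (\<Sum>(l, m)\<in>harmonic_index (2 * k). (cmod (Y l m n))\<^sup>2)"
proof -
  define f where "f x = complex_of_real ((n \<bullet> x) ^ (2 * k))" for x
  have f: "homogeneous_polynomial (2 * k) f"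
    unfolding f_def by (rule homogeneous_polynomial_inner_power)
  let ?I = "harmonic_index (2 * k)"
  obtain c where c: "\<And>x. x \<in> S2 \<Longrightarrow> f x = (\<Sum>(l, m)\<in>?I. c (l, m) * Y l m x)"
    using homogeneous_polynomial_harmonic_expansion[OF Y f] by blast
  define \<phi> where "\<phi> p = Y (fst p) (snd p)" for p
  have mem: "snd p \<in> {-int (fst p)..int (fst p)}" if "p \<in> ?I" for p
    using that by (cases p) (simp add: harmonic_index_def)
  have c': "f x = (\<Sum>p\<in>?I. c p * \<phi> p x)" if "x \<in> S2" for x
    using c[OF that] by (simp add: \<phi>_def case_prod_unfold)
  have "(\<integral>x. (cmod (0 - (\<Sum>p\<in>?I. c p * \<phi> p x)))\<^sup>2 \<partial>sphere_measure) =
      (\<integral>x. (cmod 0)\<^sup>2 \<partial>sphere_measure) - (\<Sum>p\<in>?I. (cmod (\<integral>x. 0 * cnj (\<phi> p x) \<partial>sphere_measure))\<^sup>2) +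
      (\<Sum>p\<in>?I. (cmod (c p - (\<integral>x. 0 * cnj (\<phi> p x) \<partial>sphere_measure)))\<^sup>2)"
  proof (rule integral_norm_diff_orthonormal[OF finite_harmonic_index])
    show "integrable sphere_measure (\<lambda>x. \<phi> p x * cnj (\<phi> q x))" if "p \<in> ?I" "q \<in> ?I" for p q
      unfolding \<phi>_def by (intro integrable_sphere_measure continuous_intros continuous_on_Y[OF Y] mem[OF that(1)] mem[OF that(2)])
    show "(\<integral>x. \<phi> p x * cnj (\<phi> q x) \<partial>sphere_measure) = (if p = q then 1 else 0)" if "p \<in> ?I" "q \<in> ?I" for p q
      unfolding \<phi>_def orthonormal_Y[OF Y mem[OF that(1)] mem[OF that(2)]] by (simp add: prod_eq_iff)
  qed simp_all
  then have "(\<Sum>p\<in>?I. (cmod (c p))\<^sup>2) = (\<integral>x. (cmod (\<Sum>p\<in>?I. c p * \<phi> p x))\<^sup>2 \<partial>sphere_measure)" by simp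
  also have "\<dots> = (\<integral>x. (n \<bullet> x) ^ (4 * k) \<partial>sphere_measure)"
  proof (rule integral_sphere_cong)
    fix x assume "x \<in> S2"
    then have "cmod (\<Sum>p\<in>?I. c p * \<phi> p x) = cmod (f x)" by (simp add: c')
    then show "(cmod (\<Sum>p\<in>?I. c p * \<phi> p x))\<^sup>2 = (n \<bullet> x) ^ (4 * k)"
      by (simp add: f_def norm_power power_mult[symmetric] power_even_abs flip: power_abs)
  qed
  also have "\<dots> = 1 / (4 * real k + 1)"
  proof -
    have "(\<integral>x. complex_of_real ((n \<bullet> x) ^ (4 * k)) * 1 \<partial>sphere_measure) = of_real (legendre_moment 0 (4 * k)) * 1"
      by (rule funk_hecke_power[OF homogeneous_polynomial_const _ n])
         (simp add: laplacian_dir_deriv[OF line_smooth_const] dir_deriv_const)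
    then have "(\<integral>x. (n \<bullet> x) ^ (4 * k) \<partial>sphere_measure) = legendre_moment 0 (4 * k)"
      by (simp only: mult_1_right integral_complex_of_real of_real_eq_iff)
    then show ?thesis by (simp add: legendre_moment_0)
  qed
  finally have cc: "(\<Sum>p\<in>?I. (cmod (c p))\<^sup>2) = 1 / (4 * real k + 1)" .
  have "1 = cmod (f n)" using n by (simp add: f_def norm_eq_1)
  also have "\<dots> \<le> (\<Sum>p\<in>?I. cmod (c p) * cmod (\<phi> p n))"
    unfolding c'[OF n] by (rule order_trans[OF norm_sum]) (simp add: norm_mult)
  finally have "1 \<le> (\<Sum>p\<in>?I. cmod (c p) * cmod (\<phi> p n))\<^sup>2" by simp
  also have "\<dots> \<le> (\<Sum>p\<in>?I. (cmod (c p))\<^sup>2) * (\<Sum>p\<in>?I. (cmod (\<phi> p n))\<^sup>2)" by (rule Cauchy_Schwarz_ineq_sum)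
  finally have "4 * real k + 1 \<le> (\<Sum>p\<in>?I. (cmod (\<phi> p n))\<^sup>2)" unfolding cc by (simp add: field_simps)
  then show ?thesis by (simp add: \<phi>_def case_prod_unfold)
qed

lemma spherical_harmonic_even:
  assumes "spherical_harmonic l f" "even l" "x \<in> S2" shows "f (- x) = f x"
proof -
  obtain p where p: "homogeneous_polynomial l p" "\<And>x. x \<in> S2 \<Longrightarrow> f x = p x" using assms(1) spherical_harmonicE by metis
  have "p (- x) = p x" using homogeneous_polynomial_scaleR[OF p(1), of "-1" x] assms(2) by simp
  then show ?thesis using p(2) assms(3) by simp
qed

text \<open>At even degrees the coefficients of the two half atoms are the conjugates of
  \<open>Y l m n\<close>, and \<open>sum_harmonics_at_point_ge\<close> makes the partial sums of
  their squares unbounded. An infinite sum for one zonoid serves against all constants at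
  once.\<close>

lemma no_uniform_estimate:
  assumes Y: "orthonormal_harmonics Y"
  shows "\<exists>Z \<mu>. zonoid Z \<and> generating_measure Z \<mu> \<and>
    (\<Sum>\<^sub>\<infinity>l \<in> {l. 2 \<le> l \<and> even l}. ennreal (\<Sum>m = - int l..int l. (cmod (harmonic_coeff Y \<mu> l m))\<^sup>2)) = \<infinity>"
proof -
  define n :: "real^3" where "n = axis 1 1"
  have n: "n \<in> S2" by (simp add: n_def)
  obtain \<mu> where \<mu>: "sets \<mu> = sets sphere_borel" "finite_measure \<mu>" "even_measure \<mu>"
    "\<And>f :: real^3 \<Rightarrow> real. f \<in> borel_measurable sphere_borel \<Longrightarrow> (\<integral>x. f x \<partial>\<mu>) = (f n + f (- n)) / 2"
    "\<And>f :: real^3 \<Rightarrow> complex. f \<in> borel_measurable sphere_borel \<Longrightarrow> (\<integral>x. f x \<partial>\<mu>) = (f n + f (- n)) / 2"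
    using symmetric_two_point_measure_exists[OF n] by blast
  have "generating_measure (closed_segment 0 n) \<mu>"
    unfolding generating_measure_def width_segment
  proof (intro conjI \<mu>(1-3) ballI)
    fix u
    have "(\<integral>x. \<bar>u \<bullet> x\<bar> \<partial>\<mu>) = (\<bar>u \<bullet> n\<bar> + \<bar>u \<bullet> (- n)\<bar>) / 2"
      by (rule \<mu>(4)) (intro borel_measurable_sphere_continuous continuous_intros)
    then show "\<bar>u \<bullet> n\<bar> = (\<integral>x. \<bar>u \<bullet> x\<bar> \<partial>\<mu>)" by simp
  qed
  have h: "harmonic_coeff Y \<mu> l m = cnj (Y l m n)" if "even l" "m \<in> {- int l..int l}" for l m
  proof -
    have "(\<lambda>x. cnj (Y l m x)) \<in> borel_measurable sphere_borel"
      by (intro borel_measurable_sphere_continuous continuous_intros continuous_on_Y[OF Y that(2)])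
    then show ?thesis unfolding harmonic_coeff_def
      by (subst \<mu>(5)) (simp_all add: spherical_harmonic_even[OF spherical_harmonic_Y[OF Y that(2)] that(1) n])
  qed
  define s where "s l = (\<Sum>m = - int l..int l. (cmod (Y l m n))\<^sup>2)" for l
  have s: "(\<Sum>m = - int l..int l. (cmod (harmonic_coeff Y \<mu> l m))\<^sup>2) = s l" if "even l" for l
    unfolding s_def by (intro sum.cong refl) (simp add: h that)
  have s0: "s l \<ge> 0" for l unfolding s_def by (intro sum_nonneg) simp
  let ?A = "{l::nat. 2 \<le> l \<and> even l}"
  have "(\<Sum>\<^sub>\<infinity>l \<in> ?A. ennreal (s l)) = \<infinity>"
  proof (rule ccontr)
    assume "(\<Sum>\<^sub>\<infinity>l \<in> ?A. ennreal (s l)) \<noteq> \<infinity>"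
    then obtain r where r: "(\<Sum>\<^sub>\<infinity>l \<in> ?A. ennreal (s l)) = ennreal r" "r \<ge> 0"
      by (cases "\<Sum>\<^sub>\<infinity>l \<in> ?A. ennreal (s l)") auto
    \<comment> \<open>The bound at a point counts degree 0 as well, which the sum over
      \<open>?A\<close> leaves out; hence the extra \<open>s 0\<close>.\<close>
    have b: "4 * real k + 1 \<le> s 0 + r" for k
    proof -
      have "4 * real k + 1 \<le> (\<Sum>l | l \<le> 2 * k \<and> even (2 * k - l). s l)"
        using sum_harmonics_at_point_ge[OF Y n, of k] unfolding harmonic_index_def s_def
        by (subst sum.Sigma) auto
      also have "{l. l \<le> 2 * k \<and> even (2 * k - l)} = insert 0 {l\<in>?A. l \<le> 2 * k}"
        by (auto simp: numeral_2_eq_2 not_less_eq_eq le_Suc_eq) presburger+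
      also have "(\<Sum>l\<in>insert 0 {l\<in>?A. l \<le> 2 * k}. s l) = s 0 + (\<Sum>l\<in>{l\<in>?A. l \<le> 2 * k}. s l)"
        by (subst sum.insert) auto
      also have "(\<Sum>l\<in>{l\<in>?A. l \<le> 2 * k}. s l) \<le> r"
      proof -
        have "ennreal (\<Sum>l\<in>{l\<in>?A. l \<le> 2 * k}. s l) = (\<Sum>l\<in>{l\<in>?A. l \<le> 2 * k}. ennreal (s l))"
          using s0 by (simp add: sum_ennreal)
        also have "\<dots> \<le> (\<Sum>\<^sub>\<infinity>l \<in> ?A. ennreal (s l))"
          by (subst nonneg_infsum_complete) (auto intro!: SUP_upper)
        finally show ?thesis unfolding r(1) using r(2) by simp
      qed
      finally show ?thesis by simp
    qed
    obtain k :: nat where "s 0 + r < real k" using reals_Archimedean2 by blast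
    then show False using b[of k] of_nat_0_le_iff[of k, where ?'a = real] by linarith
  qed
  then have "(\<Sum>\<^sub>\<infinity>l \<in> ?A. ennreal (\<Sum>m = - int l..int l. (cmod (harmonic_coeff Y \<mu> l m))\<^sup>2)) = \<infinity>"
    by (subst infsum_cong[where g = "\<lambda>l. ennreal (s l)"]) (auto simp: s)
  then show ?thesis using zonoid_segment \<open>generating_measure (closed_segment 0 n) \<mu>\<close> by blast
qed

section \<open>Zonal expansion of the kernel\<close>

text \<open>Archimedes' theorem that a coordinate of a uniform point of the sphere is uniform on
  [-1, 1], as the Funk-Hecke formula for the constant harmonic.\<close>

lemma archimedes_sphere:
  fixes g :: "real \<Rightarrow> real"
  assumes u: "u \<in> S2" and g: "continuous_on {-1..1} g"
  shows "(\<integral>x. g (u \<bullet> x) \<partial>sphere_measure) = 1 / 2 * integral {-1..1} g"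
proof -
  have "(\<integral>x. complex_of_real (g (u \<bullet> x)) * 1 \<partial>sphere_measure) = of_real (1 / 2 * integral {-1..1} (\<lambda>t. g t * poly (legendre 0) t)) * 1"
    by (rule funk_hecke[OF homogeneous_polynomial_const _ u g])
       (simp add: laplacian_dir_deriv[OF line_smooth_const] dir_deriv_const)
  then have "complex_of_real (\<integral>x. g (u \<bullet> x) \<partial>sphere_measure) = of_real (1 / 2 * integral {-1..1} (\<lambda>t. g t * poly (legendre 0) t))"
    by (simp only: mult_1_right integral_complex_of_real)
  then show ?thesis by (simp only: of_real_eq_iff legendre_0 poly_1 mult_1_right)
qed

text \<open>The functions sqrt (2 l + 1) P_l (u . x) are orthonormal by
  \<open>archimedes_sphere\<close> and \<open>legendre_orthogonal\<close>, and the partial sums are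
  the projections of the kernel onto them. A projection is at least as close as any polynomial in u
  . x of the same degree, and Weierstrass' theorem supplies a uniformly close one.\<close>

lemma kernel2_expansion:
  assumes u: "u \<in> S2"
  shows "(\<lambda>N. \<integral>n. (kernel2 \<bar>n \<bullet> u\<bar> - (\<Sum>j = 1..N. real (4 * j + 1) * (abs_coeff (2 * j))\<^sup>2 *
             poly (legendre (2 * j)) (n \<bullet> u)))\<^sup>2 \<partial>sphere_measure) \<longlonglongrightarrow> 0"
proof -
  define P where "P l x = poly (legendre l) (u \<bullet> x)" for l and x :: "real^3"
  define \<phi> where "\<phi> l x = complex_of_real (sqrt (2 * real l + 1) * P l x)" for l x
  define F where "F x = kernel2 \<bar>u \<bullet> x\<bar>" for x
  define \<kappa> where "\<kappa> l = (if l = 0 then 0 else (abs_coeff l)\<^sup>2)" for l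
  have ux: "u \<bullet> x \<in> {-1..1}" if "x \<in> S2" for x
    using Cauchy_Schwarz_ineq2[of u x] u that by (auto simp: abs_le_iff)
  have Pc: "continuous_on S2 (P l)" for l unfolding P_def by (intro continuous_intros)
  have Fc: "continuous_on S2 F"
    unfolding F_def by (rule continuous_on_compose2[OF continuous_on_kernel2_abs]) (use ux in \<open>auto intro!: continuous_intros\<close>)
  have cF: "(\<integral>x. of_real (F x) * cnj (\<phi> l x) \<partial>sphere_measure) = of_real (sqrt (2 * real l + 1) * \<kappa> l)" for l
  proof -
    have "(\<integral>x. of_real (F x) * cnj (\<phi> l x) \<partial>sphere_measure) = of_real (\<integral>x. sqrt (2 * real l + 1) * (kernel2 \<bar>u \<bullet> x\<bar> * poly (legendre l) (u \<bullet> x)) \<partial>sphere_measure)"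
      unfolding integral_complex_of_real[symmetric] by (rule integral_sphere_cong) (simp add: F_def \<phi>_def P_def)
    also have "(\<integral>x. sqrt (2 * real l + 1) * (kernel2 \<bar>u \<bullet> x\<bar> * poly (legendre l) (u \<bullet> x)) \<partial>sphere_measure) =
       sqrt (2 * real l + 1) * (1 / 2 * integral {-1..1} (\<lambda>t. kernel2 \<bar>t\<bar> * poly (legendre l) t))"
      by (subst archimedes_sphere[OF u, where g = "\<lambda>t. kernel2 \<bar>t\<bar> * poly (legendre l) t", symmetric])
         (auto intro!: continuous_on_mult continuous_on_kernel2_abs continuous_intros)
    finally show ?thesis unfolding kernel2_legendre_coeff \<kappa>_def by simp
  qed
  have orth: "(\<integral>x. \<phi> k x * cnj (\<phi> l x) \<partial>sphere_measure) = (if k = l then 1 else 0)" for k l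
  proof -
    have "(\<integral>x. \<phi> k x * cnj (\<phi> l x) \<partial>sphere_measure) =
       of_real (\<integral>x. sqrt (2 * real k + 1) * sqrt (2 * real l + 1) * (poly (legendre k) (u \<bullet> x) * poly (legendre l) (u \<bullet> x)) \<partial>sphere_measure)"
      unfolding integral_complex_of_real[symmetric] by (rule integral_sphere_cong) (simp add: \<phi>_def P_def)
    also have "(\<integral>x. sqrt (2 * real k + 1) * sqrt (2 * real l + 1) * (poly (legendre k) (u \<bullet> x) * poly (legendre l) (u \<bullet> x)) \<partial>sphere_measure) =
       sqrt (2 * real k + 1) * sqrt (2 * real l + 1) * (1 / 2 * integral {-1..1} (\<lambda>t. poly (legendre k) t * poly (legendre l) t))"
      by (subst archimedes_sphere[OF u, where g = "\<lambda>t. poly (legendre k) t * poly (legendre l) t", symmetric])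
         (auto intro!: continuous_intros)
    also have "\<dots> = (if k = l then 1 else 0)"
      unfolding legendre_orthogonal by (auto simp: add_nonneg_eq_0_iff)
    finally show ?thesis by simp
  qed
  have id: "(\<integral>x. (cmod (of_real (F x) - (\<Sum>l\<le>D. d l * \<phi> l x)))\<^sup>2 \<partial>sphere_measure) =
     (\<integral>x. (cmod (of_real (F x)))\<^sup>2 \<partial>sphere_measure) - (\<Sum>l\<le>D. (cmod (\<integral>x. of_real (F x) * cnj (\<phi> l x) \<partial>sphere_measure))\<^sup>2) +
     (\<Sum>l\<le>D. (cmod (d l - (\<integral>x. of_real (F x) * cnj (\<phi> l x) \<partial>sphere_measure)))\<^sup>2)" for d D
  proof (rule integral_norm_diff_orthonormal)
    show "integrable sphere_measure (\<lambda>x. complex_of_real (F x) * cnj (complex_of_real (F x)))"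
      by (intro integrable_sphere_measure continuous_intros Fc)
    show "integrable sphere_measure (\<lambda>x. complex_of_real (F x) * cnj (\<phi> l x))" for l
      unfolding \<phi>_def by (intro integrable_sphere_measure continuous_intros Fc Pc)
    show "integrable sphere_measure (\<lambda>x. \<phi> k x * cnj (\<phi> l x))" for k l
      unfolding \<phi>_def by (intro integrable_sphere_measure continuous_intros Pc)
  qed (simp_all add: orth)
  have re: "(\<integral>x. (cmod (of_real (F x) - (\<Sum>l\<le>D. of_real (sqrt (2 * real l + 1) * c l) * \<phi> l x)))\<^sup>2 \<partial>sphere_measure) =
     (\<integral>x. (F x - (\<Sum>l\<le>D. (2 * real l + 1) * c l * P l x))\<^sup>2 \<partial>sphere_measure)" for c D
  proof (rule integral_sphere_cong)
    fix x
    have "of_real (F x) - (\<Sum>l\<le>D. of_real (sqrt (2 * real l + 1) * c l) * \<phi> l x) =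
       complex_of_real (F x - (\<Sum>l\<le>D. (sqrt (2 * real l + 1) * sqrt (2 * real l + 1)) * c l * P l x))"
      by (simp add: \<phi>_def mult_ac del: real_sqrt_mult_self real_sqrt_abs2)
    then show "(cmod (of_real (F x) - (\<Sum>l\<le>D. of_real (sqrt (2 * real l + 1) * c l) * \<phi> l x)))\<^sup>2 =
       (F x - (\<Sum>l\<le>D. (2 * real l + 1) * c l * P l x))\<^sup>2"
      by (simp only: norm_of_real) simp
  qed
  have best: "(\<integral>x. (F x - (\<Sum>l\<le>D. (2 * real l + 1) * \<kappa> l * P l x))\<^sup>2 \<partial>sphere_measure) \<le>
     (\<integral>x. (F x - (\<Sum>l\<le>D. (2 * real l + 1) * c l * P l x))\<^sup>2 \<partial>sphere_measure)" for c D
    unfolding re[symmetric] id cF by (simp add: sum_nonneg)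
  \<comment> \<open>The term of degree 0 and all odd terms vanish, so the sum over j \<le> N is the
    full projection of degree 2 N, to which \<open>best\<close> applies.\<close>
  have even: "(\<Sum>l\<le>2 * N. (2 * real l + 1) * \<kappa> l * P l x) =
     (\<Sum>j = 1..N. real (4 * j + 1) * (abs_coeff (2 * j))\<^sup>2 * poly (legendre (2 * j)) (x \<bullet> u))" for N x
  proof (induction N)
    case 0 then show ?case by (simp add: \<kappa>_def)
  next
    case (Suc N)
    have "(\<Sum>l\<le>2 * Suc N. (2 * real l + 1) * \<kappa> l * P l x) = (\<Sum>l\<le>2 * N. (2 * real l + 1) * \<kappa> l * P l x) +
      (2 * real (Suc (2 * N)) + 1) * \<kappa> (Suc (2 * N)) * P (Suc (2 * N)) x +
      (2 * real (2 * Suc N) + 1) * \<kappa> (2 * Suc N) * P (2 * Suc N) x" by simp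
    then show ?case unfolding Suc by (simp add: \<kappa>_def abs_coeff_odd P_def inner_commute)
  qed
  show ?thesis
  proof (rule LIMSEQ_I)
    fix r :: real assume r: "r > 0"
    define e where "e = sqrt (r / 2)"
    have e: "e > 0" "e\<^sup>2 < r" using r by (auto simp: e_def)
    obtain g where g: "real_polynomial_function g" "\<And>t. t \<in> {-1..1} \<Longrightarrow> \<bar>kernel2 \<bar>t\<bar> - g t\<bar> < e"
      using Stone_Weierstrass_real_polynomial_function[OF compact_Icc continuous_on_kernel2_abs e(1)] by blast
    obtain a D where aD: "g = (\<lambda>t. \<Sum>i\<le>D. a i * t ^ i)" using g(1) unfolding real_polynomial_function_iff_sum by blast
    define p where "p = (\<Sum>i\<le>D. monom (a i) i)"
    have p: "poly p t = g t" "degree p \<le> D" for t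
      unfolding aD p_def by (auto simp: poly_sum poly_monom intro!: degree_sum_le order_trans[OF degree_monom_le])
    have "(\<integral>x. (F x - (\<Sum>l\<le>2 * N. (2 * real l + 1) * \<kappa> l * P l x))\<^sup>2 \<partial>sphere_measure) < r" if N: "N \<ge> D" for N
    proof -
      obtain c where "p = (\<Sum>l\<le>2 * N. smult (c l) (legendre l))"
        using poly_eq_sum_legendre[of p "2 * N"] p(2) N by auto
      then have c: "g t = (\<Sum>l\<le>2 * N. (2 * real l + 1) * (c l / (2 * real l + 1)) * poly (legendre l) t)" for t
        unfolding p(1)[symmetric] by (simp add: poly_sum add_nonneg_eq_0_iff)
      have "(\<integral>x. (F x - (\<Sum>l\<le>2 * N. (2 * real l + 1) * \<kappa> l * P l x))\<^sup>2 \<partial>sphere_measure) \<le>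
        (\<integral>x. (F x - (\<Sum>l\<le>2 * N. (2 * real l + 1) * (c l / (2 * real l + 1)) * P l x))\<^sup>2 \<partial>sphere_measure)"
        by (rule best)
      also have "\<dots> \<le> (\<integral>x. e\<^sup>2 \<partial>sphere_measure)"
      proof (rule Bochner_Integration.integral_mono)
        show "integrable sphere_measure (\<lambda>x. (F x - (\<Sum>l\<le>2 * N. (2 * real l + 1) * (c l / (2 * real l + 1)) * P l x))\<^sup>2)"
          by (intro integrable_sphere_measure continuous_intros Fc Pc)
        show "integrable sphere_measure (\<lambda>x. e\<^sup>2)" by (intro integrable_sphere_measure continuous_intros)
        fix x assume "x \<in> space sphere_measure"
        then have "\<bar>F x - g (u \<bullet> x)\<bar> < e" unfolding F_def using g(2) ux by simp
        then show "(F x - (\<Sum>l\<le>2 * N. (2 * real l + 1) * (c l / (2 * real l + 1)) * P l x))\<^sup>2 \<le> e\<^sup>2"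
          unfolding c P_def using e by (intro power2_le_iff_abs_le[THEN iffD2]) auto
      qed
      finally show ?thesis using e by simp
    qed
    then have "norm (\<integral>x. (F x - (\<Sum>l\<le>2 * N. (2 * real l + 1) * \<kappa> l * P l x))\<^sup>2 \<partial>sphere_measure) < r" if "N \<ge> D" for N
      using that by simp
    then show "\<exists>N0. \<forall>N\<ge>N0. norm ((\<integral>n. (kernel2 \<bar>n \<bullet> u\<bar> - (\<Sum>j = 1..N. real (4 * j + 1) * (abs_coeff (2 * j))\<^sup>2 *
             poly (legendre (2 * j)) (n \<bullet> u)))\<^sup>2 \<partial>sphere_measure) - 0) < r"
      unfolding even F_def by (auto simp: inner_commute)
  qed
qed

section \<open>The projection formula of Cauchy\<close>

text \<open>The sum is the integral of h rounded down to a multiple of 1 / N. It sees the measure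
  only through N sets, which makes setwise limits of measures usable for integrals.\<close>

lemma layer_cake_bounds:
  fixes h :: "'a \<Rightarrow> real"
  assumes M: "finite_measure M" and h: "h \<in> borel_measurable M" "\<And>x. x \<in> space M \<Longrightarrow> 0 \<le> h x \<and> h x \<le> 1" and N: "N \<ge> 1"
  shows "(\<Sum>i=1..N. measure M {x \<in> space M. real i / N \<le> h x}) / N \<le> (\<integral>x. h x \<partial>M)"
    and "(\<integral>x. h x \<partial>M) \<le> (\<Sum>i=1..N. measure M {x \<in> space M. real i / N \<le> h x}) / N + measure M (space M) / N"
proof -
  interpret finite_measure M by fact
  let ?E = "\<lambda>i. {x \<in> space M. real i / N \<le> h x}"
  define s where "s x = (\<Sum>i=1..N. indicator (?E i) x) / real N" for x
  have [measurable]: "?E i \<in> sets M" for i using h(1) by measurable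
  have b: "s x \<le> h x \<and> h x \<le> s x + 1 / N" if x: "x \<in> space M" for x
  proof -
    define k where "k = nat \<lfloor>N * h x\<rfloor>"
    have N0: "real N > 0" using N by simp
    have nn: "0 \<le> N * h x" using h(2)[OF x] by simp
    have k: "real k \<le> N * h x" "N * h x < real k + 1" unfolding k_def using nn by linarith+
    have "N * h x \<le> N" using h(2)[OF x] mult_left_mono[of "h x" 1 "real N"] by simp
    then have kN: "k \<le> N" using k(1) by linarith
    have "(\<Sum>i=1..N. indicator (?E i) x) = (\<Sum>i=1..N. if i \<in> {1..k} then 1 else (0::real))"
    proof (intro sum.cong refl)
      fix i assume "i \<in> {1..N}"
      have "real i / N \<le> h x \<longleftrightarrow> real i \<le> N * h x" using N0 by (simp add: field_simps)
      also have "\<dots> \<longleftrightarrow> i \<le> k" using k by linarith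
      finally show "indicator (?E i) x = (if i \<in> {1..k} then 1 else (0::real))"
        using x \<open>i \<in> {1..N}\<close> by (simp add: indicator_def)
    qed
    also have "\<dots> = real k" using kN by (subst sum.inter_restrict[symmetric]) (auto simp: Int_absorb1)
    finally have "s x = k / N" by (simp add: s_def)
    moreover have "k / N \<le> h x" using k N0 by (simp add: divide_le_eq mult.commute)
    moreover have "h x \<le> (k + 1) / N" using k N0 by (simp add: le_divide_eq mult.commute)
    ultimately show ?thesis by (simp add: add_divide_distrib)
  qed
  have iS: "integrable M s" unfolding s_def
    by (intro integrable_divide_zero Bochner_Integration.integrable_sum integrable_real_indicator)
       (auto simp: less_top[symmetric])
  have ih: "integrable M h" by (rule integrable_const_bound[of _ 1]) (use h in auto)
  have s: "(\<integral>x. s x \<partial>M) = (\<Sum>i=1..N. measure M (?E i)) / N"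
  proof -
    have "integrable M (indicator (?E i) :: 'a \<Rightarrow> real)" for i
      by (intro integrable_real_indicator) (auto simp: less_top[symmetric])
    moreover have "?E i \<inter> space M = ?E i" for i by auto
    ultimately show ?thesis unfolding s_def by (simp add: Bochner_Integration.integral_sum)
  qed
  show "(\<Sum>i=1..N. measure M (?E i)) / N \<le> (\<integral>x. h x \<partial>M)"
    unfolding s[symmetric] using b by (intro integral_mono iS ih) auto
  have "(\<integral>x. h x \<partial>M) \<le> (\<integral>x. s x + 1 / N \<partial>M)"
    using b iS by (intro integral_mono ih) auto
  also have "\<dots> = (\<integral>x. s x \<partial>M) + measure M (space M) / N"
    using iS by simp
  finally show "(\<integral>x. h x \<partial>M) \<le> (\<Sum>i=1..N. measure M (?E i)) / N + measure M (space M) / N"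
    unfolding s .
qed

lemma abs_le_div_nat_imp_0:
  fixes a B :: real
  assumes "\<And>N. (1::nat) \<le> N \<Longrightarrow> \<bar>a\<bar> \<le> B / real N" shows "a = 0"
proof (rule ccontr)
  assume "a \<noteq> 0"
  obtain N :: nat where N: "B / \<bar>a\<bar> < real N" using reals_Archimedean2 by blast
  have "0 \<le> B" using assms[of 1] by simp
  then have "0 \<le> B / \<bar>a\<bar>" by simp
  then have "real N > 0" using N by linarith
  then have N1: "N \<ge> 1" by simp
  have "\<bar>a\<bar> * N \<le> B" using assms[OF N1] N1 by (simp add: field_simps)
  moreover have "B < N * \<bar>a\<bar>" using N \<open>a \<noteq> 0\<close> by (simp add: field_simps)
  ultimately show False by (simp add: mult.commute)
qed

section \<open>The distance to a convex body along a line\<close>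

context
  fixes K :: "(real^3) set"
  assumes K: "compact K" "convex K" "K \<noteq> {}"
begin

lemma closed_body: "closed K" using K(1) by (rule compact_imp_closed)

lemma infdist_closest_point: "infdist x K = norm (x - closest_point K x)"
proof (rule antisym)
  show "infdist x K \<le> norm (x - closest_point K x)"
    using infdist_le[OF closest_point_in_set[OF closed_body K(3)]] by (simp add: dist_norm)
  obtain y where "y \<in> K" "infdist x K = dist x y"
    using infdist_attains_inf[OF closed_body K(3)] by blast
  then show "norm (x - closest_point K x) \<le> infdist x K"
    using closest_point_le[OF closed_body, of y x] by (simp add: dist_norm)
qed

text \<open>The convex combination of two nearest points lies in K and competes for the
  distance.\<close>

lemma convex_on_infdist_line: "convex_on UNIV (\<lambda>t. infdist (y + t *\<^sub>R u) K)"
proof (rule convex_onI)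
  fix t a b :: real assume t: "0 < t" "t < 1"
  let ?x = "\<lambda>t. y + t *\<^sub>R u" and ?p = "\<lambda>t. closest_point K (y + t *\<^sub>R u)"
  have "?p s \<in> K" for s by (rule closest_point_in_set[OF closed_body K(3)])
  then have "(1 - t) *\<^sub>R ?p a + t *\<^sub>R ?p b \<in> K"
    using K(2) t unfolding convex_def by (auto simp: less_imp_le)
  then have "infdist (?x ((1 - t) *\<^sub>R a + t *\<^sub>R b)) K \<le> norm (?x ((1 - t) *\<^sub>R a + t *\<^sub>R b) - ((1 - t) *\<^sub>R ?p a + t *\<^sub>R ?p b))"
    using infdist_le by (metis dist_norm)
  also have "?x ((1 - t) *\<^sub>R a + t *\<^sub>R b) - ((1 - t) *\<^sub>R ?p a + t *\<^sub>R ?p b) =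
     (1 - t) *\<^sub>R (?x a - ?p a) + t *\<^sub>R (?x b - ?p b)" by (simp add: algebra_simps)
  also have "norm \<dots> \<le> (1 - t) * infdist (?x a) K + t * infdist (?x b) K"
    unfolding infdist_closest_point using t by (intro order_trans[OF norm_triangle_ineq]) simp
  finally show "infdist (?x ((1 - t) *\<^sub>R a + t *\<^sub>R b)) K \<le> (1 - t) * infdist (?x a) K + t * infdist (?x b) K" .
qed simp

text \<open>Comparing the squared distances of two points through each other's nearest point bounds
  their difference from both sides. The nearest point map is 1-Lipschitz, so the error is quadratic
  in the step. Positivity of the distance enters when the square root is taken.\<close>

lemma DERIV_infdist_line:
  assumes u: "norm u = 1" and pos: "infdist (y + s *\<^sub>R u) K > 0"
  shows "((\<lambda>t. infdist (y + t *\<^sub>R u) K) has_real_derivative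
     u \<bullet> sgn ((y + s *\<^sub>R u) - closest_point K (y + s *\<^sub>R u))) (at s)"
proof -
  let ?p = "closest_point K" and ?d = "\<lambda>x. infdist x K"
  define x where "x = y + s *\<^sub>R u"
  define D where "D = 2 * (u \<bullet> (x - ?p x))"
  have le: "(?d z)\<^sup>2 \<le> (norm (z - ?p w))\<^sup>2" for z w
    using infdist_le[OF closest_point_in_set[OF closed_body K(3)], of z w] infdist_nonneg[of z K]
    by (intro power_mono) (auto simp: dist_norm)
  have uu: "u \<bullet> u = 1" using u by (simp add: norm_eq_1)
  \<comment> \<open>The constant is not critical: both one-sided estimates below give h^2, and the
    radius r / 6 further on is fitted to 5.\<close>
  have bound: "\<bar>(?d (x + h *\<^sub>R u))\<^sup>2 - (?d x)\<^sup>2 - h * D\<bar> \<le> 5 * h\<^sup>2" for h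
  proof -
    let ?z = "x + h *\<^sub>R u"
    define \<delta> where "\<delta> = ?p ?z - ?p x"
    have "norm \<delta> \<le> norm (h *\<^sub>R u)"
      using closest_point_lipschitz[OF K(2) closed_body K(3), of ?z x] by (simp add: \<delta>_def dist_norm)
    then have \<delta>: "norm \<delta> \<le> \<bar>h\<bar>" using u by simp
    have ud: "\<bar>u \<bullet> \<delta>\<bar> \<le> \<bar>h\<bar>" using Cauchy_Schwarz_ineq2[of u \<delta>] u \<delta> by simp
    have "(?d ?z)\<^sup>2 \<le> (norm (?z - ?p x))\<^sup>2" by (rule le)
    also have "\<dots> = (norm (x - ?p x))\<^sup>2 + h * D + h\<^sup>2"
      unfolding power2_norm_eq_inner D_def
      by (simp add: inner_diff inner_add inner_commute uu power2_eq_square algebra_simps)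
    finally have 1: "(?d ?z)\<^sup>2 - (?d x)\<^sup>2 - h * D \<le> h\<^sup>2" by (simp add: infdist_closest_point)
    have "(?d x)\<^sup>2 \<le> (norm (x - ?p ?z))\<^sup>2" by (rule le)
    also have "x - ?p ?z = (?z - ?p ?z) - h *\<^sub>R u" by simp
    also have "(norm \<dots>)\<^sup>2 = (norm (?z - ?p ?z))\<^sup>2 - 2 * h * (u \<bullet> (?z - ?p ?z)) + h\<^sup>2"
      unfolding power2_norm_eq_inner
      by (simp add: inner_diff inner_add inner_commute uu power2_eq_square algebra_simps)
    also have "u \<bullet> (?z - ?p ?z) = u \<bullet> (x - ?p x) + h - u \<bullet> \<delta>"
      by (simp add: \<delta>_def inner_diff inner_add uu)
    finally have "(?d x)\<^sup>2 - (?d ?z)\<^sup>2 + h * D \<le> 2 * (h * (u \<bullet> \<delta>)) - h\<^sup>2"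
      unfolding D_def by (simp add: infdist_closest_point power2_eq_square algebra_simps)
    moreover have "h * (u \<bullet> \<delta>) \<le> h\<^sup>2"
    proof -
      have "h * (u \<bullet> \<delta>) \<le> \<bar>h\<bar> * \<bar>u \<bullet> \<delta>\<bar>" by (metis abs_ge_self abs_mult)
      also have "\<dots> \<le> \<bar>h\<bar> * \<bar>h\<bar>" using ud by (intro mult_left_mono) auto
      finally show ?thesis by (simp add: power2_eq_square)
    qed
    ultimately have 2: "(?d x)\<^sup>2 - (?d ?z)\<^sup>2 + h * D \<le> h\<^sup>2" by linarith
    show ?thesis using 1 2 zero_le_power2[of h] unfolding abs_le_iff by linarith
  qed
  have sq: "((\<lambda>t. (?d (y + t *\<^sub>R u))\<^sup>2) has_real_derivative D) (at s)"
    unfolding has_field_derivative_iff LIM_def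
  proof (intro allI impI)
    fix r :: real assume r: "r > 0"
    show "\<exists>e>0. \<forall>t. t \<noteq> s \<and> dist t s < e \<longrightarrow>
      dist (((?d (y + t *\<^sub>R u))\<^sup>2 - (?d (y + s *\<^sub>R u))\<^sup>2) / (t - s)) D < r"
    proof (intro exI[of _ "r / 6"] conjI allI impI)
      fix t assume t: "t \<noteq> s \<and> dist t s < r / 6"
      define h where "h = t - s"
      have h: "h \<noteq> 0" "\<bar>h\<bar> < r / 6" using t by (auto simp: h_def dist_real_def)
      have xt: "y + t *\<^sub>R u = x + h *\<^sub>R u" by (simp add: x_def h_def algebra_simps)
      have "\<bar>((?d (x + h *\<^sub>R u))\<^sup>2 - (?d x)\<^sup>2) / h - D\<bar> = \<bar>(?d (x + h *\<^sub>R u))\<^sup>2 - (?d x)\<^sup>2 - h * D\<bar> / \<bar>h\<bar>"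
        unfolding abs_divide[symmetric] using h(1) by (simp add: diff_divide_distrib)
      also have "\<dots> \<le> 5 * h\<^sup>2 / \<bar>h\<bar>" using bound by (intro divide_right_mono) auto
      also have "\<dots> = 5 * \<bar>h\<bar>" using h(1) by (simp add: power2_eq_square abs_if field_simps)
      also have "\<dots> < r" using h(2) by simp
      finally show "dist (((?d (y + t *\<^sub>R u))\<^sup>2 - (?d (y + s *\<^sub>R u))\<^sup>2) / (t - s)) D < r"
        unfolding xt by (simp add: dist_real_def h_def x_def)
    qed (use r in simp)
  qed
  have p2: "(?d x)\<^sup>2 > 0" using pos by (simp add: x_def)
  have "((\<lambda>t. sqrt ((?d (y + t *\<^sub>R u))\<^sup>2)) has_real_derivative inverse (sqrt ((?d x)\<^sup>2)) / 2 * D) (at s)"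
    using DERIV_chain2[OF DERIV_real_sqrt sq] p2 by (simp add: x_def)
  moreover have "inverse (sqrt ((?d x)\<^sup>2)) / 2 * D = u \<bullet> sgn (x - ?p x)"
    using infdist_nonneg[of x K] by (simp add: D_def sgn_div_norm infdist_closest_point)
  ultimately show ?thesis by (simp add: x_def infdist_nonneg)
qed

end

section \<open>Variation of a convex function between the levels 0 and \<epsilon>\<close>

lemma convex_mono_right_of_min:
  fixes \<phi> :: "real \<Rightarrow> real"
  assumes c: "convex_on UNIV \<phi>" and m: "\<And>s. \<phi> s0 \<le> \<phi> s" and st: "s0 \<le> s" "s \<le> t"
  shows "\<phi> s \<le> \<phi> t"
proof (cases "s0 = t")
  case False
  define l where "l = (s - s0) / (t - s0)"
  have l: "0 \<le> l" "l \<le> 1" "s = (1 - l) *\<^sub>R s0 + l *\<^sub>R t"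
    using st False by (auto simp: l_def divide_simps) (simp add: algebra_simps)
  have "\<phi> s \<le> (1 - l) * \<phi> s0 + l * \<phi> t" unfolding l(3) by (rule convex_onD[OF c l(1,2)]) auto
  also have "\<dots> \<le> (1 - l) * \<phi> t + l * \<phi> t" using l m by (intro add_right_mono mult_left_mono) auto
  finally show ?thesis by (simp add: algebra_simps)
qed (use st in auto)

text \<open>Right of a minimum point a convex function is nondecreasing, so the integral of its
  slope is its increase. Up to one point the set in question is an interval [b, \<beta>]: at \<beta>
  the level \<epsilon> is reached, while b is the point where \<phi> leaves its minimal value if
  that is 0, and s0 otherwise. Starting at b matters because a derivative is given only where \<phi>
  is positive.\<close>

lemma nn_integral_convex_slope_right:
  fixes \<phi> D :: "real \<Rightarrow> real"
  assumes c: "convex_on UNIV \<phi>" "continuous_on UNIV \<phi>" and nn: "\<And>s. 0 \<le> \<phi> s"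
    and D: "\<And>s. \<phi> s > 0 \<Longrightarrow> (\<phi> has_real_derivative D s) (at s)"
    and e: "\<epsilon> > 0" "\<phi> s0 \<le> \<epsilon>" and B: "\<And>s. \<phi> s \<le> \<epsilon> \<Longrightarrow> \<bar>s\<bar> \<le> B" and m: "\<And>s. \<phi> s0 \<le> \<phi> s"
  shows "(\<integral>\<^sup>+s. indicator {s. s0 \<le> s \<and> 0 < \<phi> s \<and> \<phi> s \<le> \<epsilon>} s * ennreal \<bar>D s\<bar> \<partial>lborel) = ennreal (\<epsilon> - \<phi> s0)"
proof -
  note mono = convex_mono_right_of_min[OF c(1) m]
  \<comment> \<open>A point above the level \<epsilon>, from which the intermediate value theorem
    obtains one exactly at the level.\<close>
  have out: "\<phi> (max B s0 + 1) > \<epsilon>"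
  proof (rule ccontr)
    assume "\<not> ?thesis"
    then have "\<bar>max B s0 + 1\<bar> \<le> B" by (intro B) simp
    then show False by linarith
  qed
  have closed_le: "closed {s. \<phi> s \<le> r}" for r
    using c(2) by (auto intro!: closed_Collect_le continuous_intros)
  have "compact ({s0..} \<inter> {s. \<phi> s \<le> \<epsilon>})"
    unfolding compact_eq_bounded_closed
  proof
    show "closed ({s0..} \<inter> {s. \<phi> s \<le> \<epsilon>})" using closed_le by (intro closed_Int) auto
    show "bounded ({s0..} \<inter> {s. \<phi> s \<le> \<epsilon>})" unfolding bounded_iff using B by (intro exI[of _ B]) auto
  qed
  then obtain \<beta> where \<beta>: "s0 \<le> \<beta>" "\<phi> \<beta> \<le> \<epsilon>" "\<And>s. s0 \<le> s \<Longrightarrow> \<phi> s \<le> \<epsilon> \<Longrightarrow> s \<le> \<beta>"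
    using compact_attains_sup[of "{s0..} \<inter> {s. \<phi> s \<le> \<epsilon>}"] e by force
  have \<beta>e: "\<phi> \<beta> = \<epsilon>"
  proof -
    obtain t where t: "s0 \<le> t" "\<phi> t = \<epsilon>"
      using IVT'[of \<phi> s0 \<epsilon> "max B s0 + 1"] e out continuous_on_subset[OF c(2)] by (auto simp: less_imp_le)
    then have "\<phi> t \<le> \<phi> \<beta>" using \<beta>(3)[of t] by (intro mono) auto
    then show ?thesis using t \<beta>(2) by simp
  qed
  obtain b where b: "s0 \<le> b" "b \<le> \<beta>" "\<phi> b = \<phi> s0" "\<And>s. b < s \<Longrightarrow> 0 < \<phi> s" "\<And>s. s0 \<le> s \<Longrightarrow> s < b \<Longrightarrow> \<phi> s = 0"
  proof (cases "\<phi> s0 = 0")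
    case True
    have "compact ({s0..\<beta>} \<inter> {s. \<phi> s \<le> 0})" by (intro compact_Int_closed closed_le) simp
    then obtain b where b: "b \<in> {s0..\<beta>}" "\<phi> b \<le> 0" "\<And>s. s \<in> {s0..\<beta>} \<Longrightarrow> \<phi> s \<le> 0 \<Longrightarrow> s \<le> b"
      using compact_attains_sup[of "{s0..\<beta>} \<inter> {s. \<phi> s \<le> 0}"] True \<beta>(1) by force
    show ?thesis
    proof (rule that[of b])
      show "\<phi> b = \<phi> s0" using b(2) nn[of b] True by simp
      show "0 < \<phi> s" if "b < s" for s
      proof (cases "s \<le> \<beta>")
        case True then show ?thesis using b(1) b(3)[of s] that by force
      next
        case False
        then have "\<not> \<phi> s \<le> \<epsilon>" using \<beta>(1) \<beta>(3)[of s] by auto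
        then show ?thesis using e by simp
      qed
      show "\<phi> s = 0" if "s0 \<le> s" "s < b" for s
        using mono[OF that(1), of b] that b(2) nn[of s] by simp
    qed (use b(1) in auto)
  next
    case False
    then have "0 < \<phi> s0" using nn[of s0] by simp
    then have "0 < \<phi> s" for s using m[of s] by simp
    then show ?thesis using that[of s0] \<beta>(1) by auto
  qed
  have D0: "0 \<le> D s" if "b < s" for s
  proof (rule mono_on_imp_deriv_nonneg[of "{b..}" \<phi>])
    show "mono_on {b..} \<phi>" using b(1) by (intro mono_onI mono) auto
    show "(\<phi> has_real_derivative D s) (at s)" by (rule D[OF b(4)[OF that]])
    show "s \<in> interior {b..}" using that by simp
  qed
  have "(D has_integral (\<phi> \<beta> - \<phi> b)) {b..\<beta>}"
  proof (rule fundamental_theorem_of_calculus_interior[OF b(2)])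
    show "continuous_on {b..\<beta>} \<phi>" by (rule continuous_on_subset[OF c(2)]) simp
    show "(\<phi> has_vector_derivative D s) (at s)" if "s \<in> {b<..<\<beta>}" for s
      using D[OF b(4), of s] that by (simp add: has_real_derivative_iff_has_vector_derivative)
  qed
  then have "((\<lambda>s. \<bar>D s\<bar>) has_integral (\<epsilon> - \<phi> s0)) {b..\<beta>}"
    unfolding \<beta>e b(3) by (rule has_integral_spike_finite[of "{b}", rotated 2]) (use D0 in auto)
  then have "(\<integral>\<^sup>+s. ennreal \<bar>D s\<bar> * indicator {b..\<beta>} s \<partial>lborel) = ennreal (\<epsilon> - \<phi> s0)"
    by (intro nn_integral_has_integral_lebesgue') auto
  moreover have "(\<integral>\<^sup>+s. indicator {s. s0 \<le> s \<and> 0 < \<phi> s \<and> \<phi> s \<le> \<epsilon>} s * ennreal \<bar>D s\<bar> \<partial>lborel) =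
      (\<integral>\<^sup>+s. ennreal \<bar>D s\<bar> * indicator {b..\<beta>} s \<partial>lborel)"
  proof (rule nn_integral_cong_AE)
    show "AE s in lborel. indicator {s. s0 \<le> s \<and> 0 < \<phi> s \<and> \<phi> s \<le> \<epsilon>} s * ennreal \<bar>D s\<bar> = ennreal \<bar>D s\<bar> * indicator {b..\<beta>} s"
      using AE_lborel_singleton[of b]
    proof eventually_elim
      case (elim s)
      have "s0 \<le> s \<and> 0 < \<phi> s \<and> \<phi> s \<le> \<epsilon> \<longleftrightarrow> s \<in> {b..\<beta>}"
      proof
        assume s: "s0 \<le> s \<and> 0 < \<phi> s \<and> \<phi> s \<le> \<epsilon>"
        then show "s \<in> {b..\<beta>}" using b(5)[of s] \<beta>(3)[of s] by force
      next
        assume s: "s \<in> {b..\<beta>}"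
        then have "b < s" using elim by simp
        then show "s0 \<le> s \<and> 0 < \<phi> s \<and> \<phi> s \<le> \<epsilon>"
          using b(1) b(4)[of s] mono[of s \<beta>] s \<beta>e by auto
      qed
      then show ?case by (auto simp: indicator_def)
    qed
  qed
  ultimately show ?thesis by simp
qed

text \<open>The part left of s0 is the right part for the reflected function; the common point s0
  has measure zero.\<close>

lemma nn_integral_convex_slope:
  fixes \<phi> D :: "real \<Rightarrow> real"
  assumes c: "convex_on UNIV \<phi>" "continuous_on UNIV \<phi>" and nn: "\<And>s. 0 \<le> \<phi> s"
    and D: "\<And>s. \<phi> s > 0 \<Longrightarrow> (\<phi> has_real_derivative D s) (at s)"
    and e: "\<epsilon> > 0" "\<phi> s0 \<le> \<epsilon>" and B: "\<And>s. \<phi> s \<le> \<epsilon> \<Longrightarrow> \<bar>s\<bar> \<le> B" and m: "\<And>s. \<phi> s0 \<le> \<phi> s"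
    and meas: "(\<lambda>s. indicator {s. 0 < \<phi> s \<and> \<phi> s \<le> \<epsilon>} s * ennreal \<bar>D s\<bar>) \<in> borel_measurable borel"
  shows "(\<integral>\<^sup>+s. indicator {s. 0 < \<phi> s \<and> \<phi> s \<le> \<epsilon>} s * ennreal \<bar>D s\<bar> \<partial>lborel) = ennreal (2 * (\<epsilon> - \<phi> s0))"
proof -
  let ?G = "\<lambda>s. indicator {s. 0 < \<phi> s \<and> \<phi> s \<le> \<epsilon>} s * ennreal \<bar>D s\<bar>"
  let ?GR = "\<lambda>s. indicator {s0..} s * ?G s" and ?GL = "\<lambda>s. indicator {..s0} s * ?G s"
  have "(\<integral>\<^sup>+s. ?GR s \<partial>lborel) = (\<integral>\<^sup>+s. indicator {s. s0 \<le> s \<and> 0 < \<phi> s \<and> \<phi> s \<le> \<epsilon>} s * ennreal \<bar>D s\<bar> \<partial>lborel)"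
    by (intro nn_integral_cong) (auto simp: indicator_def)
  also have "\<dots> = ennreal (\<epsilon> - \<phi> s0)"
    by (rule nn_integral_convex_slope_right[OF c nn D e B m])
  finally have R: "(\<integral>\<^sup>+s. ?GR s \<partial>lborel) = ennreal (\<epsilon> - \<phi> s0)" .
  have GL: "?GL \<in> borel_measurable borel" and GR: "?GR \<in> borel_measurable borel"
    by (rule borel_measurable_times_ennreal[OF _ meas], simp)+
  have "(\<integral>\<^sup>+s. ?GL s \<partial>lborel) = (\<integral>\<^sup>+s. ?GL s \<partial>distr lborel borel uminus)"
    by (simp add: lborel_distr_uminus)
  also have "\<dots> = (\<integral>\<^sup>+s. ?GL (- s) \<partial>lborel)"
    using GL by (intro nn_integral_distr) auto
  also have "\<dots> = (\<integral>\<^sup>+s. indicator {s. - s0 \<le> s \<and> 0 < \<phi> (- s) \<and> \<phi> (- s) \<le> \<epsilon>} s * ennreal \<bar>- D (- s)\<bar> \<partial>lborel)"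
    by (intro nn_integral_cong) (auto simp: indicator_def)
  also have "\<dots> = ennreal (\<epsilon> - \<phi> (- (- s0)))"
  proof (rule nn_integral_convex_slope_right[of "\<lambda>s. \<phi> (- s)"])
    show "convex_on UNIV (\<lambda>s. \<phi> (- s))"
    proof (rule convex_onI)
      fix t x y :: real assume "0 < t" "t < 1"
      then show "\<phi> (- ((1 - t) *\<^sub>R x + t *\<^sub>R y)) \<le> (1 - t) * \<phi> (- x) + t * \<phi> (- y)"
        using convex_onD[OF c(1), of t "- x" "- y"] by simp
    qed simp
    show "continuous_on UNIV (\<lambda>s. \<phi> (- s))" by (intro continuous_on_compose2[OF c(2)] continuous_intros) auto
    show "((\<lambda>s. \<phi> (- s)) has_real_derivative - D (- s)) (at s)" if "0 < \<phi> (- s)" for s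
    proof -
      have "((\<lambda>s. \<phi> (- s)) has_real_derivative D (- s) * (- 1)) (at s)"
        by (rule DERIV_chain2[where g = uminus, OF D[OF that]]) (auto intro!: derivative_eq_intros)
      then show ?thesis by simp
    qed
    show "\<bar>s\<bar> \<le> B" if "\<phi> (- s) \<le> \<epsilon>" for s using B[OF that] by simp
  qed (use nn e m in auto)
  finally have L: "(\<integral>\<^sup>+s. ?GL s \<partial>lborel) = ennreal (\<epsilon> - \<phi> s0)" by simp
  have "(\<integral>\<^sup>+s. ?G s \<partial>lborel) = (\<integral>\<^sup>+s. ?GR s + ?GL s \<partial>lborel)"
  proof (rule nn_integral_cong_AE)
    show "AE s in lborel. ?G s = ?GR s + ?GL s"
      using AE_lborel_singleton[of s0] by eventually_elim (auto simp: indicator_def)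
  qed
  also have "\<dots> = (\<integral>\<^sup>+s. ?GR s \<partial>lborel) + (\<integral>\<^sup>+s. ?GL s \<partial>lborel)"
    by (rule nn_integral_add) (simp_all only: measurable_lborel1 measurable_lborel2 GL GR)
  also have "\<dots> = ennreal (2 * (\<epsilon> - \<phi> s0))"
    unfolding R L using e by (simp add: ennreal_plus[symmetric] del: ennreal_plus)
  finally show ?thesis .
qed

section \<open>Slicing space into parallel lines\<close>

lemma lborel_distr_orthogonal:
  fixes R :: "real^3 \<Rightarrow> real^3"
  assumes R: "orthogonal_transformation R" shows "distr lborel borel R = lborel"
proof (rule lborel_eqI[symmetric])
  obtain g where g: "orthogonal_transformation g" "\<And>x. R (g x) = x" "\<And>x. g (R x) = x"
    by (metis R orthogonal_transformation_inv orthogonal_transformation_bij bij_inv_eq_iff)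
  have Rm: "R \<in> borel_measurable borel"
    using R by (intro borel_measurable_continuous_onI linear_continuous_on)
      (auto simp: orthogonal_transformation_def linear_linear)
  fix l u :: "real^3" assume lu: "\<And>b. b \<in> Basis \<Longrightarrow> l \<bullet> b \<le> u \<bullet> b"
  have pre: "R -` box l u = g ` box l u" using g(2,3) by (auto simp: image_iff) (metis g(3))
  have m: "box l u \<in> lmeasurable" by simp
  have "emeasure (distr lborel borel R) (box l u) = emeasure lborel (R -` box l u)"
    using Rm by (subst emeasure_distr) auto
  also have "\<dots> = emeasure lebesgue (g ` box l u)"
    using measurable_sets_borel[OF Rm, of "box l u"] unfolding pre by simp
  also have "\<dots> = ennreal (measure lebesgue (g ` box l u))"
    using measurable_orthogonal_image[OF g(1) m] by (simp add: emeasure_eq_measure2 fmeasurableD2)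
  also have "\<dots> = ennreal (measure lebesgue (box l u))"
    by (simp only: measure_orthogonal_image[OF g(1) m])
  also have "\<dots> = emeasure lborel (box l u)"
    using m by (simp add: emeasure_eq_measure2 fmeasurableD2)
  also have "\<dots> = (\<Prod>b\<in>Basis. (u - l) \<bullet> b)" using lu by simp
  finally show "emeasure (distr lborel borel R) (box l u) = (\<Prod>b\<in>Basis. (u - l) \<bullet> b)" .
qed simp

definition append_coordinate :: "(real^2) \<times> real \<Rightarrow> real^3" where
  "append_coordinate = (\<lambda>(y, s). vector [y $ 1, y $ 2, s])"

lemma append_coordinate_nth:
  "append_coordinate (y, s) $ 1 = y $ 1" "append_coordinate (y, s) $ 2 = y $ 2" "append_coordinate (y, s) $ 3 = s"
  by (simp_all add: append_coordinate_def vector_3)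

lemma measurable_append_coordinate: "append_coordinate \<in> borel_measurable (lborel \<Otimes>\<^sub>M lborel)"
proof -
  have "append_coordinate = (\<lambda>p. (fst p $ 1) *\<^sub>R axis 1 1 + (fst p $ 2) *\<^sub>R axis 2 1 + snd p *\<^sub>R axis 3 1)"
    by (auto simp: fun_eq_iff vec_eq_iff forall_3 append_coordinate_nth axis_def)
  also have "\<dots> \<in> borel_measurable borel"
    by (intro borel_measurable_continuous_onI continuous_intros)
  finally show ?thesis by (simp add: borel_prod[symmetric] cong: measurable_cong_sets)
qed

lemma lborel_distr_append_coordinate:
  "distr (lborel \<Otimes>\<^sub>M lborel) borel append_coordinate = lborel"
proof (rule lborel_eqI[symmetric])
  fix l u :: "real^3" assume lu: "\<And>b. b \<in> Basis \<Longrightarrow> l \<bullet> b \<le> u \<bullet> b"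
  have lu': "l $ i \<le> u $ i" for i using lu[of "axis i 1"] by (simp add: inner_axis)
  define l2 u2 :: "real^2" where "l2 = vector [l $ 1, l $ 2]" and "u2 = vector [u $ 1, u $ 2]"
  have l2: "l2 $ 1 = l $ 1" "l2 $ 2 = l $ 2" "u2 $ 1 = u $ 1" "u2 $ 2 = u $ 2"
    by (simp_all add: l2_def u2_def)
  have B2: "(Basis :: (real^2) set) = {axis 1 1, axis 2 1}" by (auto simp: Basis_vec_def UNIV_2)
  have "append_coordinate -` box l u = box l2 u2 \<times> {l $ 3<..<u $ 3}"
    by (auto simp: mem_box_cart forall_3 forall_2 append_coordinate_nth l2)
  then have "emeasure (distr (lborel \<Otimes>\<^sub>M lborel) borel append_coordinate) (box l u) = emeasure (lborel \<Otimes>\<^sub>M lborel) (box l2 u2 \<times> {l $ 3<..<u $ 3})"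
    using measurable_append_coordinate by (simp add: emeasure_distr space_pair_measure)
  also have "\<dots> = emeasure lborel (box l2 u2) * emeasure lborel {l $ 3<..<u $ 3}"
    by (intro lborel.emeasure_pair_measure_Times) auto
  also have "emeasure lborel (box l2 u2) = ennreal ((u $ 1 - l $ 1) * (u $ 2 - l $ 2))"
  proof -
    have "l2 \<bullet> b \<le> u2 \<bullet> b" if "b \<in> Basis" for b
      using that lu' unfolding B2 by (auto simp: inner_axis l2)
    then have "emeasure lborel (box l2 u2) = (\<Prod>b\<in>Basis. (u2 - l2) \<bullet> b)" by simp
    also have "\<dots> = ennreal ((u $ 1 - l $ 1) * (u $ 2 - l $ 2))"
      unfolding B2 by (simp add: axis_eq_axis inner_axis l2)
    finally show ?thesis .
  qed
  also have "emeasure lborel {l $ 3<..<u $ 3} = ennreal (u $ 3 - l $ 3)" using lu' by simp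
  also have "ennreal ((u $ 1 - l $ 1) * (u $ 2 - l $ 2)) * ennreal (u $ 3 - l $ 3) = (\<Prod>b\<in>Basis. (u - l) \<bullet> b)"
    unfolding Basis_3 using lu' by (simp add: axis_eq_axis inner_axis ennreal_mult[symmetric] mult.assoc)
  finally show "emeasure (distr (lborel \<Otimes>\<^sub>M lborel) borel append_coordinate) (box l u) = (\<Prod>b\<in>Basis. (u - l) \<bullet> b)" .
qed simp

text \<open>The map x -> f (x1, x2) + x3 u is orthogonal and so preserves Lebesgue measure. Composed
  with the splitting off of the third coordinate, it turns Fubini's theorem into integration over
  the lines parallel to u, indexed by a plane.\<close>

lemma nn_integral_along_lines:
  fixes G :: "real^3 \<Rightarrow> ennreal"
  assumes f: "plane_isometry u f" and u: "u \<in> S2" and G: "G \<in> borel_measurable borel"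
  shows "(\<integral>\<^sup>+x. G x \<partial>lborel) = (\<integral>\<^sup>+y. \<integral>\<^sup>+s. G (f y + s *\<^sub>R u) \<partial>lborel \<partial>lborel)"
    and "(\<lambda>y. \<integral>\<^sup>+s. G (f y + s *\<^sub>R u) \<partial>lborel) \<in> borel_measurable lborel"
proof -
  have lf: "linear f" and nf: "norm (f y) = norm y" and uf: "u \<bullet> f y = 0" for y
    using f unfolding plane_isometry_def by blast+
  have uu: "u \<bullet> u = 1" using u by (simp add: norm_eq_1)
  define R where "R x = f (vector [x $ 1, x $ 2]) + (x $ 3) *\<^sub>R u" for x :: "real^3"
  let ?F = append_coordinate
  have "linear R"
  proof (rule linearI)
    fix x y :: "real^3" and c :: real
    have "vector [(x + y) $ 1, (x + y) $ 2] = (vector [x $ 1, x $ 2] + vector [y $ 1, y $ 2] :: real^2)"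
      by (simp add: vec_eq_iff forall_2)
    then show "R (x + y) = R x + R y" by (simp add: R_def linear_add[OF lf] algebra_simps)
    have "vector [(c *\<^sub>R x) $ 1, (c *\<^sub>R x) $ 2] = (c *\<^sub>R vector [x $ 1, x $ 2] :: real^2)"
      by (simp add: vec_eq_iff forall_2)
    then show "R (c *\<^sub>R x) = c *\<^sub>R R x" by (simp add: R_def linear_scale[OF lf] algebra_simps)
  qed
  moreover have "norm (R x) = norm x" for x
  proof -
    let ?w = "vector [x $ 1, x $ 2] :: real^2"
    have "f ?w \<bullet> f ?w = ?w \<bullet> ?w" using nf[of ?w] by (simp add: norm_eq_sqrt_inner)
    then have "R x \<bullet> R x = ?w \<bullet> ?w + x $ 3 * x $ 3"
      unfolding R_def using uf[of ?w] by (simp add: inner_add inner_commute uu)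
    also have "\<dots> = x \<bullet> x" by (simp add: inner_vec_def sum_3 sum_2)
    finally show ?thesis by (simp add: norm_eq_sqrt_inner)
  qed
  ultimately have R: "orthogonal_transformation R" by (simp add: orthogonal_transformation)
  have RF: "R (?F (y, s)) = f y + s *\<^sub>R u" for y s
  proof -
    have "vector [?F (y, s) $ 1, ?F (y, s) $ 2] = y" "?F (y, s) $ 3 = s"
      by (simp_all add: vec_eq_iff forall_2 append_coordinate_nth)
    then show ?thesis by (simp add: R_def)
  qed
  have Rm: "R \<in> borel_measurable borel"
    using R by (intro borel_measurable_continuous_onI linear_continuous_on)
      (auto simp: orthogonal_transformation_def linear_linear)
  have GR: "(\<lambda>x. G (R x)) \<in> borel_measurable borel" by (rule measurable_compose[OF Rm G])
  have GRF: "(\<lambda>p. G (R (?F p))) \<in> borel_measurable (lborel \<Otimes>\<^sub>M lborel)" by (rule measurable_compose[OF measurable_append_coordinate GR])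
  have "(\<integral>\<^sup>+x. G x \<partial>lborel) = (\<integral>\<^sup>+x. G (R x) \<partial>lborel)"
    by (subst lborel_distr_orthogonal[OF R, symmetric], rule nn_integral_distr) (use Rm G in auto)
  also have "\<dots> = (\<integral>\<^sup>+p. G (R (?F p)) \<partial>(lborel \<Otimes>\<^sub>M lborel))"
    by (subst lborel_distr_append_coordinate[symmetric], subst nn_integral_distr)
      (use measurable_append_coordinate GR in simp_all)
  also have "\<dots> = (\<integral>\<^sup>+y. \<integral>\<^sup>+s. G (R (?F (y, s))) \<partial>lborel \<partial>lborel)"
    by (rule lborel.nn_integral_fst[OF GRF, symmetric])
  finally show "(\<integral>\<^sup>+x. G x \<partial>lborel) = (\<integral>\<^sup>+y. \<integral>\<^sup>+s. G (f y + s *\<^sub>R u) \<partial>lborel \<partial>lborel)"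
    unfolding RF .
  show "(\<lambda>y. \<integral>\<^sup>+s. G (f y + s *\<^sub>R u) \<partial>lborel) \<in> borel_measurable lborel"
    using lborel.borel_measurable_nn_integral_fst[OF GRF] unfolding RF .
qed

lemma band_in_sphere_borel: "{n \<in> S2. a \<le> \<bar>u \<bullet> n\<bar>} \<in> sets sphere_borel"
proof -
  have "closed ({n. norm n = 1} \<inter> {n. a \<le> \<bar>u \<bullet> n\<bar>})"
    by (intro closed_Int closed_Collect_eq closed_Collect_le continuous_intros)
  moreover have "{n. norm n = 1} \<inter> {n. a \<le> \<bar>u \<bullet> n\<bar>} = {n \<in> S2. a \<le> \<bar>u \<bullet> n\<bar>}" by auto
  ultimately show ?thesis by (auto simp: sets_sphere_borel borel_closed)
qed

section \<open>The thin shell around the body and its two limits\<close>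

context
  fixes K :: "(real^3) set" and S :: "(real^3) measure" and u :: "real^3" and f :: "real^2 \<Rightarrow> real^3"
  assumes Kb: "convex_body K" and SK: "surface_area_measure K S" and u: "u \<in> S2" and f: "plane_isometry u f"
begin

definition normal_dir :: "real^3 \<Rightarrow> real^3" where
  "normal_dir x = sgn (x - closest_point K x)"

definition shell :: "real \<Rightarrow> (real^3) set" where
  "shell e = {x. 0 < infdist x K \<and> infdist x K \<le> e}"

text \<open>Divided by e, its integral is evaluated in two ways as e tends to 0: by normal
  directions it gives the cosine transform of S at u, and along the lines parallel to u it gives
  twice the area of the shadow.\<close>

definition shell_density :: "real \<Rightarrow> real^3 \<Rightarrow> ennreal" where
  "shell_density e x = indicator (shell e) x * ennreal \<bar>u \<bullet> normal_dir x\<bar>"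

text \<open>By \<open>DERIV_infdist_line\<close> this is the total variation of the distance to K on
  the part of the line over \<open>y\<close> that runs in the shell.\<close>

definition line_mass :: "real \<Rightarrow> real^2 \<Rightarrow> ennreal" where
  "line_mass e y = (\<integral>\<^sup>+s. shell_density e (f y + s *\<^sub>R u) \<partial>lborel)"

text \<open>The projection of K in the coordinates of the isometry f. By \<open>shadow_iff\<close>
  it indexes the lines that meet K.\<close>

definition shadow :: "(real^2) set" where
  "shadow = f -` (\<lambda>x. x - (u \<bullet> x) *\<^sub>R u) ` K"

lemma body_facts: "compact K" "convex K" "K \<noteq> {}"
  using Kb by (auto simp: convex_body_def)

lemma norm_direction: "norm u = 1" using u by simp

lemma isometry_facts: "linear f" "norm (f y) = norm y" "u \<bullet> f y = 0" "range f = {x. u \<bullet> x = 0}"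
  using f unfolding plane_isometry_def by blast+

lemma measurable_normal_dir: "normal_dir \<in> borel_measurable borel"
proof -
  have "(\<lambda>x. x - closest_point K x) \<in> borel_measurable borel"
    by (intro borel_measurable_continuous_onI continuous_intros continuous_on_closest_point body_facts closed_body)
  then show ?thesis unfolding normal_dir_def[abs_def] sgn_div_norm by measurable
qed

lemma normal_dir_sphere: "0 < infdist x K \<Longrightarrow> normal_dir x \<in> S2"
  using infdist_closest_point[OF body_facts, of x] by (simp add: normal_dir_def norm_sgn)

lemma shell_borel: "shell e \<in> sets borel"
proof -
  have "(\<lambda>x. infdist x K) \<in> borel_measurable borel"
    by (intro borel_measurable_continuous_onI continuous_intros)
  then show ?thesis unfolding shell_def by measurable
qed

lemma measurable_shell_density: "shell_density e \<in> borel_measurable borel"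
  unfolding shell_density_def[abs_def]
  using shell_borel measurable_normal_dir by measurable

lemma shadow_iff: "y \<in> shadow \<longleftrightarrow> (\<exists>s. f y + s *\<^sub>R u \<in> K)"
proof
  assume "y \<in> shadow"
  then obtain x where "x \<in> K" "f y = x - (u \<bullet> x) *\<^sub>R u" unfolding shadow_def by auto
  then show "\<exists>s. f y + s *\<^sub>R u \<in> K" by (intro exI[of _ "u \<bullet> x"]) simp
next
  assume "\<exists>s. f y + s *\<^sub>R u \<in> K"
  then obtain s where s: "f y + s *\<^sub>R u \<in> K" by blast
  have "u \<bullet> (f y + s *\<^sub>R u) = s" using norm_direction by (simp add: inner_add isometry_facts norm_eq_1)
  then have "f y = (f y + s *\<^sub>R u) - (u \<bullet> (f y + s *\<^sub>R u)) *\<^sub>R u" by simp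
  then show "y \<in> shadow" using s unfolding shadow_def by blast
qed

lemma compact_shadow_image: "compact ((\<lambda>x. x - (u \<bullet> x) *\<^sub>R u) ` K)"
  by (intro compact_continuous_image continuous_intros body_facts)

lemma closed_shadow: "closed shadow"
  unfolding shadow_def
  by (intro continuous_closed_vimage compact_imp_closed compact_shadow_image)
     (use isometry_facts(1) in \<open>simp add: linear_linear linear_continuous_at\<close>)

lemma brightness_shadow: "brightness K u = measure lborel shadow"
proof -
  have "brightness K u = measure lebesgue shadow"
    unfolding brightness_def shadow_def by (rule plane_area_eq[OF f compact_shadow_image])
  then show ?thesis using closed_shadow by (simp add: borel_closed)
qed

lemma norm_le_infdist:
  assumes "\<And>x. x \<in> K \<Longrightarrow> norm x \<le> R" "infdist z K \<le> e" shows "norm z \<le> R + e"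
proof -
  have "norm z \<le> norm (closest_point K z) + norm (z - closest_point K z)"
    using norm_triangle_ineq[of "closest_point K z" "z - closest_point K z"] by simp
  also have "\<dots> \<le> R + e"
    using assms(1)[OF closest_point_in_set[OF closed_body[OF body_facts] body_facts(3)]] assms(2)
    by (intro add_mono) (simp_all add: infdist_closest_point[OF body_facts])
  finally show ?thesis .
qed

lemma norm_line_bounds:
  assumes R: "\<And>x. x \<in> K \<Longrightarrow> norm x \<le> R" and le: "infdist (f y + s *\<^sub>R u) K \<le> e"
  shows "\<bar>s\<bar> \<le> R + e" "norm y \<le> R + e"
proof -
  let ?z = "f y + s *\<^sub>R u"
  have z: "norm ?z \<le> R + e" by (rule norm_le_infdist[OF assms])
  have "\<bar>u \<bullet> ?z\<bar> \<le> norm ?z" using Cauchy_Schwarz_ineq2[of u ?z] norm_direction by simp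
  moreover have "u \<bullet> ?z = s" using norm_direction by (simp add: inner_add isometry_facts norm_eq_1)
  ultimately show "\<bar>s\<bar> \<le> R + e" using z by simp
  have "(norm y)\<^sup>2 \<le> (norm ?z)\<^sup>2"
    using norm_direction isometry_facts(2)[of y] unfolding power2_norm_eq_inner
    by (simp add: inner_add isometry_facts(3) inner_commute norm_eq_1 norm_eq_sqrt_inner)
  then have "norm y \<le> norm ?z" by (simp add: power2_le_iff_abs_le)
  then show "norm y \<le> R + e" using z by simp
qed

text \<open>The distance along the line has bounded sublevel sets, so it attains its minimum, and
  \<open>nn_integral_convex_slope\<close> expresses the mass by the minimal value alone. The upper
  bound, the value over the shadow and the vanishing elsewhere for small e are all read off from
  these two cases.\<close>

lemma line_mass_cases:
  assumes e: "e > 0"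
  obtains (miss) "\<forall>s. e < infdist (f y + s *\<^sub>R u) K" "line_mass e y = 0"
  | (hit) s0 where "infdist (f y + s0 *\<^sub>R u) K \<le> e" "\<forall>s. infdist (f y + s0 *\<^sub>R u) K \<le> infdist (f y + s *\<^sub>R u) K"
      "line_mass e y = ennreal (2 * (e - infdist (f y + s0 *\<^sub>R u) K))"
proof (cases "\<exists>s. infdist (f y + s *\<^sub>R u) K \<le> e")
  case False
  then have gt: "\<forall>s. e < infdist (f y + s *\<^sub>R u) K" by (simp add: not_le)
  moreover have "line_mass e y = 0"
    unfolding line_mass_def shell_density_def shell_def using gt by (simp add: not_le[symmetric])
  ultimately show ?thesis by (rule miss)
next
  case True
  let ?\<phi> = "\<lambda>s. infdist (f y + s *\<^sub>R u) K"
  obtain s1 where s1: "?\<phi> s1 \<le> e" using True by blast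
  obtain R where R: "\<And>x. x \<in> K \<Longrightarrow> norm x \<le> R" using compact_imp_bounded[OF body_facts(1)] unfolding bounded_iff by blast
  have B: "\<bar>s\<bar> \<le> R + e" if "?\<phi> s \<le> e" for s by (rule norm_line_bounds(1)[OF R that])
  have c: "continuous_on UNIV ?\<phi>" by (intro continuous_intros)
  obtain s0 where s0: "s0 \<in> {- (R + e)..R + e}" "\<And>s. s \<in> {- (R + e)..R + e} \<Longrightarrow> ?\<phi> s0 \<le> ?\<phi> s"
    using continuous_attains_inf[of "{- (R + e)..R + e}" ?\<phi>] continuous_on_subset[OF c] B[OF s1] by (force simp: abs_le_iff)
  have le: "?\<phi> s0 \<le> e" using s0(2)[of s1] B[OF s1] s1 by (simp add: abs_le_iff)
  have m: "?\<phi> s0 \<le> ?\<phi> s" for s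
  proof (cases "?\<phi> s \<le> e")
    case True then show ?thesis using B[OF True] s0(2)[of s] by (simp add: abs_le_iff)
  next
    case False then show ?thesis using le by simp
  qed
  have sd: "shell_density e (f y + s *\<^sub>R u) = indicator {s. 0 < ?\<phi> s \<and> ?\<phi> s \<le> e} s * ennreal \<bar>u \<bullet> normal_dir (f y + s *\<^sub>R u)\<bar>" for s
    by (simp add: shell_density_def shell_def indicator_def)
  have "(\<lambda>s. f y + s *\<^sub>R u) \<in> borel_measurable borel"
    by (intro borel_measurable_continuous_onI continuous_intros)
  from measurable_compose[OF this measurable_shell_density[of e]]
  have meas: "(\<lambda>s. indicator {s. 0 < ?\<phi> s \<and> ?\<phi> s \<le> e} s * ennreal \<bar>u \<bullet> normal_dir (f y + s *\<^sub>R u)\<bar>) \<in> borel_measurable borel"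
    unfolding sd .
  have "line_mass e y = ennreal (2 * (e - ?\<phi> s0))"
    unfolding line_mass_def sd
  proof (rule nn_integral_convex_slope[OF _ c _ _ e le B m meas])
    show "convex_on UNIV ?\<phi>" by (rule convex_on_infdist_line[OF body_facts])
    show "(?\<phi> has_real_derivative u \<bullet> normal_dir (f y + s *\<^sub>R u)) (at s)" if "0 < ?\<phi> s" for s
      unfolding normal_dir_def by (rule DERIV_infdist_line[OF body_facts norm_direction that])
  qed (rule infdist_nonneg)
  then show ?thesis using le m by (intro hit[of s0]) auto
qed

lemma line_mass_le: "e > 0 \<Longrightarrow> line_mass e y \<le> ennreal (2 * e)"
  by (rule line_mass_cases[of e y]) (auto intro!: ennreal_leI simp: infdist_nonneg)

lemma line_mass_shadow:
  assumes "e > 0" "y \<in> shadow" shows "line_mass e y = ennreal (2 * e)"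
proof -
  obtain s where "f y + s *\<^sub>R u \<in> K" using assms(2) by (auto simp: shadow_iff)
  then have s: "infdist (f y + s *\<^sub>R u) K = 0" by simp
  show ?thesis
  proof (rule line_mass_cases[of e y, OF assms(1)])
    assume "\<forall>s. e < infdist (f y + s *\<^sub>R u) K"
    then have "e < infdist (f y + s *\<^sub>R u) K" by blast
    then show ?thesis using s assms(1) by simp
  next
    fix s0
    assume hit: "\<forall>s. infdist (f y + s0 *\<^sub>R u) K \<le> infdist (f y + s *\<^sub>R u) K"
      "line_mass e y = ennreal (2 * (e - infdist (f y + s0 *\<^sub>R u) K))"
    then have "infdist (f y + s0 *\<^sub>R u) K = 0" using hit(1)[rule_format, of s] s infdist_nonneg[of "f y + s0 *\<^sub>R u" K] by simp
    then show ?thesis using hit(2) by simp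
  qed
qed

text \<open>K is closed and the minimum is attained whenever the line comes near K, so a line that
  misses K keeps a positive distance from it.\<close>

lemma line_mass_eventually_0:
  assumes "y \<notin> shadow" shows "\<exists>e0>0. \<forall>e. 0 < e \<and> e < e0 \<longrightarrow> line_mass e y = 0"
proof -
  have "\<exists>e0>0. \<forall>s. e0 \<le> infdist (f y + s *\<^sub>R u) K"
  proof (rule line_mass_cases[of 1 y, OF zero_less_one])
    assume "\<forall>s. 1 < infdist (f y + s *\<^sub>R u) K"
    then show ?thesis by (intro exI[of _ 1]) (auto intro: less_imp_le)
  next
    fix s0
    assume hit: "\<forall>s. infdist (f y + s0 *\<^sub>R u) K \<le> infdist (f y + s *\<^sub>R u) K"
    have "infdist (f y + s0 *\<^sub>R u) K \<noteq> 0"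
      using assms in_closed_iff_infdist_zero[OF closed_body[OF body_facts] body_facts(3)] by (auto simp: shadow_iff)
    then have "0 < infdist (f y + s0 *\<^sub>R u) K" using infdist_nonneg[of "f y + s0 *\<^sub>R u" K] by simp
    then show ?thesis using hit by blast
  qed
  then obtain e0 where e0: "e0 > 0" "\<And>s. e0 \<le> infdist (f y + s *\<^sub>R u) K" by blast
  have "line_mass e y = 0" if e: "0 < e" "e < e0" for e
  proof (rule line_mass_cases[of e y, OF e(1)])
    fix s0 assume "infdist (f y + s0 *\<^sub>R u) K \<le> e"
    then show ?thesis using e0(2)[of s0] e(2) by simp
  qed
  then show ?thesis using e0(1) by blast
qed

text \<open>A sequence, because dominated convergence is sequential. The reciprocal of
  \<open>eps_seq n\<close> is \<open>Suc n\<close>, which avoids division in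
  \<open>ennreal\<close>.\<close>

definition eps_seq :: "nat \<Rightarrow> real" where "eps_seq n = inverse (real (Suc n))"

lemma eps_seq_facts: "0 < eps_seq n" "eps_seq n \<le> 1" "real (Suc n) * eps_seq n = 1" "eps_seq \<longlonglongrightarrow> 0"
  using LIMSEQ_inverse_real_of_nat unfolding eps_seq_def by (auto simp: field_simps)

text \<open>Line by line the scaled mass equals 2 over the shadow and is eventually 0 elsewhere. It
  never exceeds 2 and vanishes beyond radius R + 1, because \<open>eps_seq n\<close> \<le> 1; so
  dominated convergence applies over the plane.\<close>

lemma shell_mass_limit:
  "(\<lambda>n. ennreal (Suc n) * (\<integral>\<^sup>+x. shell_density (eps_seq n) x \<partial>lborel)) \<longlonglongrightarrow> ennreal (2 * measure lborel shadow)"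
proof -
  obtain R where R: "\<And>x. x \<in> K \<Longrightarrow> norm x \<le> R" using compact_imp_bounded[OF body_facts(1)] unfolding bounded_iff by blast
  have mm: "line_mass e \<in> borel_measurable lborel" for e
    unfolding line_mass_def[abs_def] by (rule nn_integral_along_lines(2)[OF f u measurable_shell_density])
  have sb: "shadow \<in> sets borel" using closed_shadow by (rule borel_closed)
  have far: "line_mass (eps_seq n) y = 0" if "norm y > R + 1" for n y
  proof (rule line_mass_cases[of "eps_seq n" y, OF eps_seq_facts(1)])
    fix s0 assume "infdist (f y + s0 *\<^sub>R u) K \<le> eps_seq n"
    from norm_line_bounds(2)[OF R this] show ?thesis using eps_seq_facts(2)[of n] that by simp
  qed
  have sub: "shadow \<subseteq> cball 0 (R + 1)"
  proof
    fix y assume "y \<in> shadow"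
    then have "line_mass (eps_seq 0) y = ennreal (2 * eps_seq 0)" using line_mass_shadow eps_seq_facts(1) by blast
    then have "line_mass (eps_seq 0) y \<noteq> 0" using eps_seq_facts(1)[of 0] by simp
    then show "y \<in> cball 0 (R + 1)" using far[of y 0] by (auto simp: not_less[symmetric])
  qed
  have fin: "emeasure lborel (cball (0::real^2) (R + 1)) < \<infinity>" by (rule emeasure_lborel_cball_finite)
  have "(\<lambda>n. \<integral>\<^sup>+y. ennreal (Suc n) * line_mass (eps_seq n) y \<partial>lborel) \<longlonglongrightarrow> (\<integral>\<^sup>+y. 2 * indicator shadow y \<partial>lborel)"
  proof (rule nn_integral_dominated_convergence[where w = "\<lambda>y. 2 * indicator (cball 0 (R + 1)) y"])
    show "(\<lambda>y. ennreal (Suc n) * line_mass (eps_seq n) y) \<in> borel_measurable lborel" for n using mm by measurable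
    show "AE y in lborel. ennreal (Suc n) * line_mass (eps_seq n) y \<le> 2 * indicator (cball 0 (R + 1)) y" for n
    proof (rule AE_I2)
      fix y
      have "ennreal (Suc n) * line_mass (eps_seq n) y \<le> ennreal (Suc n) * ennreal (2 * eps_seq n)"
        by (intro mult_left_mono line_mass_le eps_seq_facts(1)) simp
      also have "\<dots> = ennreal (2 * (real (Suc n) * eps_seq n))"
        using eps_seq_facts(1)[of n] by (simp add: ennreal_mult[symmetric] less_imp_le mult_ac del: of_nat_Suc)
      also have "\<dots> = 2" unfolding eps_seq_facts(3) by simp
      finally have "ennreal (Suc n) * line_mass (eps_seq n) y \<le> 2" .
      then show "ennreal (Suc n) * line_mass (eps_seq n) y \<le> 2 * indicator (cball 0 (R + 1)) y"
        using far[of y n] by (auto simp: indicator_def not_less[symmetric])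
    qed
    show "(\<integral>\<^sup>+y. 2 * indicator (cball 0 (R + 1)) y \<partial>(lborel :: (real^2) measure)) < \<infinity>"
      using fin by (simp add: nn_integral_cmult_indicator ennreal_mult_less_top)
    show "AE y in lborel. (\<lambda>n. ennreal (Suc n) * line_mass (eps_seq n) y) \<longlonglongrightarrow> 2 * indicator shadow y"
    proof (rule AE_I2)
      fix y
      show "(\<lambda>n. ennreal (Suc n) * line_mass (eps_seq n) y) \<longlonglongrightarrow> 2 * indicator shadow y"
      proof (cases "y \<in> shadow")
        case True
        have "ennreal (Suc n) * line_mass (eps_seq n) y = 2" for n
        proof -
          have "ennreal (Suc n) * line_mass (eps_seq n) y = ennreal (2 * (real (Suc n) * eps_seq n))"
            unfolding line_mass_shadow[OF eps_seq_facts(1) True] using eps_seq_facts(1)[of n]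
            by (simp add: ennreal_mult[symmetric] less_imp_le mult_ac del: of_nat_Suc)
          then show ?thesis unfolding eps_seq_facts(3) by simp
        qed
        then show ?thesis using True by simp
      next
        case False
        obtain e0 where e0: "e0 > 0" "\<And>e. 0 < e \<Longrightarrow> e < e0 \<Longrightarrow> line_mass e y = 0"
          using line_mass_eventually_0[OF False] by blast
        have "\<forall>\<^sub>F n in sequentially. eps_seq n < e0" using order_tendstoD(2)[OF eps_seq_facts(4) e0(1)] .
        then have "\<forall>\<^sub>F n in sequentially. ennreal (Suc n) * line_mass (eps_seq n) y = 0"
          by eventually_elim (simp add: e0(2) eps_seq_facts(1))
        then show ?thesis using False by (simp add: tendsto_eventually)
      qed
    qed
  qed (use sb in \<open>auto intro!: borel_measurable_times_ennreal borel_measurable_indicator\<close>)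
  moreover have "(\<integral>\<^sup>+y. ennreal (Suc n) * line_mass (eps_seq n) y \<partial>lborel) = ennreal (Suc n) * (\<integral>\<^sup>+x. shell_density (eps_seq n) x \<partial>lborel)" for n
    unfolding nn_integral_along_lines(1)[OF f u measurable_shell_density] line_mass_def[symmetric]
    by (rule nn_integral_cmult[OF mm])
  moreover have "(\<integral>\<^sup>+y. 2 * indicator shadow y \<partial>lborel) = ennreal (2 * measure lborel shadow)"
  proof -
    have "emeasure lborel shadow \<noteq> \<infinity>"
      using emeasure_mono[OF sub, of lborel] fin by (auto simp: top_unique)
    then have "emeasure lborel shadow = ennreal (measure lborel shadow)" by (simp add: emeasure_eq_ennreal_measure)
    then show ?thesis using sb by (simp add: nn_integral_cmult_indicator ennreal_mult)
  qed
  ultimately show ?thesis by simp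
qed

lemma sets_surface_measure: "sets S = sets sphere_borel" and finite_surface_measure: "finite_measure S"
  using SK by (auto simp: surface_area_measure_def)

lemma surface_limit:
  assumes "E \<in> sets sphere_borel"
  shows "(\<lambda>n. real (Suc n) * measure lebesgue (local_parallel_set K E (eps_seq n))) \<longlonglongrightarrow> measure S E"
proof -
  have "((\<lambda>\<epsilon>. measure lebesgue (local_parallel_set K E \<epsilon>) / \<epsilon>) \<longlongrightarrow> measure S E) (at_right 0)"
    using SK assms by (auto simp: surface_area_measure_def)
  moreover have "filterlim eps_seq (at_right 0) sequentially"
  proof -
    have "eps_seq n \<noteq> 0" for n using eps_seq_facts(1)[of n] by simp
    then show ?thesis using eps_seq_facts(1,4) by (simp add: filterlim_at)
  qed
  ultimately have "(\<lambda>n. measure lebesgue (local_parallel_set K E (eps_seq n)) / eps_seq n) \<longlonglongrightarrow> measure S E"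
    by (rule filterlim_compose)
  then show ?thesis by (simp add: eps_seq_def divide_inverse mult.commute)
qed

lemma measure_local_parallel_set:
  assumes "E \<in> sets sphere_borel"
  shows "local_parallel_set K E e = {x \<in> shell e. normal_dir x \<in> E}"
    "measure lebesgue (local_parallel_set K E e) = measure (restrict_space lborel (shell e)) {x \<in> shell e. normal_dir x \<in> E}"
proof -
  show eq: "local_parallel_set K E e = {x \<in> shell e. normal_dir x \<in> E}"
    by (auto simp: local_parallel_set_def shell_def normal_dir_def)
  have "E \<in> sets borel" using assms by (simp add: sets_sphere_borel)
  then have "normal_dir -` E \<in> sets borel" using measurable_sets_borel[OF measurable_normal_dir] by simp
  then have "shell e \<inter> normal_dir -` E \<in> sets borel" using shell_borel by blast
  moreover have "shell e \<inter> normal_dir -` E = {x \<in> shell e. normal_dir x \<in> E}" by auto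
  ultimately have "{x \<in> shell e. normal_dir x \<in> E} \<in> sets borel" by simp
  then show "measure lebesgue (local_parallel_set K E e) = measure (restrict_space lborel (shell e)) {x \<in> shell e. normal_dir x \<in> E}"
    unfolding eq using shell_borel by (subst measure_restrict_space) auto
qed

lemma finite_shell: "finite_measure (restrict_space lborel (shell e))"
proof (rule finite_measureI)
  obtain R where R: "\<And>x. x \<in> K \<Longrightarrow> norm x \<le> R" using compact_imp_bounded[OF body_facts(1)] unfolding bounded_iff by blast
  have "shell e \<subseteq> cball 0 (R + e)" using norm_le_infdist[OF R] by (auto simp: shell_def)
  then have "emeasure lborel (shell e) \<le> emeasure lborel (cball (0::real^3) (R + e))" by (intro emeasure_mono) auto
  also have "\<dots> < \<infinity>" by (rule emeasure_lborel_cball_finite)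
  finally show "emeasure (restrict_space lborel (shell e)) (space (restrict_space lborel (shell e))) \<noteq> \<infinity>"
    using shell_borel by (simp add: space_restrict_space emeasure_restrict_space)
qed

text \<open>Rounding |u . n| down to multiples of 1 / N gives the same kind of sum for the shell and
  for S, with the bands \<open>E i N\<close> as sets. The limit in n is taken first, at fixed N, and
  leaves an error of total mass / N; after that N is arbitrary.\<close>

lemma brightness_cosine_transform_aux: "2 * measure lborel shadow = cosine_transform S u"
proof -
  define J where "J n = (\<integral>x. \<bar>u \<bullet> normal_dir x\<bar> \<partial>restrict_space lborel (shell (eps_seq n)))" for n
  define E where "E i N = {n \<in> S2. real i / real N \<le> \<bar>u \<bullet> n\<bar>}" for i N :: nat
  have Em: "E i N \<in> sets sphere_borel" for i N unfolding E_def by (rule band_in_sphere_borel)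
  have S2m: "S2 \<in> sets sphere_borel" using sets.top[of sphere_borel] by simp
  have um: "(\<lambda>x. \<bar>u \<bullet> normal_dir x\<bar>) \<in> borel_measurable borel" using measurable_normal_dir by measurable
  have um': "(\<lambda>x. \<bar>u \<bullet> normal_dir x\<bar>) \<in> borel_measurable (restrict_space lborel (shell e))" for e
    by (rule measurable_restrict_space1) (use um in simp)
  have sp: "space (restrict_space lborel (shell e)) = shell e" for e by (simp add: space_restrict_space)
  have abs1: "\<bar>u \<bullet> n\<bar> \<le> 1" if "n \<in> S2" for n using Cauchy_Schwarz_ineq2[of u n] that norm_direction by simp
  have h1: "0 \<le> \<bar>u \<bullet> normal_dir x\<bar> \<and> \<bar>u \<bullet> normal_dir x\<bar> \<le> 1" if "x \<in> space (restrict_space lborel (shell e))" for x e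
  proof -
    have "x \<in> shell e" using that by (simp only: sp)
    then show ?thesis using abs1[OF normal_dir_sphere, of x] by (simp add: shell_def)
  qed
  have J0: "0 \<le> J n" for n unfolding J_def by (rule Bochner_Integration.integral_nonneg) simp
  have nnJ: "(\<integral>\<^sup>+x. shell_density (eps_seq n) x \<partial>lborel) = ennreal (J n)" for n
  proof -
    have i: "integrable (restrict_space lborel (shell (eps_seq n))) (\<lambda>x. \<bar>u \<bullet> normal_dir x\<bar>)"
      by (rule finite_measure.integrable_const_bound[OF finite_shell, of _ 1]) (use h1 um' in auto)
    have "(\<integral>\<^sup>+x. shell_density (eps_seq n) x \<partial>lborel) = (\<integral>\<^sup>+x. ennreal \<bar>u \<bullet> normal_dir x\<bar> \<partial>restrict_space lborel (shell (eps_seq n)))"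
      using shell_borel by (simp add: nn_integral_restrict_space shell_density_def mult.commute)
    also have "\<dots> = ennreal (J n)" unfolding J_def by (rule nn_integral_eq_integral[OF i]) simp
    finally show ?thesis .
  qed
  have "(\<lambda>n. ennreal (real (Suc n) * J n)) \<longlonglongrightarrow> ennreal (2 * measure lborel shadow)"
    using shell_mass_limit unfolding nnJ by (simp add: ennreal_mult J0 del: of_nat_Suc)
  then have Jlim: "(\<lambda>n. real (Suc n) * J n) \<longlonglongrightarrow> 2 * measure lborel shadow"
    by (rule tendsto_ennrealD) (auto simp: J0)
  \<comment> \<open>The quotient volume / \<epsilon> of the local parallel set along
    \<open>eps_seq\<close>; its limit is the mass that S gives to \<open>A\<close>.\<close>
  define T where "T A n = real (Suc n) * measure lebesgue (local_parallel_set K A (eps_seq n))" for A n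
  have T: "T A \<longlonglongrightarrow> measure S A" if "A \<in> sets sphere_borel" for A
    unfolding T_def[abs_def] by (rule surface_limit[OF that])
  have band: "{x \<in> space (restrict_space lborel (shell e)). real i / real N \<le> \<bar>u \<bullet> normal_dir x\<bar>} = {x \<in> shell e. normal_dir x \<in> E i N}" for e i N
    unfolding sp using normal_dir_sphere by (auto simp: E_def shell_def)
  have whole: "shell e = {x \<in> shell e. normal_dir x \<in> S2}" for e
    using normal_dir_sphere by (auto simp: shell_def)
  have lo: "(\<Sum>i=1..N. T (E i N) n) / real N \<le> real (Suc n) * J n"
    and hi: "real (Suc n) * J n \<le> (\<Sum>i=1..N. T (E i N) n) / real N + T S2 n / real N" if N: "1 \<le> N" for N n
  proof -
    have m: "measure (restrict_space lborel (shell (eps_seq n))) {x \<in> shell (eps_seq n). normal_dir x \<in> E i N} =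
        measure lebesgue (local_parallel_set K (E i N) (eps_seq n))" for i
      by (rule measure_local_parallel_set(2)[OF Em, symmetric])
    have m2: "measure (restrict_space lborel (shell (eps_seq n))) (space (restrict_space lborel (shell (eps_seq n)))) = measure lebesgue (local_parallel_set K S2 (eps_seq n))"
      unfolding sp measure_local_parallel_set(2)[OF S2m] using whole[of "eps_seq n"] by simp
    have hn: "0 \<le> \<bar>u \<bullet> normal_dir x\<bar> \<and> \<bar>u \<bullet> normal_dir x\<bar> \<le> 1"
      if "x \<in> space (restrict_space lborel (shell (eps_seq n)))" for x by (rule h1[OF that])
    have lc: "(\<Sum>i=1..N. measure lebesgue (local_parallel_set K (E i N) (eps_seq n))) / real N \<le> J n"
      "J n \<le> (\<Sum>i=1..N. measure lebesgue (local_parallel_set K (E i N) (eps_seq n))) / real N +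
        measure lebesgue (local_parallel_set K S2 (eps_seq n)) / real N"
      using layer_cake_bounds[OF finite_shell[of "eps_seq n"] um' hn N] by (simp_all only: band m m2 J_def)
    have "real (Suc n) * ((\<Sum>i=1..N. measure lebesgue (local_parallel_set K (E i N) (eps_seq n))) / real N) \<le> real (Suc n) * J n"
      by (rule mult_left_mono[OF lc(1)]) (rule of_nat_0_le_iff)
    then show "(\<Sum>i=1..N. T (E i N) n) / real N \<le> real (Suc n) * J n"
      unfolding T_def sum_distrib_left[symmetric] by simp
    have "real (Suc n) * J n \<le> real (Suc n) * ((\<Sum>i=1..N. measure lebesgue (local_parallel_set K (E i N) (eps_seq n))) / real N +
        measure lebesgue (local_parallel_set K S2 (eps_seq n)) / real N)"
      by (rule mult_left_mono[OF lc(2)]) (rule of_nat_0_le_iff)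
    then show "real (Suc n) * J n \<le> (\<Sum>i=1..N. T (E i N) n) / real N + T S2 n / real N"
      unfolding T_def sum_distrib_left[symmetric] distrib_left by simp
  qed
  have spS: "space S = S2" using sets_eq_imp_space_eq[OF sets_surface_measure] by simp
  have uS: "(\<lambda>n. \<bar>u \<bullet> n\<bar>) \<in> borel_measurable S"
    unfolding measurable_cong_sets[OF sets_surface_measure refl]
    by (intro borel_measurable_sphere_continuous continuous_intros)
  have "2 * measure lborel shadow - cosine_transform S u = 0"
  proof (rule abs_le_div_nat_imp_0)
    fix N :: nat assume N: "1 \<le> N"
    have s: "(\<lambda>n. (\<Sum>i=1..N. T (E i N) n) / real N) \<longlonglongrightarrow> (\<Sum>i=1..N. measure S (E i N)) / real N"
      by (intro tendsto_divide tendsto_sum T Em tendsto_const) (use N in simp)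
    have t: "(\<lambda>n. T S2 n / real N) \<longlonglongrightarrow> measure S S2 / real N"
      by (intro tendsto_divide T S2m tendsto_const) (use N in simp)
    have 1: "(\<Sum>i=1..N. measure S (E i N)) / real N \<le> 2 * measure lborel shadow"
      by (rule LIMSEQ_le[OF s Jlim]) (use lo[OF N] in blast)
    have 2: "2 * measure lborel shadow \<le> (\<Sum>i=1..N. measure S (E i N)) / real N + measure S S2 / real N"
      by (rule LIMSEQ_le[OF Jlim tendsto_add[OF s t]]) (use hi[OF N] in blast)
    have hS: "0 \<le> \<bar>u \<bullet> n\<bar> \<and> \<bar>u \<bullet> n\<bar> \<le> 1" if "n \<in> space S" for n using abs1 that spS by simp
    have lc: "(\<Sum>i=1..N. measure S (E i N)) / real N \<le> cosine_transform S u"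
      "cosine_transform S u \<le> (\<Sum>i=1..N. measure S (E i N)) / real N + measure S S2 / real N"
      using layer_cake_bounds[OF finite_surface_measure uS hS N] by (simp_all only: spS E_def cosine_transform_def)
    show "\<bar>2 * measure lborel shadow - cosine_transform S u\<bar> \<le> measure S S2 / real N"
      using 1 2 lc unfolding abs_le_iff by (intro conjI) linarith+
  qed
  then show ?thesis by simp
qed

end

lemma brightness_cosine_transform:
  assumes "convex_body K" "surface_area_measure K S" "u \<in> S2"
  shows "brightness K u = 1 / 2 * cosine_transform S u"
proof -
  obtain f where f: "plane_isometry u f" using plane_isometry_exists[OF assms(3)] by blast
  show ?thesis
    using brightness_shadow[OF assms f] brightness_cosine_transform_aux[OF assms f] by simp
qed

section \<open>Cosine transforms of even parts\<close>

lemma sets_even_part [simp]: "sets (even_part \<nu>) = sets \<nu>"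
  by (simp add: even_part_def)

lemma finite_measure_even_part:
  assumes \<nu>: "sets \<nu> = sets sphere_borel" "finite_measure \<nu>" shows "finite_measure (even_part \<nu>)"
proof (rule finite_measureI)
  interpret finite_measure \<nu> by fact
  have "space (even_part \<nu>) = space \<nu>" by (rule sets_eq_imp_space_eq) simp
  moreover have "emeasure (even_part \<nu>) (space \<nu>) = (emeasure \<nu> (space \<nu>) + emeasure \<nu> (uminus ` space \<nu>)) / 2"
    by (rule emeasure_even_part[OF \<nu>(1)]) simp
  ultimately show "emeasure (even_part \<nu>) (space (even_part \<nu>)) \<noteq> \<infinity>"
    by (simp add: ennreal_divide_eq_top_iff)
qed

text \<open>\<open>even_part\<close> is known set by set. The bands are symmetric, and on symmetric
  sets the even part has the same measure, so both transforms lie within total mass / N above the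
  same layer sum.\<close>

lemma cosine_transform_even_part:
  assumes \<nu>: "sets \<nu> = sets sphere_borel" "finite_measure \<nu>" and u: "u \<in> S2"
  shows "cosine_transform (even_part \<nu>) u = cosine_transform \<nu> u"
proof -
  interpret finite_measure \<nu> by fact
  have fe: "finite_measure (even_part \<nu>)" by (rule finite_measure_even_part[OF \<nu>])
  have se: "sets (even_part \<nu>) = sets sphere_borel" using \<nu>(1) by simp
  have sp: "space \<nu> = S2" "space (even_part \<nu>) = S2"
    using sets_eq_imp_space_eq[OF \<nu>(1)] sets_eq_imp_space_eq[OF se] by simp_all
  have same: "measure (even_part \<nu>) E = measure \<nu> E" if "E \<in> sets \<nu>" "uminus ` E = E" for E
  proof -
    have "emeasure (even_part \<nu>) E = ennreal ((measure \<nu> E + measure \<nu> E) / 2)"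
      unfolding emeasure_even_part[OF \<nu>(1) that(1)] that(2) emeasure_eq_measure
      by (simp add: divide_ennreal ennreal_plus[symmetric] ennreal_numeral[symmetric] del: ennreal_plus ennreal_numeral)
    then show ?thesis by (simp add: measure_def)
  qed
  have S2: "S2 \<in> sets \<nu>" "uminus ` S2 = S2"
  proof -
    show "S2 \<in> sets \<nu>" using sets.top[of \<nu>] sp by simp
    show "uminus ` S2 = S2"
    proof (intro equalityI subsetI)
      fix n assume "n \<in> S2"
      then show "n \<in> uminus ` S2" by (intro image_eqI[of _ _ "- n"]) auto
    qed auto
  qed
  have band: "{n \<in> S2. a \<le> \<bar>u \<bullet> n\<bar>} \<in> sets \<nu>" for a
    unfolding \<nu>(1) by (rule band_in_sphere_borel)
  have sym: "uminus ` {n \<in> S2. a \<le> \<bar>u \<bullet> n\<bar>} = {n \<in> S2. a \<le> \<bar>u \<bullet> n\<bar>}" for a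
  proof (intro equalityI subsetI)
    fix n assume "n \<in> {n \<in> S2. a \<le> \<bar>u \<bullet> n\<bar>}"
    then show "n \<in> uminus ` {n \<in> S2. a \<le> \<bar>u \<bullet> n\<bar>}" by (intro image_eqI[of _ _ "- n"]) auto
  qed auto
  have um: "(\<lambda>n. \<bar>u \<bullet> n\<bar>) \<in> borel_measurable sphere_borel"
    by (intro borel_measurable_sphere_continuous continuous_intros)
  have h: "0 \<le> \<bar>u \<bullet> n\<bar> \<and> \<bar>u \<bullet> n\<bar> \<le> 1" if "n \<in> S2" for n
    using Cauchy_Schwarz_ineq2[of u n] that u by simp
  have "cosine_transform (even_part \<nu>) u - cosine_transform \<nu> u = 0"
  proof (rule abs_le_div_nat_imp_0)
    fix N :: nat assume N: "1 \<le> N"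
    note 1 = layer_cake_bounds[OF \<nu>(2) um[folded measurable_cong_sets[OF \<nu>(1) refl]] _ N, unfolded sp, OF h, folded cosine_transform_def]
    note 2 = layer_cake_bounds[OF fe um[folded measurable_cong_sets[OF se refl]] _ N, unfolded sp, OF h, unfolded same[OF band sym] same[OF S2], folded cosine_transform_def]
    show "\<bar>cosine_transform (even_part \<nu>) u - cosine_transform \<nu> u\<bar> \<le> measure \<nu> S2 / real N"
      using 1 2 unfolding abs_le_iff by linarith
  qed
  then show ?thesis by simp
qed

theorem theorem6p12:
  fixes M :: "'a measure" and U :: "'a \<Rightarrow> real^3"
    and Y :: "nat \<Rightarrow> int \<Rightarrow> real^3 \<Rightarrow> complex"
  assumes "prob_space M"
    and "U \<in> measurable M sphere_borel"
    and "distr M sphere_borel U = sphere_measure"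
    and "orthonormal_harmonics Y"
  shows "abs_coeff 0 = 1 / 2 \<and>
    (\<forall>l. odd l \<longrightarrow> abs_coeff l = 0) \<and>
    (\<forall>j::nat. j \<ge> 1 \<longrightarrow> abs_coeff (2 * j) =
        (-1) ^ (j - 1) * of_int (double_factorial (2 * int j - 3))
          / of_int (double_factorial (2 * int j + 2))) \<and>
    abs_coeff 2 = 1 / 8 \<and> abs_coeff 4 = - 1 / 48 \<and>
    abs_coeff 6 = 1 / 128 \<and> abs_coeff 8 = - 1 / 256 \<and>
    (\<forall>Z \<mu>. zonoid Z \<and> generating_measure Z \<mu> \<longrightarrow>
      ((\<lambda>j. (abs_coeff (2 * j))\<^sup>2 *
          (\<Sum>m = - int (2 * j)..int (2 * j). (cmod (harmonic_coeff Y \<mu> (2 * j) m))\<^sup>2))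
        has_sum prob_space.variance M (\<lambda>\<omega>. width Z (U \<omega>))) {1..}) \<and>
    (\<forall>K S. convex_body K \<and> surface_area_measure K S \<longrightarrow>
      ((\<lambda>j. 1 / 4 * ((abs_coeff (2 * j))\<^sup>2 *
          (\<Sum>m = - int (2 * j)..int (2 * j).
             (cmod (harmonic_coeff Y (even_part S) (2 * j) m))\<^sup>2)))
        has_sum prob_space.variance M (\<lambda>\<omega>. brightness K (U \<omega>))) {1..}) \<and>
    (\<forall>n'\<in>S2.
      (\<lambda>N. \<integral>n. (kernel2 \<bar>n \<bullet> n'\<bar> -
          (\<Sum>j = 1..N. real (4 * j + 1) * (abs_coeff (2 * j))\<^sup>2 *
             poly (legendre (2 * j)) (n \<bullet> n')))\<^sup>2 \<partial>sphere_measure)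
        \<longlonglongrightarrow> 0) \<and>
    (\<forall>L Z \<mu>. even L \<and> L \<ge> 2 \<and> zonoid Z \<and> generating_measure Z \<mu> \<longrightarrow>
      (\<Sum>l \<in> {l. 2 \<le> l \<and> l \<le> L \<and> even l}.
          \<Sum>m = - int l..int l. (cmod (harmonic_coeff Y \<mu> l m))\<^sup>2)
        \<le> prob_space.variance M (\<lambda>\<omega>. width Z (U \<omega>)) /
          Min ((\<lambda>l. \<bar>abs_coeff l\<bar>\<^sup>2) ` {l. 2 \<le> l \<and> l \<le> L \<and> even l})) \<and>
    (\<lambda>j. abs_coeff (2 * j)) \<longlonglongrightarrow> 0 \<and>
    \<not> (\<exists>C::real. \<forall>Z \<mu>. zonoid Z \<and> generating_measure Z \<mu> \<longrightarrow>
      (\<Sum>\<^sub>\<infinity>l \<in> {l. 2 \<le> l \<and> even l}.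
          ennreal (\<Sum>m = - int l..int l. (cmod (harmonic_coeff Y \<mu> l m))\<^sup>2))
        \<le> ennreal (C * prob_space.variance M (\<lambda>\<omega>. width Z (U \<omega>))))"
proof -
  note M = assms(1) and U = assms(2) and UM = assms(3) and Y = assms(4)
  let ?V = "\<lambda>X. prob_space.variance M (\<lambda>\<omega>. X (U \<omega>))"
  have width: "((\<lambda>j. (abs_coeff (2 * j))\<^sup>2 *
          (\<Sum>m = - int (2 * j)..int (2 * j). (cmod (harmonic_coeff Y \<mu> (2 * j) m))\<^sup>2))
        has_sum ?V (width Z)) {1..}"
    if Z: "generating_measure Z \<mu>" for Z \<mu>
  proof -
    have \<mu>: "sets \<mu> = sets sphere_borel" "finite_measure \<mu>"
      and w: "\<And>u. u \<in> S2 \<Longrightarrow> width Z u = cosine_transform \<mu> u"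
      using Z by (auto simp: generating_measure_def cosine_transform_def)
    have v: "?V (width Z) = (\<integral>u. (cosine_transform \<mu> u)\<^sup>2 \<partial>sphere_measure) - (\<integral>u. cosine_transform \<mu> u \<partial>sphere_measure)\<^sup>2"
      by (rule variance_sphere[OF M U UM continuous_on_cosine_transform[OF \<mu>] w])
    show ?thesis unfolding v by (rule has_sum_cosine_transform[OF Y \<mu>])
  qed
  have brightness: "((\<lambda>j. 1 / 4 * ((abs_coeff (2 * j))\<^sup>2 *
          (\<Sum>m = - int (2 * j)..int (2 * j). (cmod (harmonic_coeff Y (even_part S) (2 * j) m))\<^sup>2)))
        has_sum ?V (brightness K)) {1..}"
    if K: "convex_body K" and S: "surface_area_measure K S" for K S
  proof -
    have s: "sets S = sets sphere_borel" "finite_measure S"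
      using S by (auto simp: surface_area_measure_def)
    have e: "sets (even_part S) = sets sphere_borel" "finite_measure (even_part S)"
      using s(1) finite_measure_even_part[OF s] by simp_all
    let ?C = "cosine_transform (even_part S)"
    have b: "brightness K u = 1 / 2 * ?C u" if "u \<in> S2" for u
      using brightness_cosine_transform[OF K S that] cosine_transform_even_part[OF s that] by simp
    have c: "continuous_on S2 (\<lambda>u. 1 / 2 * ?C u)"
      by (intro continuous_intros continuous_on_cosine_transform[OF e])
    have "?V (brightness K) = (\<integral>u. (1 / 2 * ?C u)\<^sup>2 \<partial>sphere_measure) - (\<integral>u. 1 / 2 * ?C u \<partial>sphere_measure)\<^sup>2"
      by (rule variance_sphere[OF M U UM c b])
    also have "\<dots> = 1 / 4 * ((\<integral>u. (?C u)\<^sup>2 \<partial>sphere_measure) - (\<integral>u. ?C u \<partial>sphere_measure)\<^sup>2)"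
      by (simp add: power_mult_distrib power_divide)
    finally have v: "?V (brightness K) = 1 / 4 * ((\<integral>u. (?C u)\<^sup>2 \<partial>sphere_measure) - (\<integral>u. ?C u \<partial>sphere_measure)\<^sup>2)" .
    show ?thesis unfolding v by (rule has_sum_cmult_right[OF has_sum_cosine_transform[OF Y e]])
  qed
  have band: "(\<Sum>l \<in> {l. 2 \<le> l \<and> l \<le> L \<and> even l}.
          \<Sum>m = - int l..int l. (cmod (harmonic_coeff Y \<mu> l m))\<^sup>2)
        \<le> ?V (width Z) / Min ((\<lambda>l. \<bar>abs_coeff l\<bar>\<^sup>2) ` {l. 2 \<le> l \<and> l \<le> L \<and> even l})"
    if L: "even L" "L \<ge> 2" and Z: "generating_measure Z \<mu>" for L Z \<mu>
  proof -
    let ?A = "{l. 2 \<le> l \<and> l \<le> L \<and> even l}"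
    define s where "s l = (\<Sum>m = - int l..int l. (cmod (harmonic_coeff Y \<mu> l m))\<^sup>2)" for l
    define a where "a = Min ((\<lambda>l. \<bar>abs_coeff l\<bar>\<^sup>2) ` ?A)"
    have s0: "s l \<ge> 0" for l unfolding s_def by (intro sum_nonneg) simp
    have fin: "finite ?A" by (rule finite_subset[of _ "{..L}"]) auto
    have "a \<in> (\<lambda>l. \<bar>abs_coeff l\<bar>\<^sup>2) ` ?A" unfolding a_def using fin L by (intro Min_in) auto
    \<comment> \<open>The minimum is attained at one of the even degrees up to L, and there the
      coefficient is nonzero.\<close>
    then have a0: "a > 0" using abs_coeff_nonzero by auto
    have le: "a \<le> (abs_coeff l)\<^sup>2" if "l \<in> ?A" for l
      using Min_le[of "(\<lambda>l. \<bar>abs_coeff l\<bar>\<^sup>2) ` ?A" "\<bar>abs_coeff l\<bar>\<^sup>2"] fin that by (simp add: a_def)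
    have A: "?A = (\<lambda>j. 2 * j) ` {1..L div 2}"
    proof (intro set_eqI iffI)
      fix l assume l: "l \<in> ?A"
      then obtain j where "l = 2 * j" by (auto elim: evenE)
      then show "l \<in> (\<lambda>j. 2 * j) ` {1..L div 2}" using l by auto
    qed auto
    have "a * (\<Sum>l\<in>?A. s l) \<le> (\<Sum>l\<in>?A. (abs_coeff l)\<^sup>2 * s l)"
      unfolding sum_distrib_left using le s0 by (intro sum_mono mult_right_mono) auto
    also have "\<dots> = (\<Sum>j\<in>{1..L div 2}. (abs_coeff (2 * j))\<^sup>2 * s (2 * j))"
      unfolding A by (subst sum.reindex) (auto simp: inj_on_def)
    also have "\<dots> \<le> ?V (width Z)"
      by (rule finite_sum_le_has_sum[OF width[OF Z, folded s_def]]) (auto simp: s0)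
    finally show ?thesis unfolding a_def[symmetric] s_def[symmetric] using a0 by (simp add: field_simps)
  qed
  have "\<not> (\<exists>C::real. \<forall>Z \<mu>. zonoid Z \<and> generating_measure Z \<mu> \<longrightarrow>
      (\<Sum>\<^sub>\<infinity>l \<in> {l. 2 \<le> l \<and> even l}.
          ennreal (\<Sum>m = - int l..int l. (cmod (harmonic_coeff Y \<mu> l m))\<^sup>2))
        \<le> ennreal (C * ?V (width Z)))"
  proof (rule notI, elim exE)
    fix C :: real
    assume C: "\<forall>Z \<mu>. zonoid Z \<and> generating_measure Z \<mu> \<longrightarrow>
      (\<Sum>\<^sub>\<infinity>l \<in> {l. 2 \<le> l \<and> even l}. ennreal (\<Sum>m = - int l..int l. (cmod (harmonic_coeff Y \<mu> l m))\<^sup>2))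
        \<le> ennreal (C * ?V (width Z))"
    obtain Z \<mu> where Z: "zonoid Z" "generating_measure Z \<mu>"
      and inf: "(\<Sum>\<^sub>\<infinity>l \<in> {l. 2 \<le> l \<and> even l}. ennreal (\<Sum>m = - int l..int l. (cmod (harmonic_coeff Y \<mu> l m))\<^sup>2)) = \<infinity>"
      using no_uniform_estimate[OF Y] by blast
    \<comment> \<open>\<open>ennreal\<close> of a real number is finite, whatever the sign of
      C.\<close>
    have "(\<infinity> :: ennreal) \<le> ennreal (C * ?V (width Z))"
      using C[rule_format, OF conjI[OF Z]] unfolding inf .
    then show False by (simp add: top_unique)
  qed
  then show ?thesis
    using width brightness band abs_coeff_0 abs_coeff_odd abs_coeff_double_factorial abs_coeff_values
      kernel2_expansion abs_coeff_tendsto_0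
    by (intro conjI allI impI ballI) (simp_all only: simp_thms)
qed

end
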